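(* Let $\alpha$ and $\beta$ be compositions, both of length $R$ and size $N$, with $\alpha\neq(1^R)$. Let $\nu$ be a partition of $N$ with $\nu_3\le 1$, written $\nu=ab1^d$ (that is, $\nu_1=a$, $\nu_2=b$, and $\nu$ has exactly $d\ge 0$ further parts, all equal to $1$). Then $r_\alpha-r_\beta=s_\nu$ if and only if $b\ge 2$ and there exist $\tilde\alpha\in\{\alpha,\alpha^*\}$ and $\tilde\beta\in\{\beta,\beta^*\}$ such that $(\tilde\alpha,\tilde\beta)$ is one of the following five pairs: (1) $\tilde\alpha=(b,1^d,a)$, $\tilde\beta=(b-1,1^d,a+1)$; (2) $\tilde\alpha=(a,b,1^d)$, $\tilde\beta=(b-1,a+1,1^d)$; (3) $\tilde\alpha=(1^{d+1},a,b-1)$, $\tilde\beta=(1^{d+1},b-1,a)$; (4) $\tilde\alpha=(1,a,1^d,b-1)$, $\tilde\beta=(1,b-1,1^d,a)$; (5) $\tilde\alpha=(b-1,1^d,b,a-b+1)$, $\tilde\beta=(b,1^d,b-1,a-b+1)$.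
   Context: A composition is a finite sequence $\alpha=\alpha_1\cdots\alpha_R$ of positive integers; $R$ is its length and $\sum\alpha_i$ its size; $j^m$ denotes $m$ consecutive parts equal to $j$ (omitted if $m=0$). The reverse is $\alpha^*=\alpha_R\cdots\alpha_1$. The ribbon diagram of $\alpha$ (English convention, rows numbered from the top) is the connected array of cells with $\alpha_i$ cells in row $i$, where the rightmost cell of row $i+1$ lies directly below the leftmost cell of row $i$. A semistandard Young tableau (SSYT) of this shape is a filling by positive integers, weakly increasing along rows left to right and strictly increasing down columns. The ribbon Schur function is $r_\alpha=\sum_T x^{T}$, summing over SSYT $T$ of ribbon shape $\alpha$, where $x^T=\prod_i x_i^{\#\{i\text{'s in }T\}}$; $s_\nu$ denotes the Schur function of the partition $\nu$. *)

theory Defs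
  imports "HOL-Library.Multiset" "HOL-Library.FuncSet"
begin

definition composition :: "nat list \<Rightarrow> bool" where
  "composition \<alpha> \<longleftrightarrow> (\<forall>p\<in>set \<alpha>. 0 < p)"

definition is_partition :: "nat list \<Rightarrow> bool" where
  "is_partition \<nu> \<longleftrightarrow> (\<forall>p\<in>set \<nu>. 0 < p) \<and> sorted_wrt (\<ge>) \<nu>"

text \<open>The \<open>i\<close>-th part counts from 1, and is 0 beyond the last part.\<close>

definition part :: "nat list \<Rightarrow> nat \<Rightarrow> nat" where
  "part \<nu> i = (if 1 \<le> i \<and> i \<le> length \<nu> then \<nu> ! (i - 1) else 0)"

text \<open>A cell is a pair (row, column) of matrix coordinates counted from 0, rows downwards
  and columns to the right.\<close>

type_synonym diagram = "(nat \<times> nat) set"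

definition young_diagram :: "nat list \<Rightarrow> diagram" where
  "young_diagram \<nu> = {(i, j). i < length \<nu> \<and> j < \<nu> ! i}"

text \<open>The last row of the ribbon starts in column 0. Going up from row \<open>k\<close> to row \<open>k - 1\<close>,
  the leftmost column moves right by \<open>\<alpha> ! k - 1\<close>, as the new row starts above the rightmost
  cell of row \<open>k\<close>; see \<open>ribbon_overlap\<close> below.\<close>

definition ribbon_start :: "nat list \<Rightarrow> nat \<Rightarrow> nat" where
  "ribbon_start \<alpha> i = (\<Sum>k\<in>{i<..<length \<alpha>}. \<alpha> ! k - 1)"

definition ribbon_diagram :: "nat list \<Rightarrow> diagram" where
  "ribbon_diagram \<alpha> =
     {(i, j). i < length \<alpha> \<and> ribbon_start \<alpha> i \<le> j \<and> j < ribbon_start \<alpha> i + \<alpha> ! i}"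

lemma ribbon_overlap:
  assumes "composition \<alpha>" and "Suc i < length \<alpha>"
  shows "ribbon_start \<alpha> (Suc i) + \<alpha> ! Suc i - 1 = ribbon_start \<alpha> i"
proof -
  have "{i<..<length \<alpha>} = insert (Suc i) {Suc i<..<length \<alpha>}"
    using assms(2) by auto
  moreover have "0 < \<alpha> ! Suc i"
    using assms unfolding composition_def by simp
  ultimately show ?thesis
    unfolding ribbon_start_def by simp
qed

definition ssyt :: "diagram \<Rightarrow> (nat \<times> nat \<Rightarrow> nat) set" where
  "ssyt D = {T \<in> D \<rightarrow>\<^sub>E {1..}.
     (\<forall>i j j'. (i, j) \<in> D \<longrightarrow> (i, j') \<in> D \<longrightarrow> j < j' \<longrightarrow> T (i, j) \<le> T (i, j')) \<and>
     (\<forall>i i' j. (i, j) \<in> D \<longrightarrow> (i', j) \<in> D \<longrightarrow> i < i' \<longrightarrow> T (i, j) < T (i', j))}"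

text \<open>A formal power series over the integers in the variables \<open>x\<^sub>1, x\<^sub>2, \<dots>\<close> is represented by
  its coefficient function, where the multiset \<open>m\<close> stands for the monomial in which \<open>x\<^sub>i\<close> has
  exponent \<open>count m i\<close>. Subtraction and equality of series are those of functions.\<close>

type_synonym series = "nat multiset \<Rightarrow> int"

definition content :: "diagram \<Rightarrow> (nat \<times> nat \<Rightarrow> nat) \<Rightarrow> nat multiset" where
  "content D T = image_mset T (mset_set D)"

definition tableau_series :: "diagram \<Rightarrow> series" where
  "tableau_series D = (\<lambda>m. int (card {T \<in> ssyt D. content D T = m}))"

definition schur :: "nat list \<Rightarrow> series" where
  "schur \<nu> = tableau_series (young_diagram \<nu>)"

definition ribbon_schur :: "nat list \<Rightarrow> series" where
  "ribbon_schur \<alpha> = tableau_series (ribbon_diagram \<alpha>)"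

text \<open>The cardinalities above are those of finite sets.\<close>

lemma finite_young_diagram: "finite (young_diagram \<nu>)"
proof -
  have "young_diagram \<nu> = (SIGMA i:{..<length \<nu>}. {..<\<nu> ! i})"
    unfolding young_diagram_def by auto
  then show ?thesis by simp
qed

lemma finite_ribbon_diagram: "finite (ribbon_diagram \<alpha>)"
proof -
  have "ribbon_diagram \<alpha> =
      (SIGMA i:{..<length \<alpha>}. {ribbon_start \<alpha> i..<ribbon_start \<alpha> i + \<alpha> ! i})"
    unfolding ribbon_diagram_def by auto
  then show ?thesis by simp
qed

lemma finite_ssyt_content:
  assumes "finite D"
  shows "finite {T \<in> ssyt D. content D T = m}"
proof (rule finite_subset)
  show "{T \<in> ssyt D. content D T = m} \<subseteq> D \<rightarrow>\<^sub>E set_mset m"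
  proof
    fix T assume T: "T \<in> {T \<in> ssyt D. content D T = m}"
    then have "set_mset m = T ` D"
      using assms unfolding content_def by auto
    with T show "T \<in> D \<rightarrow>\<^sub>E set_mset m"
      unfolding ssyt_def by (auto simp: PiE_iff)
  qed
  show "finite (D \<rightarrow>\<^sub>E set_mset m)"
    using assms by (simp add: finite_PiE)
qed

end

theory Submission
  imports Defs "HOL-Library.Poly_Mapping" "HOL-Computational_Algebra.Polynomial"
begin

text \<open>Ribbon Schur functions satisfy \<open>r\<^sub>\<gamma> r\<^sub>\<delta> = r\<^bsub>\<gamma>\<cdot>\<delta>\<^esub> + r\<^bsub>\<gamma>\<odot>\<delta>\<^esub>\<close>
  (concatenation and near-concatenation), so \<open>r\<^sub>\<alpha>\<close> is a signed sum of products of complete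
  homogeneous functions over the coarsenings of \<open>\<alpha>\<close>; this is \<open>rib\<close> below. A tail swap gives
  \<open>s\<^sub>\<nu> = h\<^sub>a r\<^bsub>b1^d\<^esub> - h\<^bsub>b-1\<^esub> r\<^bsub>(a+1)1^d\<^esub> = r\<^bsub>ab1^d\<^esub> - r\<^bsub>(b-1)(a+1)1^d\<^esub>\<close>,
  and the five families follow from the product rule.

  Conversely, the \<open>h\<^sub>k\<close> are algebraically independent (via the \<open>e\<^sub>k\<close>, whose products have distinct
  lowest monomials), so an identity between ribbon Schur functions survives when \<open>h\<^sub>k\<close> is replaced by
  \<open>f k\<close> for an arbitrary \<open>f\<close> into a commutative ring. Taking \<open>f k = x^k + t (1 + x + \<dots> + x^(k-1))\<close>
  makes \<open>r\<^sub>\<alpha>\<close> a product of factors attached to the rows, in which the two end rows play a special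
  role; its two lowest orders in \<open>t\<close> determine the end rows and the multiset of the other rows, and in
  particular show that the length of \<open>\<alpha>\<close> is at most \<open>d + 3\<close>. The positions of the rows
  longer than 1 are then found from the partial sums, the sums of adjacent
  parts, and the numerical specialisation \<open>f 1 = 3\<close>, \<open>f k = 4\<close> for \<open>k \<ge> 2\<close>.\<close>

section \<open>Alternating sums over coarsenings\<close>

text \<open>Positions are the difficulty. The product of row factors is symmetric in the middle
  rows, so the substitution with \<open>t\<close> sees only their multiset, and other substitutions
  must locate the long rows. Putting \<open>f k\<close> equal to \<open>g k\<close> times a variable
  grades the coarsenings by their number of parts: the quadratic coefficient sees the proper partial
  sums, the coefficient just below the top sees the sums of adjacent parts. The values 3, 4, 4, ...
  ignore how long a long row is and depend polynomially on the runs of ones, which leaves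
  Diophantine equations with few solutions. With \<open>r\<close> the excess of the length over
  \<open>d + 2\<close>, the sign in the end-row identity is \<open>(-1)^r\<close>, so \<alpha> leads
  in it for even \<open>r\<close> and \<beta> for odd \<open>r\<close>. The case
  \<open>b = 2\<close> stands apart, since the part \<open>b - 1\<close> is then itself a 1 and is
  absorbed into the runs of ones. Hooks, that is \<open>b \<le> 1\<close>, are excluded by putting
  every \<open>f k\<close> equal to 2, which gives every nonempty ribbon the value 2.\<close>

fun rib :: "(nat \<Rightarrow> 'a::comm_ring_1) \<Rightarrow> nat list \<Rightarrow> 'a" where
  "rib f [] = 1"
| "rib f [k] = f k"
| "rib f (k # l # \<gamma>) = f k * rib f (l # \<gamma>) - rib f ((k + l) # \<gamma>)"

text \<open>The recursion of \<open>rib\<close> both drops the first part and merges it into the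
  second. The results have the same length, one less than before, so the induction runs on the
  length of \<gamma> and not on its structure.\<close>

lemma rib_mult: "rib f (\<gamma> @ [k]) * rib f (l # \<delta>) = rib f (\<gamma> @ k # l # \<delta>) + rib f (\<gamma> @ (k + l) # \<delta>)"
proof (induction "length \<gamma>" arbitrary: \<gamma>)
  case 0
  then show ?case by simp
next
  case (Suc n)
  then obtain m \<gamma>' where \<gamma>: "\<gamma> = m # \<gamma>'" "length \<gamma>' = n" by (cases \<gamma>) auto
  show ?case
  proof (cases \<gamma>')
    case Nil
    then show ?thesis using \<gamma> by (simp add: algebra_simps)
  next
    case (Cons m' \<gamma>'')
    have "rib f (((m + m') # \<gamma>'') @ [k]) * rib f (l # \<delta>)
        = rib f (((m + m') # \<gamma>'') @ k # l # \<delta>) + rib f (((m + m') # \<gamma>'') @ (k + l) # \<delta>)"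
      using Suc(1)[of "(m + m') # \<gamma>''"] \<gamma> Cons by simp
    moreover have "rib f ((m' # \<gamma>'') @ [k]) * rib f (l # \<delta>)
        = rib f ((m' # \<gamma>'') @ k # l # \<delta>) + rib f ((m' # \<gamma>'') @ (k + l) # \<delta>)"
      using Suc(1)[of "m' # \<gamma>''"] \<gamma> Cons by simp
    ultimately show ?thesis using \<gamma> Cons by (simp add: algebra_simps)
  qed
qed

text \<open>The recursion peels parts off on the left; the product rule with a single part on the
  right is its mirror image.\<close>

lemma rib_rev: "rib f (rev \<gamma>) = rib f \<gamma>"
proof (induction f \<gamma> rule: rib.induct)
  case (3 f k l \<gamma>)
  have "rib f (rev (l # \<gamma>)) * f k = rib f (rev (k # l # \<gamma>)) + rib f (rev ((k + l) # \<gamma>))"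
    using rib_mult[of f "rev \<gamma>" l k "[]"] by (simp add: add.commute)
  then have "rib f (rev (k # l # \<gamma>)) = f k * rib f (rev (l # \<gamma>)) - rib f (rev ((k + l) # \<gamma>))"
    by (simp add: algebra_simps)
  also have "\<dots> = rib f (k # l # \<gamma>)" by (simp only: 3 rib.simps)
  finally show ?case .
qed simp_all

section \<open>The five families\<close>

lemma rib_family1:
  "rib f (b # replicate d 1 @ [a]) - rib f ((b - 1) # replicate d 1 @ [a + 1])
     = rib f (a # b # replicate d 1) - rib f ((b - 1) # (a + 1) # replicate d 1)"
  if "2 \<le> b"
proof (cases d)
  case 0
  then show ?thesis using that by (simp add: algebra_simps)
next
  case (Suc e)
  \<comment> \<open>The two products share the merged term
    \<open>b # replicate e 1 @ [a + 1]\<close>, which cancels in their difference. On the right-hand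
    side the recursion produces the same two products, its merged terms cancelling because
    \<open>(b - 1) + (a + 1) = a + b\<close>.\<close>
  have 1: "rib f (b # replicate d 1) * f a
      = rib f (b # replicate d 1 @ [a]) + rib f (b # replicate e 1 @ [a + 1])"
    using rib_mult[of f "b # replicate e 1" 1 a "[]"] Suc
    by (simp add: replicate_append_same replicate_app_Cons_same del: rib.simps(3))
  have 2: "f (b - 1) * rib f (replicate d 1 @ [a + 1])
      = rib f ((b - 1) # replicate d 1 @ [a + 1]) + rib f (b # replicate e 1 @ [a + 1])"
    using that Suc by simp
  have 3: "rib f (replicate d 1 @ [a + 1]) = rib f ((a + 1) # replicate d 1)"
    using rib_rev[of f "replicate d 1 @ [a + 1]"] by simp
  show ?thesis using 1 2 that unfolding 3 by (simp add: algebra_simps)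
qed

text \<open>A column of \<open>d + 1\<close> ones followed by \<open>k\<close> is the column times
  \<open>f k\<close> minus the hook \<open>(k + 1) # replicate d 1\<close>. After substitution, the
  product of the column with \<open>f a\<close> and \<open>f (b - 1)\<close> is symmetric and
  cancels.\<close>

lemma rib_family3:
  "rib f (replicate (d + 1) 1 @ [a, b - 1]) - rib f (replicate (d + 1) 1 @ [b - 1, a])
     = rib f (a # b # replicate d 1) - rib f ((b - 1) # (a + 1) # replicate d 1)"
  if "2 \<le> b"
proof -
  have e: "rib f (replicate (d + 1) 1) * f k
      = rib f (replicate (d + 1) 1 @ [k]) + rib f ((k + 1) # replicate d 1)" for k
    using rib_mult[of f "replicate d 1" 1 k "[]"] rib_rev[of f "replicate d 1 @ [Suc k]"]
    by (simp add: replicate_append_same replicate_app_Cons_same del: rib.simps(3))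
  have m: "rib f (replicate (d + 1) 1 @ [k]) * f l
      = rib f (replicate (d + 1) 1 @ [k, l]) + rib f (replicate (d + 1) 1 @ [k + l])" for k l
    using rib_mult[of f "replicate (d + 1) 1" k l "[]"] by simp
  have *: "rib f (replicate (d + 1) 1 @ [a, b - 1]) - rib f (replicate (d + 1) 1 @ [b - 1, a])
    = rib f (replicate (d + 1) 1 @ [a]) * f (b - 1) - rib f (replicate (d + 1) 1 @ [b - 1]) * f a"
    unfolding m by (simp add: add.commute)
  have 1: "rib f (replicate (d + 1) 1 @ [a]) = rib f (replicate (d + 1) 1) * f a - rib f ((a + 1) # replicate d 1)"
    using e[of a] by (simp add: algebra_simps)
  have 2: "rib f (replicate (d + 1) 1 @ [b - 1])
      = rib f (replicate (d + 1) 1) * f (b - 1) - rib f (b # replicate d 1)"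
    using e[of "b - 1"] that by (simp add: algebra_simps)
  have "rib f (replicate (d + 1) 1 @ [a, b - 1]) - rib f (replicate (d + 1) 1 @ [b - 1, a])
     = f a * rib f (b # replicate d 1) - f (b - 1) * rib f ((a + 1) # replicate d 1)"
    unfolding * 1 2 by (simp add: algebra_simps del: replicate.simps rib.simps replicate_Suc)
  then show ?thesis using that by (simp add: add.commute)
qed

lemma rib_swap_ends: "rib f (k # replicate d 1 @ [l]) = rib f (l # replicate d 1 @ [k])"
  using rib_rev[of f "k # replicate d 1 @ [l]"] by simp

text \<open>Splitting off the leading 1 leaves \<open>f 1\<close> times two ribbons that are
  reverses of each other, hence equal; the merged terms form the first family.\<close>

lemma rib_family4:
  "rib f (1 # a # replicate d 1 @ [b - 1]) - rib f (1 # (b - 1) # replicate d 1 @ [a])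
     = rib f (a # b # replicate d 1) - rib f ((b - 1) # (a + 1) # replicate d 1)"
  if "2 \<le> b"
proof -
  have "rib f (1 # a # replicate d 1 @ [b - 1]) - rib f (1 # (b - 1) # replicate d 1 @ [a])
    = rib f (b # replicate d 1 @ [a]) - rib f ((b - 1) # replicate d 1 @ [a + 1])"
    using that rib_swap_ends[of f a d "b - 1"] rib_swap_ends[of f "Suc a" d "b - 1"] by simp
  then show ?thesis using rib_family1[OF that] by simp
qed

text \<open>The ribbons \<open>(b - 1) # replicate d 1 @ [b]\<close> and
  \<open>b # replicate d 1 @ [b - 1]\<close> are reverses of each other. Multiplying both by
  \<open>f (a - b + 1)\<close> and comparing leaves the wanted difference against the merged terms,
  which form the first family.\<close>

lemma rib_family5:
  "rib f ((b - 1) # replicate d 1 @ [b, a - b + 1]) - rib f (b # replicate d 1 @ [b - 1, a - b + 1])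
     = rib f (a # b # replicate d 1) - rib f ((b - 1) # (a + 1) # replicate d 1)"
  if "2 \<le> b" "b \<le> a"
proof -
  have 1: "rib f ((b - 1) # replicate d 1 @ [b]) * f (a - b + 1)
      = rib f ((b - 1) # replicate d 1 @ [b, a - b + 1]) + rib f ((b - 1) # replicate d 1 @ [a + 1])"
    using that rib_mult[of f "(b - 1) # replicate d 1" b "a - b + 1" "[]"] by simp
  have 2: "rib f (b # replicate d 1 @ [b - 1]) * f (a - b + 1)
      = rib f (b # replicate d 1 @ [b - 1, a - b + 1]) + rib f (b # replicate d 1 @ [a])"
    using that rib_mult[of f "b # replicate d 1" "b - 1" "a - b + 1" "[]"] by simp
  have "rib f ((b - 1) # replicate d 1 @ [b, a - b + 1]) + rib f ((b - 1) # replicate d 1 @ [a + 1])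
      = rib f (b # replicate d 1 @ [b - 1, a - b + 1]) + rib f (b # replicate d 1 @ [a])"
    using 1 2 unfolding rib_swap_ends[of f "b - 1" d b] by (rule box_equals[OF refl])
  moreover have "x - y = v - u" if "x + u = y + v" for x y u v :: 'a
    using that by (simp add: algebra_simps)
  ultimately show ?thesis
    unfolding rib_family1[OF that(1), of f d a, symmetric] by blast
qed

section \<open>Duality of complete and elementary functions\<close>

lemma rib_column_sum:
  assumes "0 < n"
  shows "rib f (replicate n 1) = - (\<Sum>i\<in>{1..n}. (-1) ^ i * f i * rib f (replicate (n - i) 1))"
proof -
  \<comment> \<open>Each product of \<open>f k\<close> with a column is a sum of two hooks with
    first rows \<open>k\<close> and \<open>k + 1\<close>, so the alternating sum telescopes and its
    tail from \<open>k\<close> on is a single hook.\<close>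
  have "(\<Sum>i\<in>{k..n}. (-1) ^ i * f i * rib f (replicate (n - i) 1)) = (-1) ^ k * rib f (k # replicate (n - k) 1)"
    if "k \<le> n" for k
    using that
  proof (induction rule: inc_induct)
    case base
    then show ?case by simp
  next
    case (step k)
    have "f k * rib f (replicate (n - k) 1)
        = rib f (k # replicate (n - k) 1) + rib f (Suc k # replicate (n - Suc k) 1)"
      using step(2) by (cases "n - k") (auto simp: Suc_diff_Suc[symmetric])
    moreover have "{k..n} = insert k {Suc k..n}" using step(2) by auto
    moreover have "(-1) ^ k * f k * rib f (replicate (n - k) 1) = (-1) ^ k * (f k * rib f (replicate (n - k) 1))"
      by (rule mult.assoc)
    ultimately show ?case using step(2,3) by (simp add: distrib_left del: rib.simps(3))
  qed
  from this[of 1] assms have "(\<Sum>i\<in>{1..n}. (-1) ^ i * f i * rib f (replicate (n - i) 1)) = - rib f (1 # replicate (n - 1) 1)"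
    by simp
  moreover have "1 # replicate (n - 1) 1 = replicate n (1::nat)" using assms by (cases n) auto
  ultimately show ?thesis by simp
qed

text \<open>The relation \<open>\<Sum> (-1)^i h_i e_(n-i) = 0\<close> is symmetric in the two
  families up to sign, so the formula that gives the \<open>e_k\<close> in terms of the
  \<open>h_k\<close> also gives the \<open>h_k\<close> in terms of the \<open>e_k\<close>.\<close>

lemma rib_columns_involution:
  assumes "0 < n"
  shows "rib (\<lambda>k. rib f (replicate k 1)) (replicate n 1) = f n"
  using assms
proof (induction n rule: less_induct)
  case (less n)
  \<comment> \<open>The convention \<open>h_0 = 1\<close>; the value \<open>f 0\<close> is
    arbitrary.\<close>
  define F where "F k = (if k = 0 then 1 else f k)" for k
  let ?g = "\<lambda>k. rib f (replicate k 1)"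
  have "rib ?g (replicate (n - i) 1) = F (n - i)" if "i \<in> {1..n}" for i
    using that less.IH[of "n - i"] by (auto simp: F_def)
  then have 1: "rib ?g (replicate n 1) = - (\<Sum>i\<in>{1..n}. (-1) ^ i * ?g i * F (n - i))"
    using rib_column_sum[OF less.prems, of ?g] by simp
  have 0: "{0..n} = insert 0 {1..n}" by auto
  have "(\<Sum>i\<in>{0..n}. (-1) ^ i * F i * ?g (n - i)) = 0"
    using rib_column_sum[OF less.prems, of f] unfolding 0 by (simp add: F_def)
  then have "0 = (-1) ^ n * (\<Sum>i\<in>{0..n}. (-1) ^ i * F i * ?g (n - i))" by simp
  also have "(\<Sum>i\<in>{0..n}. (-1) ^ i * F i * ?g (n - i)) = (\<Sum>i\<in>{0..n}. (-1) ^ (n - i) * F (n - i) * ?g i)"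
    by (rule sum.reindex_bij_witness[of _ "\<lambda>i. n - i" "\<lambda>i. n - i"]) auto
  also have "(-1) ^ n * \<dots> = (\<Sum>i\<in>{0..n}. (-1) ^ i * ?g i * F (n - i))"
    unfolding sum_distrib_left
  proof (rule sum.cong[OF refl])
    fix i assume "i \<in> {0..n}"
    then obtain m where "n = i + m" by (auto simp: le_iff_add)
    then have *: "(-1) ^ n * (-1) ^ (n - i) = ((-1) ^ i :: 'a)"
      by (simp add: power_add mult.assoc flip: power_mult_distrib)
    have "(-1) ^ n * ((-1) ^ (n - i) * F (n - i) * ?g i) = ((-1) ^ n * (-1) ^ (n - i)) * (F (n - i) * ?g i)"
      by (simp only: mult.assoc)
    then show "(-1) ^ n * ((-1) ^ (n - i) * F (n - i) * ?g i) = (-1) ^ i * ?g i * F (n - i)"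
      unfolding * by (simp only: mult_ac)
  qed
  finally have "F n = - (\<Sum>i\<in>{1..n}. (-1) ^ i * ?g i * F (n - i))"
    unfolding 0 by (simp add: eq_neg_iff_add_eq_0)
  then show ?case using 1 less.prems by (simp add: F_def)
qed

section \<open>Words and ribbon tableaux\<close>

definition semistandard :: "diagram \<Rightarrow> (nat \<times> nat \<Rightarrow> nat) \<Rightarrow> bool" where
  "semistandard D T \<longleftrightarrow>
     (\<forall>i j j'. (i, j) \<in> D \<longrightarrow> (i, j') \<in> D \<longrightarrow> j < j' \<longrightarrow> T (i, j) \<le> T (i, j')) \<and>
     (\<forall>i i' j. (i, j) \<in> D \<longrightarrow> (i', j) \<in> D \<longrightarrow> i < i' \<longrightarrow> T (i, j) < T (i', j))"

definition tableau_poly :: "(nat \<Rightarrow> 'a::comm_ring_1) \<Rightarrow> nat \<Rightarrow> diagram \<Rightarrow> 'a" where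
  "tableau_poly x n D = (\<Sum>T | T \<in> D \<rightarrow>\<^sub>E {1..n} \<and> semistandard D T. \<Prod>c\<in>D. x (T c))"

definition word_sum :: "(nat \<Rightarrow> 'a::comm_ring_1) \<Rightarrow> nat \<Rightarrow> (nat list \<Rightarrow> bool) \<Rightarrow> 'a" where
  "word_sum x n P = (\<Sum>w | set w \<subseteq> {1..n} \<and> P w. prod_list (map x w))"

text \<open>The list \<open>cs\<close> is a reading order of the cells. It identifies fillings with
  words of one fixed length, for which concatenation corresponds to multiplication.\<close>

lemma tableau_poly_eq_word_sum:
  assumes "distinct cs" and D: "set cs = D"
    and P: "\<And>T. semistandard D T \<longleftrightarrow> P (map T cs)"
    and len: "\<And>w. P w \<Longrightarrow> length w = length cs"
  shows "tableau_poly x n D = word_sum x n P"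
  unfolding tableau_poly_def word_sum_def
proof (rule sym, rule sum.reindex_bij_betw[symmetric, THEN trans])
  let ?f = "\<lambda>T. map T cs"
  let ?A = "{T. T \<in> D \<rightarrow>\<^sub>E {1..n} \<and> semistandard D T}" and ?B = "{w. set w \<subseteq> {1..n} \<and> P w}"
  show "bij_betw ?f ?A ?B"
    unfolding bij_betw_def
  proof
    show "inj_on ?f ?A"
    proof (rule inj_onI)
      fix T T' assume "T \<in> ?A" "T' \<in> ?A" "map T cs = map T' cs"
      then show "T = T'" using D by (intro PiE_ext[of T D "\<lambda>_. {1..n}" T']) auto
    qed
    show "?f ` ?A = ?B"
    proof
      show "?f ` ?A \<subseteq> ?B" using D P by (auto simp: PiE_iff)
      show "?B \<subseteq> ?f ` ?A"
      proof
        fix w assume w: "w \<in> ?B"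
        define T where "T = (\<lambda>c. if c \<in> D then the (map_of (zip cs w) c) else undefined)"
        have l: "length w = length cs" using w len by auto
        have "T (cs ! i) = w ! i" if "i < length cs" for i
          using that l assms(1) D unfolding T_def by (auto simp: map_of_zip_nth)
        then have m: "map T cs = w" using l by (auto intro: nth_equalityI)
        have "T c \<in> set w" if "c \<in> D" for c
          using that D unfolding m[symmetric] by auto
        moreover have "T c = undefined" if "c \<notin> D" for c using that unfolding T_def by auto
        ultimately have "T \<in> D \<rightarrow>\<^sub>E {1..n}" using w by (intro PiE_I) blast+
        then show "w \<in> ?f ` ?A" using w m P by force
      qed
    qed
  qed
  have "(\<Prod>c\<in>D. x (T c)) = prod_list (map x (map T cs))" for T
    using prod.distinct_set_conv_list[OF assms(1), of "\<lambda>c. x (T c)"] D by (simp add: comp_def)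
  then show "(\<Sum>T\<in>?A. prod_list (map x (map T cs))) = (\<Sum>T\<in>?A. \<Prod>c\<in>D. x (T c))" by simp
qed

lemma finite_words:
  assumes "\<And>w. P w \<Longrightarrow> length w = l"
  shows "finite {w. set w \<subseteq> {1..n::nat} \<and> P w}"
  using finite_lists_length_eq[of "{1..n}" l] assms by (auto elim!: rev_finite_subset)

text \<open>Reading each row from right to left, top row first, turns ribbon tableaux into the words
  that ascend strictly exactly at the row ends.\<close>

fun ribbon_word :: "nat list \<Rightarrow> nat list \<Rightarrow> bool" where
  "ribbon_word [] w \<longleftrightarrow> w = []"
| "ribbon_word [k] w \<longleftrightarrow> length w = k \<and> sorted_wrt (\<ge>) w"
| "ribbon_word (k # l # \<gamma>) w \<longleftrightarrow> (\<exists>u v. w = u @ v \<and> ribbon_word [k] u \<and> ribbon_word (l # \<gamma>) v \<and> last u < hd v)"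

lemma ribbon_word_length: "ribbon_word \<gamma> w \<Longrightarrow> length w = sum_list \<gamma>"
  by (induction \<gamma> w rule: ribbon_word.induct) auto

lemma sorted_wrt_ge_append:
  assumes "u \<noteq> []" "v \<noteq> []"
  shows "sorted_wrt (\<ge>) (u @ v) \<longleftrightarrow> sorted_wrt (\<ge>) u \<and> sorted_wrt (\<ge>) v \<and> hd v \<le> (last u :: nat)"
proof -
  obtain u' a where u: "u = u' @ [a]" using assms(1) by (cases u rule: rev_cases) auto
  obtain b v' where v: "v = b # v'" using assms(2) by (cases v) auto
  show ?thesis unfolding u v by (fastforce simp: sorted_wrt_append)
qed

text \<open>Cutting the long row after \<open>k\<close> letters leaves a junction that is not an
  ascent, whereas a row end is one. Concatenations of a row with a ribbon word therefore split into
  two classes, which is the product rule on the level of words.\<close>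

lemma ribbon_word_merge:
  assumes "0 < k" "0 < l"
  shows "ribbon_word ((k + l) # \<gamma>) w \<longleftrightarrow>
    (\<exists>u v. w = u @ v \<and> ribbon_word [k] u \<and> ribbon_word (l # \<gamma>) v \<and> \<not> last u < hd v)"
proof (cases \<gamma>)
  case Nil
  show ?thesis
  proof
    assume w: "ribbon_word ((k + l) # \<gamma>) w"
    then have "sorted_wrt (\<ge>) (take k w @ drop k w)" using Nil by simp
    then have "sorted_wrt (\<ge>) (take k w) \<and> sorted_wrt (\<ge>) (drop k w) \<and> hd (drop k w) \<le> last (take k w)"
      using w Nil assms by (subst (asm) sorted_wrt_ge_append) auto
    then show "\<exists>u v. w = u @ v \<and> ribbon_word [k] u \<and> ribbon_word (l # \<gamma>) v \<and> \<not> last u < hd v"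
      using w Nil by (intro exI[of _ "take k w"] exI[of _ "drop k w"]) auto
  next
    assume "\<exists>u v. w = u @ v \<and> ribbon_word [k] u \<and> ribbon_word (l # \<gamma>) v \<and> \<not> last u < hd v"
    then obtain u v where uv: "w = u @ v" "ribbon_word [k] u" "ribbon_word (l # \<gamma>) v" "hd v \<le> last u" by auto
    then have "u \<noteq> []" "v \<noteq> []" using assms Nil by auto
    then show "ribbon_word ((k + l) # \<gamma>) w" using uv Nil by (simp add: sorted_wrt_ge_append)
  qed
next
  case (Cons m \<gamma>')
  show ?thesis
  proof
    assume "ribbon_word ((k + l) # \<gamma>) w"
    then obtain u v where uv: "w = u @ v" "length u = k + l" "sorted_wrt (\<ge>) u" "ribbon_word \<gamma> v" "last u < hd v"
      using Cons by auto
    from uv(3) have "sorted_wrt (\<ge>) (take k u @ drop k u)" by simp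
    then have "sorted_wrt (\<ge>) (take k u) \<and> sorted_wrt (\<ge>) (drop k u) \<and> hd (drop k u) \<le> last (take k u)"
      using uv(2) assms by (subst (asm) sorted_wrt_ge_append) auto
    then show "\<exists>u v. w = u @ v \<and> ribbon_word [k] u \<and> ribbon_word (l # \<gamma>) v \<and> \<not> last u < hd v"
      using uv Cons assms by (intro exI[of _ "take k u"] exI[of _ "drop k u @ v"]) (fastforce simp: last_drop)
  next
    assume "\<exists>u v. w = u @ v \<and> ribbon_word [k] u \<and> ribbon_word (l # \<gamma>) v \<and> \<not> last u < hd v"
    then obtain u v v' where uv: "w = u @ v @ v'" "length u = k" "sorted_wrt (\<ge>) u"
      "length v = l" "sorted_wrt (\<ge>) v" "ribbon_word \<gamma> v'" "last v < hd v'" "\<not> last u < hd (v @ v')"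
      using Cons by auto
    moreover from this have "u \<noteq> []" "v \<noteq> []" using assms by auto
    ultimately have "ribbon_word [k + l] (u @ v) \<and> last (u @ v) < hd v'"
      by (simp add: sorted_wrt_ge_append)
    then show "ribbon_word ((k + l) # \<gamma>) w"
      using uv(1,6) unfolding Cons ribbon_word.simps(3)
      by (intro exI[of _ "u @ v"] exI[of _ v'] conjI) simp_all
  qed
qed

lemma word_sum_mult:
  assumes "\<And>w. P w \<Longrightarrow> length w = k" and "\<And>w. Q w \<Longrightarrow> length w = l"
  shows "word_sum x n P * word_sum x n Q = word_sum x n (\<lambda>w. \<exists>u v. w = u @ v \<and> P u \<and> Q v)"
proof -
  define S where "S = {1..n}"
  let ?A = "{w. set w \<subseteq> S \<and> P w}" and ?B = "{w. set w \<subseteq> S \<and> Q w}"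
  let ?C = "{w. set w \<subseteq> S \<and> (\<exists>u v. w = u @ v \<and> P u \<and> Q v)}"
  have "bij_betw (\<lambda>(u, v). u @ v) (?A \<times> ?B) ?C"
    unfolding bij_betw_def
  proof
    show "inj_on (\<lambda>(u, v). u @ v) (?A \<times> ?B)" using assms by (auto simp: inj_on_def)
    show "(\<lambda>(u, v). u @ v) ` (?A \<times> ?B) = ?C"
    proof
      show "?C \<subseteq> (\<lambda>(u, v). u @ v) ` (?A \<times> ?B)"
      proof
        fix w assume "w \<in> ?C"
        then obtain u v where "w = u @ v" "(u, v) \<in> ?A \<times> ?B" by auto
        then show "w \<in> (\<lambda>(u, v). u @ v) ` (?A \<times> ?B)" by (intro image_eqI[of _ _ "(u, v)"]) simp_all
      qed
    qed auto
  qed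
  then have "word_sum x n (\<lambda>w. \<exists>u v. w = u @ v \<and> P u \<and> Q v)
     = (\<Sum>(u, v)\<in>?A \<times> ?B. prod_list (map x u) * prod_list (map x v))"
    unfolding word_sum_def S_def[symmetric] by (subst sum.reindex_bij_betw[symmetric], assumption) (auto intro!: sum.cong)
  then show ?thesis
    unfolding word_sum_def S_def[symmetric] by (simp add: sum_product sum.cartesian_product)
qed

lemma word_sum_split:
  assumes "\<And>w. P w \<Longrightarrow> length w = l"
    and "\<And>w. P w \<longleftrightarrow> Q w \<or> Q' w" and "\<And>w. \<not> (Q w \<and> Q' w)"
  shows "word_sum x n P = word_sum x n Q + word_sum x n Q'"
proof -
  have "{w. set w \<subseteq> {1..n} \<and> P w} = {w. set w \<subseteq> {1..n} \<and> Q w} \<union> {w. set w \<subseteq> {1..n} \<and> Q' w}"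
    using assms(2) by auto
  moreover have "finite {w. set w \<subseteq> {1..n} \<and> P w}" using assms(1) by (rule finite_words)
  ultimately show ?thesis
    unfolding word_sum_def using assms(3) by (auto intro!: sum.union_disjoint)
qed

lemma word_sum_ribbon_word:
  "composition \<gamma> \<Longrightarrow> word_sum x n (ribbon_word \<gamma>) = rib (\<lambda>k. word_sum x n (ribbon_word [k])) \<gamma>"
proof (induction "\<lambda>k. word_sum x n (ribbon_word [k])" \<gamma> rule: rib.induct)
  case 1
  have "{w. set w \<subseteq> {1..n} \<and> w = []} = {[]}" by auto
  then show ?case by (simp add: word_sum_def)
next
  case (3 k l \<gamma>)
  have c: "0 < k" "0 < l" "composition (l # \<gamma>)" "composition ((k + l) # \<gamma>)"
    using 3(3) by (auto simp: composition_def)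
  have "word_sum x n (ribbon_word [k]) * word_sum x n (ribbon_word (l # \<gamma>))
      = word_sum x n (\<lambda>w. \<exists>u v. w = u @ v \<and> ribbon_word [k] u \<and> ribbon_word (l # \<gamma>) v)"
    by (rule word_sum_mult[of _ k _ "sum_list (l # \<gamma>)"]) (auto dest: ribbon_word_length)
  also have "\<dots> = word_sum x n (ribbon_word (k # l # \<gamma>)) + word_sum x n (ribbon_word ((k + l) # \<gamma>))"
  proof (rule word_sum_split[of _ "sum_list (k # l # \<gamma>)"])
    fix w
    show "(\<exists>u v. w = u @ v \<and> ribbon_word [k] u \<and> ribbon_word (l # \<gamma>) v) \<Longrightarrow> length w = sum_list (k # l # \<gamma>)"
      by (auto dest: ribbon_word_length)
    show "(\<exists>u v. w = u @ v \<and> ribbon_word [k] u \<and> ribbon_word (l # \<gamma>) v)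
        \<longleftrightarrow> ribbon_word (k # l # \<gamma>) w \<or> ribbon_word ((k + l) # \<gamma>) w"
      unfolding ribbon_word_merge[OF c(1,2)] ribbon_word.simps(3) by blast
    have "u = u' \<and> v = v'" if "u @ v = u' @ v'" "ribbon_word [k] u" "ribbon_word [k] u'" for u v u' v' :: "nat list"
      using that by simp
    then show "\<not> (ribbon_word (k # l # \<gamma>) w \<and> ribbon_word ((k + l) # \<gamma>) w)"
      unfolding ribbon_word_merge[OF c(1,2)] ribbon_word.simps(3) by metis
  qed
  finally show ?case using 3(1)[OF c(3)] 3(2)[OF c(4)] by (simp only: rib.simps) simp
qed simp

text \<open>Stated for any top row \<open>J\<close> on any diagram \<open>D'\<close>, so that
  ribbons, hooks and two-row shapes can all be treated row by row.\<close>

lemma semistandard_stack: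
  assumes "\<And>i j. (i, j) \<in> D \<longleftrightarrow> (case i of 0 \<Rightarrow> j \<in> J | Suc i' \<Rightarrow> (i', j) \<in> D')"
  shows "semistandard D T \<longleftrightarrow> (\<forall>j\<in>J. \<forall>j'\<in>J. j < j' \<longrightarrow> T (0, j) \<le> T (0, j')) \<and>
    semistandard D' (\<lambda>(i, j). T (Suc i, j)) \<and> (\<forall>j\<in>J. \<forall>i. (i, j) \<in> D' \<longrightarrow> T (0, j) < T (Suc i, j))"
proof
  assume s: "semistandard D T"
  have "T (i, j) \<le> T (i, j')" if "(i, j) \<in> D" "(i, j') \<in> D" "j < j'" for i j j'
    using s that unfolding semistandard_def by blast
  note row = this[of 0] this[of "Suc _"]
  have "T (i, j) < T (i', j)" if "(i, j) \<in> D" "(i', j) \<in> D" "i < i'" for i i' j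
    using s that unfolding semistandard_def by blast
  note col = this[of 0 _ "Suc _"] this[of "Suc _" _ "Suc _"]
  show "(\<forall>j\<in>J. \<forall>j'\<in>J. j < j' \<longrightarrow> T (0, j) \<le> T (0, j')) \<and>
    semistandard D' (\<lambda>(i, j). T (Suc i, j)) \<and> (\<forall>j\<in>J. \<forall>i. (i, j) \<in> D' \<longrightarrow> T (0, j) < T (Suc i, j))"
    using row col by (auto simp: semistandard_def assms)
next
  assume s: "(\<forall>j\<in>J. \<forall>j'\<in>J. j < j' \<longrightarrow> T (0, j) \<le> T (0, j')) \<and>
    semistandard D' (\<lambda>(i, j). T (Suc i, j)) \<and> (\<forall>j\<in>J. \<forall>i. (i, j) \<in> D' \<longrightarrow> T (0, j) < T (Suc i, j))"
  show "semistandard D T"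
    unfolding semistandard_def
  proof (intro conjI allI impI)
    fix i j j' assume "(i, j) \<in> D" "(i, j') \<in> D" "j < j'"
    then show "T (i, j) \<le> T (i, j')" using s by (cases i) (auto simp: semistandard_def assms)
  next
    fix i i' j assume "(i, j) \<in> D" "(i', j) \<in> D" "i < i'"
    then show "T (i, j) < T (i', j)" using s by (cases i; cases i') (auto simp: semistandard_def assms)
  qed
qed

section \<open>Rows of ribbon diagrams and their reading words\<close>

lemma ribbon_start_Cons_Suc: "ribbon_start (k # \<gamma>) (Suc i) = ribbon_start \<gamma> i"
proof -
  have "{Suc i<..<Suc (length \<gamma>)} = Suc ` {i<..<length \<gamma>}"
  proof
    show "{Suc i<..<Suc (length \<gamma>)} \<subseteq> Suc ` {i<..<length \<gamma>}"
    proof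
      fix m assume "m \<in> {Suc i<..<Suc (length \<gamma>)}"
      then show "m \<in> Suc ` {i<..<length \<gamma>}" by (intro image_eqI[of _ _ "m - 1"]) auto
    qed
  qed auto
  then show ?thesis unfolding ribbon_start_def by (simp add: sum.reindex)
qed

lemma ribbon_diagram_Cons:
  "(i, j) \<in> ribbon_diagram (k # \<gamma>) \<longleftrightarrow>
    (case i of 0 \<Rightarrow> j \<in> {ribbon_start (k # \<gamma>) 0..<ribbon_start (k # \<gamma>) 0 + k} | Suc i' \<Rightarrow> (i', j) \<in> ribbon_diagram \<gamma>)"
  by (cases i) (auto simp: ribbon_diagram_def ribbon_start_Cons_Suc)

lemma young_diagram_Cons:
  "(i, j) \<in> young_diagram (k # \<gamma>) \<longleftrightarrow> (case i of 0 \<Rightarrow> j \<in> {..<k} | Suc i' \<Rightarrow> (i', j) \<in> young_diagram \<gamma>)"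
  by (cases i) (auto simp: young_diagram_def)

lemma ribbon_start_Cons_Cons:
  "composition (k # l # \<gamma>) \<Longrightarrow> ribbon_start (k # l # \<gamma>) 0 = ribbon_start (l # \<gamma>) 0 + (l - 1)"
  using ribbon_overlap[of "k # l # \<gamma>" 0] by (simp add: ribbon_start_Cons_Suc composition_def)

text \<open>Rows move weakly to the left on the way down, and neighbours overlap in one column. This
  confines the column conditions between rows that are not adjacent.\<close>

lemma ribbon_diagram_lower_rows:
  "composition \<gamma> \<Longrightarrow> (Suc i, j) \<in> ribbon_diagram \<gamma> \<Longrightarrow> j \<le> ribbon_start \<gamma> 0"
proof (induction \<gamma> arbitrary: i)
  case Nil
  then show ?case by (simp add: ribbon_diagram_def)
next
  case (Cons k \<gamma>)
  have ij: "(i, j) \<in> ribbon_diagram \<gamma>" using Cons.prems(2) by (simp add: ribbon_diagram_Cons)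
  then obtain l \<gamma>' where \<gamma>: "\<gamma> = l # \<gamma>'" by (cases \<gamma>) (auto simp: ribbon_diagram_def)
  have s: "ribbon_start (k # \<gamma>) 0 = ribbon_start \<gamma> 0 + (l - 1)"
    using Cons.prems(1) unfolding \<gamma> by (rule ribbon_start_Cons_Cons)
  show ?case
  proof (cases i)
    case 0
    then show ?thesis using ij s unfolding \<gamma> by (auto simp: ribbon_diagram_Cons)
  next
    case (Suc i')
    then have "j \<le> ribbon_start \<gamma> 0" using Cons.IH[of i'] Cons.prems(1) ij by (simp add: composition_def)
    then show ?thesis using s by simp
  qed
qed

fun ribbon_cells :: "nat list \<Rightarrow> (nat \<times> nat) list" where
  "ribbon_cells [] = []"
| "ribbon_cells (k # \<gamma>) =
    map (\<lambda>j. (0, ribbon_start (k # \<gamma>) 0 + (k - Suc j))) [0..<k] @ map (\<lambda>(i, j). (Suc i, j)) (ribbon_cells \<gamma>)"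

lemma set_ribbon_cells: "set (ribbon_cells \<gamma>) = ribbon_diagram \<gamma>"
proof (induction \<gamma>)
  case Nil
  then show ?case by (simp add: ribbon_diagram_def)
next
  case (Cons k \<gamma>)
  have "(i, j) \<in> set (ribbon_cells (k # \<gamma>)) \<longleftrightarrow> (i, j) \<in> ribbon_diagram (k # \<gamma>)" for i j
  proof (cases i)
    case 0
    have "j \<in> (\<lambda>j'. ribbon_start (k # \<gamma>) 0 + (k - Suc j')) ` {0..<k}"
      if "j \<in> {ribbon_start (k # \<gamma>) 0..<ribbon_start (k # \<gamma>) 0 + k}"
      using that by (intro image_eqI[of _ _ "k - Suc (j - ribbon_start (k # \<gamma>) 0)"]) auto
    then show ?thesis using 0 by (auto simp: ribbon_diagram_Cons)
  next
    case (Suc i')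
    then show ?thesis using Cons by (force simp: ribbon_diagram_Cons)
  qed
  then show ?case unfolding set_eq_iff split_paired_All by blast
qed

lemma distinct_ribbon_cells: "distinct (ribbon_cells \<gamma>)"
  by (induction \<gamma>) (auto simp: distinct_map inj_on_def)

lemma length_ribbon_cells: "length (ribbon_cells \<gamma>) = sum_list \<gamma>"
  by (induction \<gamma>) auto

lemma sorted_row_iff:
  "sorted_wrt (\<ge>) (map (\<lambda>j. f (s + (k - Suc j))) [0..<k]) \<longleftrightarrow>
     (\<forall>j\<in>{s..<s + k}. \<forall>j'\<in>{s..<s + k}. j < j' \<longrightarrow> f j \<le> (f j' :: nat))"
proof
  assume s: "sorted_wrt (\<ge>) (map (\<lambda>j. f (s + (k - Suc j))) [0..<k])"
  show "\<forall>j\<in>{s..<s + k}. \<forall>j'\<in>{s..<s + k}. j < j' \<longrightarrow> f j \<le> f j'"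
  proof (intro ballI impI)
    fix j j' assume j: "j \<in> {s..<s + k}" "j' \<in> {s..<s + k}" "j < j'"
    then show "f j \<le> f j'"
      using sorted_wrt_nth_less[OF s, of "k - Suc (j' - s)" "k - Suc (j - s)"] by simp
  qed
next
  assume "\<forall>j\<in>{s..<s + k}. \<forall>j'\<in>{s..<s + k}. j < j' \<longrightarrow> f j \<le> f j'"
  then show "sorted_wrt (\<ge>) (map (\<lambda>j. f (s + (k - Suc j))) [0..<k])"
    by (auto simp: sorted_wrt_iff_nth_less)
qed

lemma semistandard_ribbon:
  "composition \<gamma> \<Longrightarrow> semistandard (ribbon_diagram \<gamma>) T \<longleftrightarrow> ribbon_word \<gamma> (map T (ribbon_cells \<gamma>))"
proof (induction \<gamma> arbitrary: T rule: induct_list012)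
  case 1
  then show ?case by (simp add: semistandard_def ribbon_diagram_def)
next
  case (2 k)
  have [simp]: "ribbon_diagram [] = {}" by (simp add: ribbon_diagram_def)
  show ?case
    unfolding semistandard_stack[OF ribbon_diagram_Cons]
    using sorted_row_iff[of "\<lambda>j. T (0, j)"] by (simp add: comp_def semistandard_def)
next
  case (3 k l \<gamma>)
  let ?s = "ribbon_start (k # l # \<gamma>) 0" and ?T = "\<lambda>(i, j). T (Suc i, j)"
  have c: "composition (l # \<gamma>)" and kl: "0 < k" "0 < l" using 3 by (auto simp: composition_def)
  have s: "?s = ribbon_start (l # \<gamma>) 0 + (l - 1)" using 3 by (intro ribbon_start_Cons_Cons)
  define u where "u = map (\<lambda>j. T (0, ?s + (k - Suc j))) [0..<k]"
  define v where "v = map ?T (ribbon_cells (l # \<gamma>))"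
  have v': "semistandard (ribbon_diagram (l # \<gamma>)) ?T \<longleftrightarrow> ribbon_word (l # \<gamma>) v"
    unfolding v_def using 3(2)[OF c] .
  have w: "map T (ribbon_cells (k # l # \<gamma>)) = u @ v"
    by (simp add: u_def v_def comp_def case_prod_beta')
  have last: "last u = T (0, ?s)" using kl by (simp add: u_def last_map)
  have hd: "hd v = T (Suc 0, ?s)" unfolding v_def s using kl by (simp add: hd_append hd_map upt_conv_Cons)
  have cross: "(\<forall>j\<in>{?s..<?s + k}. \<forall>i. (i, j) \<in> ribbon_diagram (l # \<gamma>) \<longrightarrow> T (0, j) < T (Suc i, j))
      \<longleftrightarrow> last u < hd v" if ss: "semistandard (ribbon_diagram (l # \<gamma>)) ?T"
  proof
    assume "\<forall>j\<in>{?s..<?s + k}. \<forall>i. (i, j) \<in> ribbon_diagram (l # \<gamma>) \<longrightarrow> T (0, j) < T (Suc i, j)"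
    moreover have "(0, ?s) \<in> ribbon_diagram (l # \<gamma>)" using s kl by (simp add: ribbon_diagram_Cons)
    ultimately show "last u < hd v" using kl unfolding last hd by simp
  next
    assume lt: "last u < hd v"
    show "\<forall>j\<in>{?s..<?s + k}. \<forall>i. (i, j) \<in> ribbon_diagram (l # \<gamma>) \<longrightarrow> T (0, j) < T (Suc i, j)"
    proof (intro ballI allI impI)
      fix j i assume j: "j \<in> {?s..<?s + k}" "(i, j) \<in> ribbon_diagram (l # \<gamma>)"
      show "T (0, j) < T (Suc i, j)"
      proof (cases i)
        case 0
        then have "j = ?s" using j s by (auto simp: ribbon_diagram_Cons)
        then show ?thesis using 0 lt unfolding last hd by simp
      next
        case (Suc i')
        \<comment> \<open>A cell below the second row can share a column with the top row only in
          the overlap column, and only when the second row is a single cell. The inequality then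
          passes through that cell.\<close>
        then have "j \<le> ribbon_start (l # \<gamma>) 0" using ribbon_diagram_lower_rows[OF c] j by blast
        then have js: "j = ?s" using j s by simp
        have "(0, ?s) \<in> ribbon_diagram (l # \<gamma>)" using s kl by (simp add: ribbon_diagram_Cons)
        then have "T (Suc 0, j) < T (Suc i, j)"
          using ss j Suc unfolding semistandard_def js by fastforce
        then show ?thesis using lt js unfolding last hd by simp
      qed
    qed
  qed
  have row: "(\<forall>j\<in>{?s..<?s + k}. \<forall>j'\<in>{?s..<?s + k}. j < j' \<longrightarrow> T (0, j) \<le> T (0, j')) \<longleftrightarrow> ribbon_word [k] u"
    unfolding u_def using sorted_row_iff[of "\<lambda>j. T (0, j)" ?s k] by simp
  have "ribbon_word (k # l # \<gamma>) (u @ v) \<longleftrightarrow> ribbon_word [k] u \<and> ribbon_word (l # \<gamma>) v \<and> last u < hd v"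
  proof
    have "length u = k" by (simp add: u_def)
    moreover assume "ribbon_word (k # l # \<gamma>) (u @ v)"
    then obtain u' v' where "u @ v = u' @ v'" "ribbon_word [k] u'" "ribbon_word (l # \<gamma>) v'" "last u' < hd v'"
      unfolding ribbon_word.simps(3) by blast
    ultimately show "ribbon_word [k] u \<and> ribbon_word (l # \<gamma>) v \<and> last u < hd v" by simp
  qed (auto simp only: ribbon_word.simps(3))
  moreover have "semistandard (ribbon_diagram (k # l # \<gamma>)) T \<longleftrightarrow>
      ribbon_word [k] u \<and> semistandard (ribbon_diagram (l # \<gamma>)) ?T \<and>
      (\<forall>j\<in>{?s..<?s + k}. \<forall>i. (i, j) \<in> ribbon_diagram (l # \<gamma>) \<longrightarrow> T (0, j) < T (Suc i, j))"
    unfolding row[symmetric] by (rule semistandard_stack[OF ribbon_diagram_Cons])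
  ultimately show ?case
    unfolding w v'[symmetric] using cross
    by (cases "semistandard (ribbon_diagram (l # \<gamma>)) ?T") (simp_all only: simp_thms)
qed

lemma tableau_poly_ribbon:
  assumes "composition \<gamma>"
  shows "tableau_poly x n (ribbon_diagram \<gamma>) = rib (\<lambda>k. word_sum x n (ribbon_word [k])) \<gamma>"
proof -
  have "tableau_poly x n (ribbon_diagram \<gamma>) = word_sum x n (ribbon_word \<gamma>)"
    by (rule tableau_poly_eq_word_sum[OF distinct_ribbon_cells set_ribbon_cells semistandard_ribbon[OF assms]])
      (simp add: length_ribbon_cells ribbon_word_length)
  then show ?thesis using word_sum_ribbon_word[OF assms] by simp
qed

section \<open>Two-row shapes with a column\<close>

text \<open>Unlike in \<open>ribbon_word\<close>, the row \<open>v\<close> is read from left to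
  right. The column \<open>c\<close> hangs below its first cell, so that \<open>hd v # c\<close> is
  the complete first column.\<close>

definition hook_word :: "nat \<Rightarrow> nat \<Rightarrow> nat list \<Rightarrow> bool" where
  "hook_word b d w \<longleftrightarrow> (\<exists>v c. w = v @ c \<and> length v = b \<and> length c = d \<and> sorted v \<and> sorted_wrt (<) (hd v # c))"

lemma sorted_map_upt_iff: "sorted (map f [0..<k]) \<longleftrightarrow> (\<forall>j\<in>{..<k}. \<forall>j'\<in>{..<k}. j < j' \<longrightarrow> f j \<le> f j')"
  by (auto simp: sorted_wrt_iff_nth_less sorted_iff_nth_mono_less)

lemma young_diagram_column: "(i, j) \<in> young_diagram (replicate d 1) \<longleftrightarrow> i < d \<and> j = 0"
  by (auto simp: young_diagram_def)

lemma semistandard_column: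
  "semistandard (young_diagram (replicate d 1)) T \<longleftrightarrow> sorted_wrt (<) (map (\<lambda>i. T (i, 0)) [0..<d])"
  unfolding semistandard_def young_diagram_column by (auto simp: sorted_wrt_iff_nth_less)

definition hook_cells :: "nat \<Rightarrow> nat \<Rightarrow> (nat \<times> nat) list" where
  "hook_cells b d = map (Pair 0) [0..<b] @ map (\<lambda>i. (Suc i, 0)) [0..<d]"

lemma semistandard_hook:
  assumes "0 < b"
  shows "semistandard (young_diagram (b # replicate d 1)) T \<longleftrightarrow> hook_word b d (map T (hook_cells b d))"
proof -
  define v where "v = map (\<lambda>j. T (0, j)) [0..<b]"
  define c where "c = map (\<lambda>i. T (Suc i, 0)) [0..<d]"
  have vc: "map T (hook_cells b d) = v @ c" by (simp add: hook_cells_def v_def c_def comp_def)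
  have hd: "hd v = T (0, 0)" using assms by (simp add: v_def hd_map upt_conv_Cons)
  have "hook_word b d (v @ c) \<longleftrightarrow> sorted v \<and> sorted_wrt (<) (hd v # c)"
    unfolding hook_word_def using assms by (fastforce simp: v_def c_def)
  moreover have "sorted v \<longleftrightarrow> (\<forall>j\<in>{..<b}. \<forall>j'\<in>{..<b}. j < j' \<longrightarrow> T (0, j) \<le> T (0, j'))"
    unfolding v_def by (rule sorted_map_upt_iff)
  moreover have "sorted_wrt (<) (hd v # c) \<longleftrightarrow>
      semistandard (young_diagram (replicate d 1)) (\<lambda>(i, j). T (Suc i, j)) \<and>
      (\<forall>j\<in>{..<b}. \<forall>i. (i, j) \<in> young_diagram (replicate d 1) \<longrightarrow> T (0, j) < T (Suc i, j))"
    unfolding semistandard_column young_diagram_column hd c_def using assms by auto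
  ultimately show ?thesis
    unfolding vc semistandard_stack[OF young_diagram_Cons] by simp
qed

lemma set_hook_cells: "set (hook_cells b d) = young_diagram (b # replicate d 1)"
proof -
  have "(i, j) \<in> set (hook_cells b d) \<longleftrightarrow> (i, j) \<in> young_diagram (b # replicate d 1)" for i j
    unfolding young_diagram_Cons young_diagram_column
    by (cases i) (auto simp: hook_cells_def)
  then show ?thesis unfolding set_eq_iff split_paired_All by blast
qed

lemma distinct_hook_cells: "distinct (hook_cells b d)"
  by (auto simp: hook_cells_def distinct_map inj_on_def)

lemma hook_ribbon_eq_young: "ribbon_diagram (b # replicate d 1) = young_diagram (b # replicate d 1)"
proof -
  have "(b # replicate d 1) ! k = 1" if "0 < k" "k < Suc d" for k using that by (cases k) auto
  then have "ribbon_start (b # replicate d 1) i = 0" for i by (auto simp: ribbon_start_def)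
  then show ?thesis by (simp add: ribbon_diagram_def young_diagram_def)
qed

text \<open>A hook is both a Young diagram and a ribbon. Its two reading orders give different words
  but the same tableau polynomial.\<close>

lemma word_sum_hook_word:
  assumes "0 < b"
  shows "word_sum x n (hook_word b d) = rib (\<lambda>k. word_sum x n (ribbon_word [k])) (b # replicate d 1)"
proof -
  have "tableau_poly x n (young_diagram (b # replicate d 1)) = word_sum x n (hook_word b d)"
    by (rule tableau_poly_eq_word_sum[OF distinct_hook_cells set_hook_cells semistandard_hook[OF assms]])
      (auto simp: hook_word_def hook_cells_def)
  moreover have "composition (b # replicate d 1)" using assms by (simp add: composition_def)
  ultimately show ?thesis using tableau_poly_ribbon hook_ribbon_eq_young by metis
qed

lemma semistandard_two_rows:
  fixes T :: "nat \<times> nat \<Rightarrow> nat"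
  assumes "0 < b" "b \<le> a"
  shows "semistandard (young_diagram (a # b # replicate d 1)) T \<longleftrightarrow>
    sorted (map (\<lambda>j. T (0, j)) [0..<a]) \<and>
    semistandard (young_diagram (b # replicate d 1)) (\<lambda>(i, j). T (Suc i, j)) \<and>
    (\<forall>j<b. T (0, j) < T (Suc 0, j))"
proof -
  have "(\<forall>j\<in>{..<a}. \<forall>i. (i, j) \<in> young_diagram (b # replicate d 1) \<longrightarrow> T (0, j) < T (Suc i, j)) \<longleftrightarrow>
      (\<forall>j<b. T (0, j) < T (Suc 0, j))"
    if ss: "semistandard (young_diagram (b # replicate d 1)) (\<lambda>(i, j). T (Suc i, j))"
  proof
    assume "\<forall>j\<in>{..<a}. \<forall>i. (i, j) \<in> young_diagram (b # replicate d 1) \<longrightarrow> T (0, j) < T (Suc i, j)"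
    then show "\<forall>j<b. T (0, j) < T (Suc 0, j)" using assms by (auto simp: young_diagram_Cons)
  next
    assume lt: "\<forall>j<b. T (0, j) < T (Suc 0, j)"
    show "\<forall>j\<in>{..<a}. \<forall>i. (i, j) \<in> young_diagram (b # replicate d 1) \<longrightarrow> T (0, j) < T (Suc i, j)"
    proof (intro ballI allI impI)
      fix j i assume ij: "(i, j) \<in> young_diagram (b # replicate d 1)"
      show "T (0, j) < T (Suc i, j)"
      proof (cases i)
        case 0
        then show ?thesis using lt ij by (simp add: young_diagram_Cons)
      next
        case (Suc i')
        then have "j = 0" using ij unfolding young_diagram_Cons young_diagram_column by simp
        moreover have "(0, 0) \<in> young_diagram (b # replicate d 1)" using assms by (simp add: young_diagram_Cons)
        ultimately have "T (Suc 0, j) < T (Suc i, j)"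
          using ss ij Suc unfolding semistandard_def by fastforce
        then show ?thesis using lt assms \<open>j = 0\<close> by fastforce
      qed
    qed
  qed
  then show ?thesis
    unfolding semistandard_stack[OF young_diagram_Cons, of a] sorted_map_upt_iff by blast
qed

text \<open>The tail swap at the first crossing of the two rows, as in the Lindstroem--Gessel--Viennot
  proof of the Jacobi--Trudi identity.\<close>

definition crossing :: "nat list \<Rightarrow> nat list \<Rightarrow> nat" where
  "crossing u v = (LEAST j. j = length u \<or> v ! j \<le> u ! j)"

definition tail_swap :: "nat list \<times> nat list \<Rightarrow> nat list \<times> nat list" where
  "tail_swap = (\<lambda>(u, v). let j = crossing u v in (take j u @ drop (Suc j) v, take (Suc j) v @ drop j u))"

lemma crossing_le: "crossing u v \<le> length u"
  unfolding crossing_def by (rule Least_le) simp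

lemma crossing_before: "i < crossing u v \<Longrightarrow> u ! i < v ! i"
  unfolding crossing_def using not_less_Least by fastforce

lemma crossing_at: "crossing u v < length u \<Longrightarrow> v ! crossing u v \<le> u ! crossing u v"
  unfolding crossing_def by (metis (mono_tags, lifting) LeastI nat_neq_iff)

lemma crossing_eqI:
  assumes "j \<le> length u" "\<And>i. i < j \<Longrightarrow> u ! i < v ! i" "j < length u \<Longrightarrow> v ! j \<le> u ! j"
  shows "crossing u v = j"
  unfolding crossing_def
proof (rule Least_equality)
  show "j = length u \<or> v ! j \<le> u ! j" using assms(1,3) by (cases "j = length u") auto
  show "j \<le> i" if "i = length u \<or> v ! i \<le> u ! i" for i
    using that assms(1) assms(2)[of i] by (metis linorder_not_less not_le)
qed

text \<open>With the crossing at \<open>j\<close>, the upper row keeps \<open>j\<close> entries and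
  the lower row keeps \<open>j + 1\<close>, which changes lengths \<open>(a, b)\<close> into
  \<open>(b - 1, a + 1)\<close>. The lower row never loses its head, so a column hanging below it
  stays strict, and the crossing does not move, so a second swap undoes the first.\<close>

lemma tail_swap:
  assumes "sorted u" "sorted v" "crossing u v < length v" and uv: "tail_swap (u, v) = (u', v')"
  shows "sorted u'" "sorted v'" "length u' = length v - 1" "length v' = length u + 1"
    "hd v' = hd v" "crossing u' v' = crossing u v" "tail_swap (u', v') = (u, v)"
    "mset u' + mset v' = mset u + mset v"
proof -
  define j where "j = crossing u v"
  have u': "u' = take j u @ drop (Suc j) v" and v': "v' = take (Suc j) v @ drop j u"
    using uv by (auto simp: tail_swap_def j_def Let_def)
  have ju: "j \<le> length u" and jv: "j < length v" using crossing_le assms(3) by (auto simp: j_def)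
  have lt: "u ! i < v ! i" if "i < j" for i using that crossing_before j_def by simp
  have at: "v ! j \<le> u ! j" if "j < length u" using that crossing_at j_def by simp
  show "length u' = length v - 1" "length v' = length u + 1" using ju jv by (auto simp: u' v')
  show "hd v' = hd v" using jv by (cases v) (auto simp: v')
  have "x \<le> y" if x: "x \<in> set (take j u)" and y: "y \<in> set (drop (Suc j) v)" for x y
  proof -
    obtain i where i: "i < j" "x = u ! i" using x ju unfolding in_set_conv_nth by auto
    obtain k where "k < length v - Suc j" "y = v ! (Suc j + k)" using y unfolding in_set_conv_nth by auto
    then have "v ! i \<le> y" using i assms(2) by (auto intro!: sorted_nth_mono)
    then show ?thesis using lt[OF i(1)] i(2) by simp
  qed
  then show "sorted u'" using assms(1,2) unfolding u' sorted_append by (auto intro: sorted_wrt_take sorted_wrt_drop)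
  have "x \<le> y" if x: "x \<in> set (take (Suc j) v)" and y: "y \<in> set (drop j u)" for x y
  proof -
    obtain i where i: "i < Suc j" "x = v ! i" using x jv unfolding in_set_conv_nth by auto
    obtain k where k: "k < length u - j" "y = u ! (j + k)" using y unfolding in_set_conv_nth by auto
    have "x \<le> v ! j" using i jv assms(2) by (auto intro!: sorted_nth_mono)
    also have "v ! j \<le> u ! j" using at k by simp
    also have "u ! j \<le> y" using k assms(1) by (auto intro!: sorted_nth_mono)
    finally show ?thesis .
  qed
  then show "sorted v'" using assms(1,2) unfolding v' sorted_append by (auto intro: sorted_wrt_take sorted_wrt_drop)
  show cr: "crossing u' v' = crossing u v"
    unfolding j_def[symmetric]
  proof (rule crossing_eqI)
    show "j \<le> length u'" using ju by (simp add: u')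
    show "u' ! i < v' ! i" if "i < j" for i using that lt ju jv by (simp add: u' v' nth_append)
    show "v' ! j \<le> u' ! j" if "j < length u'"
    proof -
      have "Suc j < length v" using that ju jv by (simp add: u')
      then have "v ! j \<le> v ! Suc j" using assms(2) by (auto intro!: sorted_nth_mono)
      then show ?thesis using that ju jv by (simp add: u' v' nth_append)
    qed
  qed
  have "take j u' @ drop (Suc j) v' = u" "take (Suc j) v' @ drop j u' = v"
    using ju jv by (auto simp: u' v')
  then show "tail_swap (u', v') = (u, v)" unfolding tail_swap_def using cr by (simp add: Let_def j_def)
  have "mset u' + mset v' = (mset (take j u) + mset (drop j u)) + (mset (take (Suc j) v) + mset (drop (Suc j) v))"
    by (simp add: u' v')
  also have "\<dots> = mset u + mset v" by (simp only: union_code[symmetric] append_take_drop_id flip: mset_append)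
  finally show "mset u' + mset v' = mset u + mset v" .
qed

definition row_hook :: "nat set \<Rightarrow> nat \<Rightarrow> nat \<Rightarrow> nat \<Rightarrow> (nat list \<times> nat list \<times> nat list) set" where
  "row_hook S a b d = {(u, v, c). set u \<subseteq> S \<and> set v \<subseteq> S \<and> set c \<subseteq> S \<and>
     length u = a \<and> length v = b \<and> length c = d \<and> sorted u \<and> sorted v \<and> sorted_wrt (<) (hd v # c)}"

definition column_strict :: "nat list \<Rightarrow> nat list \<Rightarrow> bool" where
  "column_strict u v \<longleftrightarrow> (\<forall>j<length v. u ! j < v ! j)"

abbreviation triple_weight :: "(nat \<Rightarrow> 'a::comm_ring_1) \<Rightarrow> nat list \<times> nat list \<times> nat list \<Rightarrow> 'a" where
  "triple_weight x \<equiv> \<lambda>(u, v, c). prod_list (map x u) * prod_list (map x v) * prod_list (map x c)"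

lemma finite_row_hook: "finite (row_hook {1..n} a b d)"
proof -
  let ?L = "\<lambda>k. {w. set w \<subseteq> {1..n} \<and> length w = k}"
  have "row_hook {1..n} a b d \<subseteq> ?L a \<times> ?L b \<times> ?L d" by (auto simp: row_hook_def)
  moreover have "finite (?L a \<times> ?L b \<times> ?L d)" by (intro finite_cartesian_product finite_lists_length_eq) auto
  ultimately show ?thesis by (rule finite_subset)
qed

lemma word_sum_triples:
  "word_sum x n (\<lambda>w. \<exists>u v c. w = u @ v @ c \<and> length u = a \<and> length v = b \<and> length c = d \<and>
     sorted u \<and> sorted v \<and> sorted_wrt (<) (hd v # c) \<and> Q u v)
   = (\<Sum>t\<in>{(u, v, c). (u, v, c) \<in> row_hook {1..n} a b d \<and> Q u v}. triple_weight x t)"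
proof -
  define S where "S = {1..n}"
  let ?A = "{(u, v, c). (u, v, c) \<in> row_hook S a b d \<and> Q u v}"
  let ?B = "{w. set w \<subseteq> S \<and> (\<exists>u v c. w = u @ v @ c \<and> length u = a \<and> length v = b \<and> length c = d \<and>
     sorted u \<and> sorted v \<and> sorted_wrt (<) (hd v # c) \<and> Q u v)}"
  let ?f = "\<lambda>(u, v, c). u @ v @ c"
  have "bij_betw ?f ?A ?B"
    unfolding bij_betw_def
  proof
    show "inj_on ?f ?A" by (auto simp: inj_on_def row_hook_def)
    show "?f ` ?A = ?B"
    proof
      show "?B \<subseteq> ?f ` ?A"
      proof
        fix w assume "w \<in> ?B"
        then obtain u v c where "w = u @ v @ c" "(u, v, c) \<in> ?A" by (auto simp: row_hook_def)
        then show "w \<in> ?f ` ?A" by (intro image_eqI[of _ _ "(u, v, c)"]) simp_all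
      qed
    qed (auto simp: row_hook_def)
  qed
  then show ?thesis
    unfolding word_sum_def S_def[symmetric]
    by (subst sum.reindex_bij_betw[symmetric], assumption) (auto intro!: sum.cong simp: mult.assoc)
qed

text \<open>For row lengths \<open>(b - 1, a + 1)\<close> the default value \<open>length u\<close>
  of \<open>crossing\<close> is still a position in the longer lower row, so every such triple can
  be swapped. The swap pairs all of them with the triples for \<open>(a, b)\<close> whose columns
  fail to be strict.\<close>

lemma sum_crossing_rows:
  assumes "0 < b" "b \<le> a"
  shows "(\<Sum>t\<in>{(u, v, c). (u, v, c) \<in> row_hook S a b d \<and> \<not> column_strict u v}. triple_weight x t)
    = (\<Sum>t\<in>{(u, v, c). (u, v, c) \<in> row_hook S (b - 1) (a + 1) d \<and> True}. triple_weight x t)"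
proof -
  let ?f = "\<lambda>(u, v, c). case tail_swap (u, v) of (u', v') \<Rightarrow> (u', v', c)"
  let ?A = "{(u, v, c). (u, v, c) \<in> row_hook S a b d \<and> \<not> column_strict u v}"
  let ?B = "{(u, v, c). (u, v, c) \<in> row_hook S (b - 1) (a + 1) d \<and> True}"
  have step: "?f (u, v, c) \<in> row_hook S (b' - 1) (a' + 1) d" "?f (?f (u, v, c)) = (u, v, c)"
      "triple_weight x (?f (u, v, c)) = triple_weight x (u, v, c)"
      "case ?f (u, v, c) of (u', v', c') \<Rightarrow> crossing u' v' = crossing u v"
    if t: "(u, v, c) \<in> row_hook S a' b' d" "crossing u v < b'" for u v c a' b'
  proof -
    obtain u' v' where uv: "tail_swap (u, v) = (u', v')" by (cases "tail_swap (u, v)") auto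
    have uvc: "set u \<subseteq> S" "set v \<subseteq> S" "set c \<subseteq> S" "length u = a'" "length v = b'" "length c = d"
      "sorted u" "sorted v" "sorted_wrt (<) (hd v # c)"
      using t(1) by (auto simp: row_hook_def)
    have cv: "crossing u v < length v" using t(2) uvc by simp
    note sw = tail_swap[OF uvc(7,8) cv uv]
    have m: "mset (u' @ v') = mset (u @ v)" using sw(8) by simp
    then have "set (u' @ v') = set (u @ v)" by (rule mset_eq_setD)
    then show "?f (u, v, c) \<in> row_hook S (b' - 1) (a' + 1) d"
      using uvc sw uv by (auto simp: row_hook_def)
    show "?f (?f (u, v, c)) = (u, v, c)" using sw uv by simp
    have "prod_mset (image_mset x (mset (u' @ v'))) = prod_mset (image_mset x (mset (u @ v)))" unfolding m ..
    then show "triple_weight x (?f (u, v, c)) = triple_weight x (u, v, c)"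
      unfolding uv mset_map[symmetric] prod_mset_prod_list by (simp add: uv)
    show "case ?f (u, v, c) of (u', v', c') \<Rightarrow> crossing u' v' = crossing u v" using uv sw by simp
  qed
  \<comment> \<open>As \<open>b \<le> a = length u\<close>, a value below \<open>b\<close> is a
    genuine crossing and not the default.\<close>
  have bad: "\<not> column_strict u v \<longleftrightarrow> crossing u v < b" if "(u, v, c) \<in> row_hook S a b d" for u v c
  proof
    have l: "length u = a" "length v = b" using that by (auto simp: row_hook_def)
    show "crossing u v < b" if "\<not> column_strict u v"
      using that crossing_before[of _ u v] l unfolding column_strict_def by (metis le_less_trans not_le)
    show "\<not> column_strict u v" if "crossing u v < b"
      using that crossing_at[of u v] l assms unfolding column_strict_def by (metis less_le_trans not_le)
  qed
  have B: "crossing u v < a + 1" if "(u, v, c) \<in> row_hook S (b - 1) (a + 1) d" for u v c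
    using that crossing_le[of u v] assms by (auto simp: row_hook_def)
  have b: "b - 1 + 1 = b" using assms by simp
  show ?thesis
  proof (rule sum.reindex_bij_witness[of _ ?f ?f])
    fix t assume t: "t \<in> ?A"
    obtain u v c where [simp]: "t = (u, v, c)" by (cases t)
    have uvc: "(u, v, c) \<in> row_hook S a b d" "crossing u v < b" using t bad by auto
    show "?f (?f t) = t" using step(2)[OF uvc] by simp
    show "?f t \<in> ?B" using step(1)[OF uvc] by auto
    show "triple_weight x (?f t) = triple_weight x t" using step(3)[OF uvc] by simp
  next
    fix t assume t: "t \<in> ?B"
    obtain u v c where [simp]: "t = (u, v, c)" by (cases t)
    have uvc: "(u, v, c) \<in> row_hook S (b - 1) (a + 1) d" "crossing u v < a + 1" using t B by auto
    show "?f (?f t) = t" using step(2)[OF uvc] by simp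
    obtain u' v' c' where f: "?f t = (u', v', c')" by (cases "?f t")
    have "(u', v', c') \<in> row_hook S a b d" using step(1)[OF uvc] f b by simp
    moreover have "crossing u' v' < b"
      using step(4)[OF uvc] f crossing_le[of u v] uvc(1) assms(1) by (auto simp: row_hook_def)
    ultimately show "?f t \<in> ?A" using bad f by auto
  qed
qed

theorem tableau_poly_two_rows:
  assumes "2 \<le> b" "b \<le> a"
  shows "tableau_poly x n (young_diagram (a # b # replicate d 1))
    = rib (\<lambda>k. word_sum x n (ribbon_word [k])) (a # b # replicate d 1)
    - rib (\<lambda>k. word_sum x n (ribbon_word [k])) ((b - 1) # (a + 1) # replicate d 1)"
proof -
  let ?h = "\<lambda>k. word_sum x n (ribbon_word [k])"
  let ?P = "\<lambda>a b Q w. \<exists>u v c. w = u @ v @ c \<and> length u = a \<and> length v = b \<and> length c = d \<and>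
     sorted u \<and> sorted v \<and> sorted_wrt (<) (hd v # c) \<and> Q u v"
  have prod: "?h a' * rib ?h (b' # replicate d 1) = word_sum x n (?P a' b' (\<lambda>_ _. True))"
    if "0 < a'" "0 < b'" for a' b'
  proof -
    have "?h a' * rib ?h (b' # replicate d 1) = word_sum x n (hook_word a' 0) * word_sum x n (hook_word b' d)"
      using word_sum_hook_word[OF that(1), of x n 0] word_sum_hook_word[OF that(2), of x n d] by simp
    also have "\<dots> = word_sum x n (\<lambda>w. \<exists>u v. w = u @ v \<and> hook_word a' 0 u \<and> hook_word b' d v)"
      by (rule word_sum_mult[of _ a' _ "b' + d"]) (auto simp: hook_word_def)
    also have "(\<lambda>w. \<exists>u v. w = u @ v \<and> hook_word a' 0 u \<and> hook_word b' d v) = ?P a' b' (\<lambda>_ _. True)"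
      by (rule ext) (auto simp: hook_word_def)
    finally show ?thesis .
  qed
  define cs where "cs = map (Pair 0) [0..<a] @ map (\<lambda>(i, j). (Suc i, j)) (hook_cells b d)"
  have "tableau_poly x n (young_diagram (a # b # replicate d 1)) = word_sum x n (?P a b column_strict)"
  proof (rule tableau_poly_eq_word_sum[of cs])
    show "distinct cs" using distinct_hook_cells[of b d] by (auto simp: cs_def distinct_map inj_on_def)
    have "(i, j) \<in> set cs \<longleftrightarrow> (i, j) \<in> young_diagram (a # b # replicate d 1)" for i j
      unfolding young_diagram_Cons[of i j a] set_hook_cells[symmetric]
      by (cases i) (force simp: cs_def)+
    then show "set cs = young_diagram (a # b # replicate d 1)" unfolding set_eq_iff split_paired_All by blast
    show "length w = length cs" if "?P a b column_strict w" for w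
      using that by (auto simp: cs_def hook_cells_def)
    fix T :: "nat \<times> nat \<Rightarrow> nat"
    let ?T = "\<lambda>(i, j). T (Suc i, j)"
    define u where "u = map (\<lambda>j. T (0, j)) [0..<a]"
    define v where "v = map (\<lambda>j. T (Suc 0, j)) [0..<b]"
    define c where "c = map (\<lambda>i. T (Suc (Suc i), 0)) [0..<d]"
    have vc: "map ?T (hook_cells b d) = v @ c" by (simp add: hook_cells_def v_def c_def comp_def)
    then have cs: "map T cs = u @ v @ c" by (simp add: cs_def u_def comp_def case_prod_beta')
    have l: "length u = a" "length v = b" "length c = d" by (simp_all add: u_def v_def c_def)
    have "semistandard (young_diagram (b # replicate d 1)) ?T \<longleftrightarrow> sorted v \<and> sorted_wrt (<) (hd v # c)"
      using semistandard_hook[of b d ?T] assms l unfolding vc hook_word_def by fastforce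
    moreover have "(\<forall>j<b. T (0, j) < T (Suc 0, j)) \<longleftrightarrow> column_strict u v"
      using assms by (simp add: column_strict_def u_def v_def)
    moreover have "?P a b column_strict (u @ v @ c) \<longleftrightarrow>
        sorted u \<and> sorted v \<and> sorted_wrt (<) (hd v # c) \<and> column_strict u v"
      using l by fastforce
    ultimately show "semistandard (young_diagram (a # b # replicate d 1)) T \<longleftrightarrow> ?P a b column_strict (map T cs)"
      using semistandard_two_rows[of b a d T] assms unfolding cs u_def[symmetric] by simp
  qed
  also have "\<dots> = word_sum x n (?P a b (\<lambda>_ _. True)) - word_sum x n (?P a b (\<lambda>u v. \<not> column_strict u v))"
  proof -
    have "{(u, v, c). (u, v, c) \<in> row_hook {1..n} a b d \<and> True} =
        {(u, v, c). (u, v, c) \<in> row_hook {1..n} a b d \<and> column_strict u v} \<union>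
        {(u, v, c). (u, v, c) \<in> row_hook {1..n} a b d \<and> \<not> column_strict u v}"
      by auto
    moreover have "finite {(u, v, c). (u, v, c) \<in> row_hook {1..n} a b d \<and> Q u v}" for Q
      by (rule finite_subset[OF _ finite_row_hook[of n a b d]]) auto
    ultimately show ?thesis
      unfolding word_sum_triples eq_diff_eq by (subst sum.union_disjoint[symmetric]) auto
  qed
  also have "word_sum x n (?P a b (\<lambda>u v. \<not> column_strict u v)) = word_sum x n (?P (b - 1) (a + 1) (\<lambda>_ _. True))"
    unfolding word_sum_triples by (rule sum_crossing_rows) (use assms in auto)
  also have "word_sum x n (?P a b (\<lambda>_ _. True)) = ?h a * rib ?h (b # replicate d 1)"
    using assms by (intro prod[symmetric]) auto
  also have "word_sum x n (?P (b - 1) (a + 1) (\<lambda>_ _. True)) = ?h (b - 1) * rib ?h ((a + 1) # replicate d 1)"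
    using assms by (intro prod[symmetric]) auto
  finally show ?thesis using assms by (simp add: add.commute del: ribbon_word.simps)
qed

section \<open>Algebraic independence\<close>

type_synonym mpoly = "nat multiset \<Rightarrow>\<^sub>0 int"

definition var :: "nat \<Rightarrow> mpoly" where
  "var i = Poly_Mapping.single {#i#} 1"

lemma prod_var: "finite D \<Longrightarrow> (\<Prod>c\<in>D. var (T c)) = Poly_Mapping.single (Defs.content D T) 1"
  unfolding Defs.content_def var_def by (induction D rule: finite_induct) (auto simp: mult_single)

lemma prod_list_var: "prod_list (map var w) = Poly_Mapping.single (mset w) 1"
  unfolding var_def by (induction w) (auto simp: mult_single)

text \<open>The series have infinitely many variables. Each coefficient is read off from a
  polynomial in sufficiently many of them, where the ring operations are available.\<close>

lemma lookup_tableau_poly: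
  assumes "finite D"
  shows "Poly_Mapping.lookup (tableau_poly var n D) m = (if set_mset m \<subseteq> {1..n} then tableau_series D m else 0)"
proof -
  define S where "S = {1..n}"
  let ?A = "{T. T \<in> D \<rightarrow>\<^sub>E S \<and> semistandard D T}"
  have fin: "finite ?A"
    by (rule finite_subset[OF _ finite_PiE[OF assms, of "\<lambda>_. S"]]) (auto simp: S_def)
  have "Poly_Mapping.lookup (tableau_poly var n D) m = (\<Sum>T\<in>?A. if Defs.content D T = m then 1 else 0)"
    unfolding tableau_poly_def S_def lookup_sum
    by (intro sum.cong refl) (auto simp: prod_var[OF assms] lookup_single when_def)
  also have "\<dots> = int (card {T\<in>?A. Defs.content D T = m})"
    using fin by (simp add: sum.If_cases Int_def)
  also have "\<dots> = (if set_mset m \<subseteq> S then tableau_series D m else 0)"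
  proof (cases "set_mset m \<subseteq> S")
    case True
    have "T \<in> D \<rightarrow>\<^sub>E S" if "T \<in> ssyt D" "Defs.content D T = m" for T
    proof -
      have "T ` D = set_mset m" using that(2) assms by (auto simp: Defs.content_def)
      then show ?thesis using that(1) True by (auto simp: ssyt_def PiE_iff)
    qed
    then have "{T\<in>?A. Defs.content D T = m} = {T \<in> ssyt D. Defs.content D T = m}"
      by (auto simp: ssyt_def semistandard_def S_def)
    then show ?thesis using True by (simp add: tableau_series_def)
  next
    case False
    have "Defs.content D T \<noteq> m" if "T \<in> D \<rightarrow>\<^sub>E S" for T
    proof
      assume "Defs.content D T = m"
      then have "set_mset m = T ` D" using assms by (auto simp: Defs.content_def)
      then show False using that False by auto
    qed
    then have "{T\<in>?A. Defs.content D T = m} = {}" by auto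
    then show ?thesis using False by (simp only: card.empty if_False of_nat_0)
  qed
  finally show ?thesis unfolding S_def .
qed

abbreviation homog :: "nat \<Rightarrow> nat \<Rightarrow> mpoly" where
  "homog n \<equiv> \<lambda>k. word_sum var n (ribbon_word [k])"

lemma lookup_rib_homog:
  assumes "composition \<gamma>"
  shows "Poly_Mapping.lookup (rib (homog n) \<gamma>) m = (if set_mset m \<subseteq> {1..n} then ribbon_schur \<gamma> m else 0)"
  using lookup_tableau_poly[OF finite_ribbon_diagram, of n \<gamma> m] tableau_poly_ribbon[OF assms, of var n]
  by (simp add: ribbon_schur_def)

lemma ex_variable_bound: "\<exists>n. set_mset m \<subseteq> {1..n} \<or> 0 \<in># m" for m :: "nat multiset"
  by (rule exI[of _ "Max (set_mset m)"]) (auto simp: Suc_le_eq intro: gr0I)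

text \<open>Series are indexed by all multisets of naturals, and no range \<open>{1..n}\<close>
  covers a multiset that contains 0. Entries of tableaux are positive, so nothing is lost
  there.\<close>

lemma tableau_series_0: "0 \<in># m \<Longrightarrow> finite D \<Longrightarrow> tableau_series D m = 0"
proof -
  assume m: "0 \<in># m" "finite D"
  have "Defs.content D T \<noteq> m" if "T \<in> ssyt D" for T
  proof
    assume "Defs.content D T = m"
    then have "0 \<in> T ` D" using m by (auto simp: Defs.content_def)
    then show False using that by (auto simp: ssyt_def PiE_iff)
  qed
  then have "{T \<in> ssyt D. Defs.content D T = m} = {}" by blast
  then show ?thesis by (simp add: tableau_series_def del: Collect_empty_eq)
qed

lemma schur_two_rows:
  assumes "2 \<le> b" "b \<le> a"
  shows "schur (a # b # replicate d 1) = ribbon_schur (a # b # replicate d 1) - ribbon_schur ((b - 1) # (a + 1) # replicate d 1)"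
proof
  fix m
  have c: "composition (a # b # replicate d 1)" "composition ((b - 1) # (a + 1) # replicate d 1)"
    using assms by (auto simp: composition_def)
  show "schur (a # b # replicate d 1) m = (ribbon_schur (a # b # replicate d 1) - ribbon_schur ((b - 1) # (a + 1) # replicate d 1)) m"
  proof (cases "0 \<in># m")
    case True
    then show ?thesis
      by (simp add: schur_def ribbon_schur_def tableau_series_0 finite_young_diagram finite_ribbon_diagram)
  next
    case False
    then obtain n where n: "set_mset m \<subseteq> {1..n}" using ex_variable_bound by blast
    have "schur (a # b # replicate d 1) m = Poly_Mapping.lookup (tableau_poly var n (young_diagram (a # b # replicate d 1))) m"
      unfolding lookup_tableau_poly[OF finite_young_diagram] schur_def using n by simp
    also have "\<dots> = Poly_Mapping.lookup (rib (homog n) (a # b # replicate d 1)) m - Poly_Mapping.lookup (rib (homog n) ((b - 1) # (a + 1) # replicate d 1)) m"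
      unfolding tableau_poly_two_rows[OF assms] lookup_minus ..
    finally show ?thesis unfolding lookup_rib_homog[OF c(1)] lookup_rib_homog[OF c(2)] using n by simp
  qed
qed

lemma ribbon_schur_diff_eqI:
  assumes "\<And>f :: nat \<Rightarrow> mpoly. rib f \<alpha> - rib f \<beta> = rib f \<gamma> - rib f \<delta>"
    and "composition \<alpha>" "composition \<beta>" "composition \<gamma>" "composition \<delta>"
  shows "ribbon_schur \<alpha> - ribbon_schur \<beta> = ribbon_schur \<gamma> - ribbon_schur \<delta>"
proof
  fix m
  show "(ribbon_schur \<alpha> - ribbon_schur \<beta>) m = (ribbon_schur \<gamma> - ribbon_schur \<delta>) m"
  proof (cases "0 \<in># m")
    case True
    then show ?thesis by (simp add: ribbon_schur_def tableau_series_0 finite_ribbon_diagram)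
  next
    case False
    then obtain n where n: "set_mset m \<subseteq> {1..n}" using ex_variable_bound by blast
    have "Poly_Mapping.lookup (rib (homog n) \<alpha> - rib (homog n) \<beta>) m = Poly_Mapping.lookup (rib (homog n) \<gamma> - rib (homog n) \<delta>) m"
      using assms(1) by simp
    then show ?thesis
      unfolding lookup_minus assms(2-)[THEN lookup_rib_homog] using n by simp
  qed
qed

section \<open>Evaluation homomorphisms\<close>

definition eval_mpoly :: "(nat \<Rightarrow> 'b::comm_ring_1) \<Rightarrow> mpoly \<Rightarrow> 'b" where
  "eval_mpoly \<phi> p = (\<Sum>M\<in>Poly_Mapping.keys p. of_int (Poly_Mapping.lookup p M) * prod_mset (image_mset \<phi> M))"

lemma eval_mpoly_superset:
  assumes "finite A" "Poly_Mapping.keys p \<subseteq> A"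
  shows "eval_mpoly \<phi> p = (\<Sum>M\<in>A. of_int (Poly_Mapping.lookup p M) * prod_mset (image_mset \<phi> M))"
  unfolding eval_mpoly_def using assms
  by (intro sum.mono_neutral_left) (auto simp: in_keys_iff)

lemma eval_mpoly_add: "eval_mpoly \<phi> (p + q) = eval_mpoly \<phi> p + eval_mpoly \<phi> q"
proof -
  let ?A = "Poly_Mapping.keys p \<union> Poly_Mapping.keys q \<union> Poly_Mapping.keys (p + q)"
  have e: "eval_mpoly \<phi> r = (\<Sum>M\<in>?A. of_int (Poly_Mapping.lookup r M) * prod_mset (image_mset \<phi> M))"
    if "Poly_Mapping.keys r \<subseteq> ?A" for r using that by (intro eval_mpoly_superset) auto
  show ?thesis by (subst (1 2 3) e) (auto simp: lookup_add algebra_simps sum.distrib)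
qed

lemma eval_mpoly_single: "eval_mpoly \<phi> (Poly_Mapping.single M c) = of_int c * prod_mset (image_mset \<phi> M)"
  by (simp add: eval_mpoly_def)

lemma eval_mpoly_0: "eval_mpoly \<phi> 0 = 0"
  by (simp add: eval_mpoly_def)

lemma eval_mpoly_sum: "eval_mpoly \<phi> (\<Sum>i\<in>A. g i) = (\<Sum>i\<in>A. eval_mpoly \<phi> (g i))"
  by (induction A rule: infinite_finite_induct) (auto simp: eval_mpoly_add eval_mpoly_0)

lemma eval_mpoly_diff: "eval_mpoly \<phi> (p - q) = eval_mpoly \<phi> p - eval_mpoly \<phi> q"
  using eval_mpoly_add[of \<phi> "p - q" q] by simp

lemma mpoly_eq_sum_single: "p = (\<Sum>M\<in>Poly_Mapping.keys p. Poly_Mapping.single M (Poly_Mapping.lookup p M))" for p :: mpoly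
  by (rule poly_mapping_eqI) (auto simp: lookup_sum lookup_single when_def sum.delta in_keys_iff)

lemma eval_mpoly_mult: "eval_mpoly \<phi> (p * q) = eval_mpoly \<phi> p * eval_mpoly \<phi> q"
proof -
  have "p * q = (\<Sum>M\<in>Poly_Mapping.keys p. \<Sum>M'\<in>Poly_Mapping.keys q. Poly_Mapping.single (M + M') (Poly_Mapping.lookup p M * Poly_Mapping.lookup q M'))"
    by (subst mpoly_eq_sum_single[of p], subst mpoly_eq_sum_single[of q]) (simp add: sum_product mult_single)
  then show ?thesis
    by (simp add: eval_mpoly_sum eval_mpoly_single) (simp add: eval_mpoly_def sum_product algebra_simps)
qed

lemma eval_mpoly_1: "eval_mpoly \<phi> 1 = 1"
  using eval_mpoly_single[of \<phi> 0 1] by simp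

lemma eval_mpoly_of_int: "eval_mpoly \<phi> (of_int c) = of_int c"
  using eval_mpoly_single[of \<phi> 0 c] by (simp flip: single_of_int)

lemma eval_mpoly_rib: "eval_mpoly \<phi> (rib g \<gamma>) = rib (\<lambda>k. eval_mpoly \<phi> (g k)) \<gamma>"
  by (induction g \<gamma> rule: rib.induct) (simp_all add: eval_mpoly_1 eval_mpoly_diff eval_mpoly_mult)

text \<open>The variable \<open>x_i\<close> has weight \<open>i\<close>. Since \<open>m\<close>
  itself is not heavier than \<open>m\<close>, the condition also forces its coefficient in
  \<open>p\<close> to be exactly 1, and this is why the notion is multiplicative over the
  integers.\<close>

definition lowest_term :: "mpoly \<Rightarrow> nat multiset \<Rightarrow> bool" where
  "lowest_term p m \<longleftrightarrow> (\<forall>m'\<in>Poly_Mapping.keys (p - Poly_Mapping.single m 1). sum_mset m < sum_mset m')"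

lemma lowest_term_lookup:
  assumes "lowest_term p m"
  shows "Poly_Mapping.lookup p m = 1" and "m' \<noteq> m \<Longrightarrow> Poly_Mapping.lookup p m' \<noteq> 0 \<Longrightarrow> sum_mset m < sum_mset m'"
proof -
  have "m \<notin> Poly_Mapping.keys (p - Poly_Mapping.single m 1)" using assms by (auto simp: lowest_term_def)
  then show "Poly_Mapping.lookup p m = 1" by (simp add: in_keys_iff lookup_minus)
  show "sum_mset m < sum_mset m'" if "m' \<noteq> m" "Poly_Mapping.lookup p m' \<noteq> 0"
    using assms that by (auto simp: lowest_term_def in_keys_iff lookup_minus lookup_single)
qed

lemma lowest_term_mult:
  assumes "lowest_term p m" "lowest_term q m'"
  shows "lowest_term (p * q) (m + m')"
proof -
  let ?s = "\<lambda>m. Poly_Mapping.single m 1 :: mpoly"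
  define p' q' where "p' = p - ?s m" and "q' = q - ?s m'"
  have eq: "p * q - ?s (m + m') = ?s m * q' + p' * ?s m' + p' * q'"
    unfolding p'_def q'_def using mult_single[of m 1 m' "1::int"] by (simp add: algebra_simps)
  have 1: "sum_mset (m + m') < sum_mset M" if "M \<in> Poly_Mapping.keys (?s m * q')" for M
    using that keys_mult[of "?s m" q'] assms(2) unfolding lowest_term_def q'_def by fastforce
  have 2: "sum_mset (m + m') < sum_mset M" if "M \<in> Poly_Mapping.keys (p' * ?s m')" for M
    using that keys_mult[of p' "?s m'"] assms(1) unfolding lowest_term_def p'_def by fastforce
  have 3: "sum_mset (m + m') < sum_mset M" if "M \<in> Poly_Mapping.keys (p' * q')" for M
    using that keys_mult[of p' q'] assms unfolding lowest_term_def p'_def q'_def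
    by (fastforce intro: add_strict_mono)
  have sub: "Poly_Mapping.keys (?s m * q' + p' * ?s m' + p' * q')
      \<subseteq> Poly_Mapping.keys (?s m * q') \<union> Poly_Mapping.keys (p' * ?s m') \<union> Poly_Mapping.keys (p' * q')"
    using keys_add[of "?s m * q' + p' * ?s m'" "p' * q'"] keys_add[of "?s m * q'" "p' * ?s m'"] by blast
  show ?thesis
    unfolding lowest_term_def
  proof
    fix M assume "M \<in> Poly_Mapping.keys (p * q - ?s (m + m'))"
    then have "M \<in> Poly_Mapping.keys (?s m * q') \<union> Poly_Mapping.keys (p' * ?s m') \<union> Poly_Mapping.keys (p' * q')"
      unfolding eq by (rule subsetD[OF sub])
    then show "sum_mset (m + m') < sum_mset M" using 1 2 3 by blast
  qed
qed

section \<open>Lowest monomials of products of elementary functions\<close>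

abbreviation elem :: "nat \<Rightarrow> nat \<Rightarrow> mpoly" where
  "elem n \<equiv> \<lambda>k. rib (homog n) (replicate k 1)"

lemma elem_word_sum: "elem n k = word_sum var n (\<lambda>w. length w = k \<and> sorted_wrt (<) w)"
proof -
  have "ribbon_diagram (replicate k 1) = young_diagram (replicate k 1)"
    using hook_ribbon_eq_young[of 1 "k - 1"]
    by (cases k) (auto simp: ribbon_diagram_def young_diagram_def)
  then have "elem n k = tableau_poly var n (young_diagram (replicate k 1))"
    using tableau_poly_ribbon[of "replicate k 1" var n] by (simp add: composition_def)
  also have "\<dots> = word_sum var n (\<lambda>w. length w = k \<and> sorted_wrt (<) w)"
  proof (rule tableau_poly_eq_word_sum[of "map (\<lambda>i. (i, 0)) [0..<k]"])
    have "(i, j) \<in> set (map (\<lambda>i. (i, 0)) [0..<k]) \<longleftrightarrow> (i, j) \<in> young_diagram (replicate k 1)" for i j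
      unfolding young_diagram_column by auto
    then show "set (map (\<lambda>i. (i, 0)) [0..<k]) = young_diagram (replicate k 1)"
      unfolding set_eq_iff split_paired_All by blast
    show "semistandard (young_diagram (replicate k 1)) T \<longleftrightarrow>
      length (map T (map (\<lambda>i. (i, 0)) [0..<k])) = k \<and> sorted_wrt (<) (map T (map (\<lambda>i. (i, 0)) [0..<k]))" for T
      unfolding semistandard_column by (simp add: comp_def)
  qed (auto simp: distinct_map inj_on_def)
  finally show ?thesis .
qed

lemma strictly_sorted_nth_ge:
  assumes "sorted_wrt (<) w" "set w \<subseteq> {1..n::nat}" "i < length w"
  shows "Suc i \<le> w ! i"
  using assms(3)
proof (induction i)
  case 0
  then show ?case using assms(2) nth_mem by fastforce
next
  case (Suc i)
  then have "w ! i < w ! Suc i" using assms(1) by (simp add: sorted_wrt_nth_less)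
  then show ?case using Suc by simp
qed

text \<open>In a strictly increasing word of positive letters, the letter at index \<open>i\<close>
  is at least \<open>i + 1\<close>; equality throughout occurs only for
  \<open>1, ..., k\<close>.\<close>

lemma lowest_term_elem:
  assumes "k \<le> n"
  shows "lowest_term (elem n k) (mset [1..<Suc k])"
proof -
  let ?P = "\<lambda>w. set w \<subseteq> {1..n} \<and> length w = k \<and> sorted_wrt (<) w"
  let ?w = "[1..<Suc k]"
  have fin: "finite {w. ?P w}" by (rule finite_words) simp
  have P: "?P ?w" using assms by (auto simp del: upt_Suc)
  have "elem n k = (\<Sum>w | ?P w. Poly_Mapping.single (mset w) 1)"
    unfolding elem_word_sum[of n k] by (simp only: word_sum_def prod_list_var)
  also have "\<dots> = Poly_Mapping.single (mset ?w) 1 + (\<Sum>w\<in>{w. ?P w} - {?w}. Poly_Mapping.single (mset w) 1)"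
    using sum.remove[OF fin, of ?w "\<lambda>w. Poly_Mapping.single (mset w) (1::int)"] P by simp
  finally have eq: "elem n k - Poly_Mapping.single (mset ?w) 1 = (\<Sum>w\<in>{w. ?P w} - {?w}. Poly_Mapping.single (mset w) 1)"
    by simp
  have keys: "Poly_Mapping.keys (\<Sum>w\<in>{w. ?P w} - {?w}. Poly_Mapping.single (mset w) (1::int)) \<subseteq> mset ` ({w. ?P w} - {?w})"
    by (rule order.trans[OF keys_sum]) (auto simp del: upt_Suc)
  have less: "sum_list ?w < sum_list w" if w: "?P w" "w \<noteq> ?w" for w
  proof -
    have ge: "Suc i \<le> w ! i" if "i < k" for i using strictly_sorted_nth_ge[of w n i] w that by auto
    obtain i where i: "i < k" "w ! i \<noteq> ?w ! i" using w nth_equalityI[of w ?w] by (auto simp del: upt_Suc)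
    have "sum_list ?w = (\<Sum>i<k. Suc i)"
      by (simp add: sum_list_sum_nth atLeast0LessThan del: upt_Suc)
    also have "\<dots> < (\<Sum>i<k. w ! i)"
    proof (rule sum_strict_mono_ex1)
      show "\<exists>i\<in>{..<k}. Suc i < w ! i" using i ge[of i] by (intro bexI[of _ i]) (auto simp del: upt_Suc)
    qed (use ge in auto)
    also have "\<dots> = sum_list w" using w by (simp add: sum_list_sum_nth atLeast0LessThan)
    finally show ?thesis .
  qed
  show ?thesis
    unfolding lowest_term_def eq
  proof
    fix m assume "m \<in> Poly_Mapping.keys (\<Sum>w\<in>{w. ?P w} - {?w}. Poly_Mapping.single (mset w) (1::int))"
    then have "m \<in> mset ` ({w. ?P w} - {?w})" by (rule subsetD[OF keys])
    then obtain w where w: "?P w" "w \<noteq> ?w" "m = mset w" by blast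
    show "sum_mset (mset ?w) < sum_mset m" unfolding w(3) sum_mset_sum_list using w(1,2) by (rule less)
  qed
qed

text \<open>An element \<open>k\<close> of \<open>M\<close> stands for the factor
  \<open>e_(k+1)\<close>, with lowest monomial \<open>x_1 ... x_(k+1)\<close>; the shift leaves out
  the constant \<open>e_0\<close>.\<close>

definition lowest_monomial :: "nat multiset \<Rightarrow> nat multiset" where
  "lowest_monomial M = (\<Sum>k\<in>#M. mset [1..<Suc (Suc k)])"

lemma lowest_term_prod_elem:
  "(\<forall>k\<in>#M. Suc k \<le> n) \<Longrightarrow> lowest_term (prod_mset (image_mset (\<lambda>k. elem n (Suc k)) M)) (lowest_monomial M)"
proof (induction M)
  case empty
  then show ?case by (simp add: lowest_term_def lowest_monomial_def flip: single_one)
next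
  case (add k M)
  have "lowest_monomial (add_mset k M) = mset [1..<Suc (Suc k)] + lowest_monomial M"
    by (simp add: lowest_monomial_def del: upt_Suc)
  then show ?case
    using lowest_term_mult[OF lowest_term_elem[of "Suc k" n] add.IH] add.prems
    by (simp del: upt_Suc replicate_Suc ribbon_word.simps)
qed

text \<open>The exponent of \<open>x_(k+1)\<close> exceeds that of \<open>x_(k+2)\<close> by the
  multiplicity of \<open>k\<close> in \<open>M\<close>.\<close>

lemma lowest_monomial_inj: "lowest_monomial M = lowest_monomial M' \<Longrightarrow> M = M'"
proof -
  have c: "count (lowest_monomial M) (Suc k) = count M k + count (lowest_monomial M) (Suc (Suc k))" for M k
  proof (induction M)
    case (add j M)
    have "count (mset [1..<Suc (Suc j)]) (Suc k) = (if k \<le> j then 1 else 0)" for k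
      using distinct_upt[of 1 "Suc (Suc j)"] unfolding distinct_count_atmost_1 by (simp del: upt_Suc)
    then show ?case using add by (simp add: lowest_monomial_def del: upt_Suc)
  qed (simp add: lowest_monomial_def)
  assume "lowest_monomial M = lowest_monomial M'"
  then have "count M k = count M' k" for k using c[of M k] c[of M' k] by simp
  then show ?thesis by (rule multiset_eqI)
qed

lemma lookup_of_int_mult: "Poly_Mapping.lookup (of_int c * q) m = c * Poly_Mapping.lookup q m" for q :: mpoly
proof (induction c rule: int_induct[of _ 0])
  case (step1 i)
  then show ?case by (simp add: distrib_right lookup_add)
next
  case (step2 i)
  then show ?case by (simp add: left_diff_distrib lookup_minus)
qed simp

theorem elem_algebraically_independent:
  assumes "\<And>n. eval_mpoly (\<lambda>k. elem n (Suc k)) p = 0"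
  shows "p = 0"
proof (rule ccontr)
  assume "p \<noteq> 0"
  then have ne: "Poly_Mapping.keys p \<noteq> {}" by (metis keys_zero poly_mapping_eqI in_keys_iff lookup_zero empty_iff)
  \<comment> \<open>At the lowest monomial of this \<open>M\<close> no other product contributes:
    its own lowest monomial is different and at least as heavy, and its remaining monomials are
    heavier still.\<close>
  define M where "M = arg_min_on (\<lambda>M. sum_mset (lowest_monomial M)) (Poly_Mapping.keys p)"
  have Mk: "M \<in> Poly_Mapping.keys p"
    and min: "\<And>M'. M' \<in> Poly_Mapping.keys p \<Longrightarrow> sum_mset (lowest_monomial M) \<le> sum_mset (lowest_monomial M')"
    using arg_min_if_finite[OF finite_keys ne, of "\<lambda>M. sum_mset (lowest_monomial M)"]
    unfolding M_def by (auto simp: not_less)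
  have "finite (\<Union>M\<in>Poly_Mapping.keys p. set_mset M)" by simp
  then obtain n where n: "\<And>M k. M \<in> Poly_Mapping.keys p \<Longrightarrow> k \<in># M \<Longrightarrow> k < n"
    unfolding finite_nat_set_iff_bounded by blast
  let ?e = "\<lambda>M. prod_mset (image_mset (\<lambda>k. elem n (Suc k)) M)"
  have low: "lowest_term (?e M') (lowest_monomial M')" if "M' \<in> Poly_Mapping.keys p" for M'
    using n[OF that] by (intro lowest_term_prod_elem) (auto simp: Suc_le_eq)
  have "0 = Poly_Mapping.lookup (eval_mpoly (\<lambda>k. elem n (Suc k)) p) (lowest_monomial M)" using assms by simp
  also have "\<dots> = (\<Sum>M'\<in>Poly_Mapping.keys p. Poly_Mapping.lookup p M' * Poly_Mapping.lookup (?e M') (lowest_monomial M))"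
    by (simp add: eval_mpoly_def lookup_sum lookup_of_int_mult)
  also have "\<dots> = (\<Sum>M'\<in>Poly_Mapping.keys p. if M' = M then Poly_Mapping.lookup p M else 0)"
  proof (intro sum.cong refl)
    fix M' assume M': "M' \<in> Poly_Mapping.keys p"
    show "Poly_Mapping.lookup p M' * Poly_Mapping.lookup (?e M') (lowest_monomial M) = (if M' = M then Poly_Mapping.lookup p M else 0)"
    proof (cases "M' = M")
      case True
      then show ?thesis using lowest_term_lookup(1)[OF low[OF Mk]] by simp
    next
      case False
      then have "lowest_monomial M \<noteq> lowest_monomial M'" using lowest_monomial_inj by blast
      then have "Poly_Mapping.lookup (?e M') (lowest_monomial M) = 0"
        using lowest_term_lookup(2)[OF low[OF M']] min[OF M'] by (metis not_le)
      then show ?thesis using False by simp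
    qed
  qed
  also have "\<dots> = Poly_Mapping.lookup p M" using Mk by simp
  finally show False using Mk by (simp add: in_keys_iff)
qed

section \<open>Transfer of ribbon identities to arbitrary rings\<close>

lemma rib_cong:
  "composition \<gamma> \<Longrightarrow> (\<And>k. 0 < k \<Longrightarrow> f k = g k) \<Longrightarrow> rib f \<gamma> = rib g \<gamma>"
  by (induction f \<gamma> rule: rib.induct) (auto simp: composition_def)

definition rib_comb :: "(nat \<Rightarrow> 'a::comm_ring_1) \<Rightarrow> (int \<times> nat list) list \<Rightarrow> 'a" where
  "rib_comb f cs = (\<Sum>(c, \<gamma>)\<leftarrow>cs. of_int c * rib f \<gamma>)"

lemma rib_comb_cong:
  "(\<And>c \<gamma>. (c, \<gamma>) \<in> set cs \<Longrightarrow> composition \<gamma>) \<Longrightarrow> (\<And>k. 0 < k \<Longrightarrow> f k = g k) \<Longrightarrow> rib_comb f cs = rib_comb g cs"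
  unfolding rib_comb_def by (intro arg_cong[of _ _ sum_list] map_cong) (auto simp: rib_cong[of _ f g])

lemma eval_mpoly_rib_comb: "eval_mpoly \<phi> (rib_comb g cs) = rib_comb (\<lambda>k. eval_mpoly \<phi> (g k)) cs"
  unfolding rib_comb_def
  by (induction cs) (auto simp: eval_mpoly_0 eval_mpoly_add eval_mpoly_mult eval_mpoly_of_int eval_mpoly_rib)

theorem rib_comb_transfer:
  fixes f :: "nat \<Rightarrow> 'a::comm_ring_1"
  assumes c: "\<And>c \<gamma>. (c, \<gamma>) \<in> set cs \<Longrightarrow> composition \<gamma>" and 0: "\<And>n. rib_comb (homog n) cs = 0"
  shows "rib_comb f cs = 0"
proof -
  \<comment> \<open>The combination with each \<open>h_j\<close> written as a polynomial in free
    variables that stand for \<open>e_1, e_2, ...\<close>. Inserting the columns of any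
    \<open>g\<close> restores the combination at \<open>g\<close>, by the involution. So
    \<open>p\<close> vanishes at the elementary polynomials, hence is 0, and then vanishes at the
    columns of \<open>f\<close> as well.\<close>
  define p where "p = rib_comb (\<lambda>j. rib (\<lambda>k. var (k - 1)) (replicate j 1)) cs"
  have eval: "eval_mpoly (\<lambda>k. rib g (replicate (Suc k) 1)) p = rib_comb g cs" for g :: "nat \<Rightarrow> 'b::comm_ring_1"
  proof -
    let ?\<phi> = "\<lambda>k. rib g (replicate (Suc k) 1)"
    have "eval_mpoly ?\<phi> (rib (\<lambda>k. var (k - 1)) (replicate j 1)) = g j" if "0 < j" for j
    proof -
      have "eval_mpoly ?\<phi> (rib (\<lambda>k. var (k - 1)) (replicate j 1))
          = rib (\<lambda>k. eval_mpoly ?\<phi> (var (k - 1))) (replicate j 1)" by (rule eval_mpoly_rib)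
      also have "\<dots> = rib (\<lambda>k. rib g (replicate k 1)) (replicate j 1)"
        by (rule rib_cong) (auto simp: composition_def var_def eval_mpoly_single gr0_conv_Suc simp del: replicate_Suc)
      also have "\<dots> = g j" using that by (rule rib_columns_involution)
      finally show ?thesis .
    qed
    then show ?thesis
      unfolding p_def eval_mpoly_rib_comb using c by (intro rib_comb_cong) auto
  qed
  have "p = 0"
  proof (rule elem_algebraically_independent)
    show "eval_mpoly (\<lambda>k. elem n (Suc k)) p = 0" for n using eval[of "homog n"] 0 by simp
  qed
  then show ?thesis using eval[of f] by (simp add: eval_mpoly_0)
qed

theorem ribbon_schur_diff_transfer:
  assumes "ribbon_schur \<alpha> - ribbon_schur \<beta> = ribbon_schur \<gamma> - ribbon_schur \<delta>"
    and c: "composition \<alpha>" "composition \<beta>" "composition \<gamma>" "composition \<delta>"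
  shows "rib f \<alpha> - rib f \<beta> = rib f \<gamma> - rib f \<delta>"
proof -
  have 0: "rib_comb (homog n) [(1, \<alpha>), (-1, \<beta>), (-1, \<gamma>), (1, \<delta>)] = 0" for n
  proof (rule poly_mapping_eqI)
    fix m
    have "(ribbon_schur \<alpha> - ribbon_schur \<beta>) m = (ribbon_schur \<gamma> - ribbon_schur \<delta>) m" using assms(1) by simp
    then show "Poly_Mapping.lookup (rib_comb (homog n) [(1, \<alpha>), (-1, \<beta>), (-1, \<gamma>), (1, \<delta>)]) m = Poly_Mapping.lookup 0 m"
      by (simp add: rib_comb_def lookup_add lookup_minus c[THEN lookup_rib_homog] del: ribbon_word.simps)
  qed
  have "rib_comb f [(1, \<alpha>), (-1, \<beta>), (-1, \<gamma>), (1, \<delta>)] = 0"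
    by (rule rib_comb_transfer[OF _ 0]) (use c in auto)
  then show ?thesis by (simp add: rib_comb_def algebra_simps)
qed

theorem ribbon_schur_diff_transfer_single:
  assumes "ribbon_schur \<alpha> - ribbon_schur \<beta> = ribbon_schur \<gamma>"
    and c: "composition \<alpha>" "composition \<beta>" "composition \<gamma>"
  shows "rib f \<alpha> - rib f \<beta> = rib f \<gamma>"
proof -
  have 0: "rib_comb (homog n) [(1, \<alpha>), (-1, \<beta>), (-1, \<gamma>)] = 0" for n
  proof (rule poly_mapping_eqI)
    fix m
    have "(ribbon_schur \<alpha> - ribbon_schur \<beta>) m = ribbon_schur \<gamma> m" using assms(1) by simp
    then show "Poly_Mapping.lookup (rib_comb (homog n) [(1, \<alpha>), (-1, \<beta>), (-1, \<gamma>)]) m = Poly_Mapping.lookup 0 m"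
      by (simp add: rib_comb_def lookup_add lookup_minus c[THEN lookup_rib_homog] del: ribbon_word.simps)
  qed
  have "rib_comb f [(1, \<alpha>), (-1, \<beta>), (-1, \<gamma>)] = 0"
    by (rule rib_comb_transfer[OF _ 0]) (use c in auto)
  then show ?thesis by (simp add: rib_comb_def algebra_simps)
qed

section \<open>Coefficients and specialisations\<close>

text \<open>Sums over all ways of adding up two adjacent parts; the summand is the product of
  \<open>g\<close> over the resulting composition.\<close>

fun merge_sum :: "(nat \<Rightarrow> int) \<Rightarrow> nat list \<Rightarrow> int" where
  "merge_sum g (k # l # \<gamma>) = g (k + l) * prod_list (map g \<gamma>) + g k * merge_sum g (l # \<gamma>)"
| "merge_sum g _ = 0"

text \<open>When \<open>f k\<close> is \<open>g k\<close> times the variable, the degree counts the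
  parts of a coarsening, and refining nothing gives the largest degree. The coefficients thus
  separate the coarsenings by their length.\<close>

lemma coeff_rib_above: "length \<gamma> < i \<Longrightarrow> coeff (rib (\<lambda>k. monom (g k :: int) 1) \<gamma>) i = 0"
proof (induction "\<lambda>k. monom (g k) 1" \<gamma> arbitrary: i rule: rib.induct)
  case (3 k l \<gamma>)
  then show ?case by (simp add: coeff_monom_mult)
qed (auto simp: coeff_monom)

lemma coeff_rib_length: "coeff (rib (\<lambda>k. monom (g k :: int) 1) \<gamma>) (length \<gamma>) = prod_list (map g \<gamma>)"
proof (induction "\<lambda>k. monom (g k) 1" \<gamma> rule: rib.induct)
  case (3 k l \<gamma>)
  then show ?case
    using coeff_rib_above[of "(k + l) # \<gamma>" "length (k # l # \<gamma>)" g] by (simp add: coeff_monom_mult)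
qed (auto simp: coeff_monom)

lemma coeff_rib_length_pred:
  "\<gamma> \<noteq> [] \<Longrightarrow> coeff (rib (\<lambda>k. monom (g k :: int) 1) \<gamma>) (length \<gamma> - 1) = - merge_sum g \<gamma>"
proof (induction "\<lambda>k. monom (g k) 1" \<gamma> rule: rib.induct)
  case (3 k l \<gamma>)
  then show ?case using coeff_rib_length[of g "(k + l) # \<gamma>"] by (simp add: coeff_monom_mult)
qed (auto simp: coeff_monom)

section \<open>Proper partial sums and the coefficients of low degree\<close>

fun psums :: "nat list \<Rightarrow> nat set" where
  "psums (k # l # \<gamma>) = insert k ((+) k ` psums (l # \<gamma>))"
| "psums _ = {}"

lemma psums_Cons: "\<gamma> \<noteq> [] \<Longrightarrow> s \<in> psums (k # \<gamma>) \<longleftrightarrow> s = k \<or> (\<exists>t. s = k + t \<and> t \<in> psums \<gamma>)"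
  by (cases \<gamma>) auto

lemma psums_merge: "psums ((k + l) # \<gamma>) = (+) k ` psums (l # \<gamma>)"
  by (cases \<gamma>) (auto simp: image_iff)

lemma psums_bounds: "composition \<gamma> \<Longrightarrow> psums \<gamma> \<subseteq> {0<..<sum_list \<gamma>}"
  by (induction \<gamma> rule: psums.induct) (auto simp: composition_def)

lemma finite_psums: "finite (psums \<gamma>)"
  by (induction \<gamma> rule: psums.induct) auto

lemma psums_replicate:
  "\<gamma> \<noteq> [] \<Longrightarrow> s \<in> psums (replicate m 1 @ \<gamma>) \<longleftrightarrow> (1 \<le> s \<and> s \<le> m) \<or> (m \<le> s \<and> s - m \<in> psums \<gamma>)"
proof (induction m arbitrary: s)
  case (Suc m)
  have "s \<in> psums (replicate (Suc m) 1 @ \<gamma>) \<longleftrightarrow> s = 1 \<or> (\<exists>t. s = 1 + t \<and> t \<in> psums (replicate m 1 @ \<gamma>))"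
    using Suc.prems psums_Cons[of "replicate m 1 @ \<gamma>" s 1] by simp
  also have "\<dots> \<longleftrightarrow> (1 \<le> s \<and> s \<le> Suc m) \<or> (Suc m \<le> s \<and> s - Suc m \<in> psums \<gamma>)"
    by (cases s) (auto simp: Suc.IH[OF Suc.prems] simp del: One_nat_def)
  finally show ?case .
qed auto

lemma coeff_rib_01:
  "\<gamma> \<noteq> [] \<Longrightarrow> coeff (rib (\<lambda>k. monom (g k :: int) 1) \<gamma>) 0 = 0 \<and>
     coeff (rib (\<lambda>k. monom (g k) 1) \<gamma>) 1 = (-1) ^ (length \<gamma> - 1) * g (sum_list \<gamma>)"
proof (induction "\<lambda>k. monom (g k) 1" \<gamma> rule: rib.induct)
  case (3 k l \<gamma>)
  then show ?case by (simp add: coeff_monom_mult add.assoc)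
qed (auto simp: coeff_monom)

lemma coeff_rib_2:
  "composition \<gamma> \<Longrightarrow> coeff (rib (\<lambda>k. monom (g k :: int) 1) \<gamma>) 2
     = (-1) ^ length \<gamma> * (\<Sum>s\<in>psums \<gamma>. g s * g (sum_list \<gamma> - s))"
proof (induction "\<lambda>k. monom (g k) 1" \<gamma> rule: rib.induct)
  case (3 k l \<gamma>)
  have c: "composition (l # \<gamma>)" "composition ((k + l) # \<gamma>)" using 3(3) by (auto simp: composition_def)
  have "(\<Sum>s\<in>psums (k # l # \<gamma>). g s * g (sum_list (k # l # \<gamma>) - s))
      = g k * g (sum_list (l # \<gamma>)) + (\<Sum>s\<in>(+) k ` psums (l # \<gamma>). g s * g (sum_list (k # l # \<gamma>) - s))"
  proof -
    have "k \<notin> (+) k ` psums (l # \<gamma>)" using psums_bounds[OF c(1)] by auto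
    then show ?thesis by (simp add: finite_psums)
  qed
  also have "(+) k ` psums (l # \<gamma>) = psums ((k + l) # \<gamma>)" by (rule psums_merge[symmetric])
  finally show ?case
    using 3(2)[OF c(2)] coeff_rib_01[of "l # \<gamma>" g]
    by (simp add: coeff_monom_mult algebra_simps numeral_2_eq_2 psums_merge del: psums.simps)
qed (auto simp: coeff_monom)

text \<open>A coarsening with two parts is a cut at a proper partial sum \<open>s\<close>, of weight
  \<open>g s * g (N - s)\<close> for size \<open>N\<close>. The indicator of two complementary
  values keeps only the cuts at \<open>p\<close> and \<open>q\<close>, which are distinct.\<close>

lemma coeff_rib_2_pair:
  assumes "composition \<gamma>" "p + q = sum_list \<gamma>" "p \<noteq> q"
  shows "coeff (rib (\<lambda>k. monom (of_bool (k = p \<or> k = q) :: int) 1) \<gamma>) 2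
     = (-1) ^ length \<gamma> * (of_bool (p \<in> psums \<gamma>) + of_bool (q \<in> psums \<gamma>))"
proof -
  let ?g = "\<lambda>k. of_bool (k = p \<or> k = q) :: int"
  have "?g s * ?g (sum_list \<gamma> - s) = of_bool (s = p) + of_bool (s = q)" if "s \<in> psums \<gamma>" for s
    unfolding assms(2)[symmetric] using assms(3) by (cases "s = p"; cases "s = q") simp_all
  then have "(\<Sum>s\<in>psums \<gamma>. ?g s * ?g (sum_list \<gamma> - s)) = (\<Sum>s\<in>psums \<gamma>. of_bool (s = p)) + (\<Sum>s\<in>psums \<gamma>. of_bool (s = q))"
    by (simp add: sum.distrib)
  also have "\<dots> = of_bool (p \<in> psums \<gamma>) + of_bool (q \<in> psums \<gamma>)"
    using finite_psums[of \<gamma>] by (simp add: of_bool_def)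
  finally show ?thesis using coeff_rib_2[OF assms(1), of ?g] by simp
qed

text \<open>These are the coefficients of \<open>(1 + z)\<^sup>2 / (1 - z)\<close>, the complete homogeneous functions of
  one ordinary and two odd variables at 1. Prepending a part 1 then acts unipotently on the pair
  \<open>(rib (2 # \<gamma>), rib \<gamma>)\<close>, so the values are polynomial in the lengths of the runs of ones.\<close>

definition shape_val :: "nat \<Rightarrow> int" where
  "shape_val k = (if k = 1 then 3 else 4)"

text \<open>\<open>shape_val\<close> is constant from 2 on, and merging keeps a long part long, so
  the exact length of a long first part never enters the recursion.\<close>

lemma shape_val_long_first:
  "2 \<le> k \<Longrightarrow> rib shape_val (k # \<gamma>) = rib shape_val (2 # \<gamma>)"
proof (induction "length \<gamma>" arbitrary: k \<gamma>)
  case (Suc n)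
  then obtain l \<gamma>' where \<gamma>: "\<gamma> = l # \<gamma>'" by (cases \<gamma>) auto
  have "rib shape_val ((k + l) # \<gamma>') = rib shape_val (2 # \<gamma>')"
    by (rule Suc.hyps(1)) (use Suc.hyps(2) Suc.prems \<gamma> in simp_all)
  moreover have "rib shape_val ((2 + l) # \<gamma>') = rib shape_val (2 # \<gamma>')"
    by (rule Suc.hyps(1)) (use Suc.hyps(2) Suc.prems \<gamma> in simp_all)
  ultimately show ?case unfolding \<gamma> using Suc.prems by (simp add: shape_val_def)
qed (simp add: shape_val_def)

lemma shape_val_long:
  assumes "2 \<le> k"
  shows "rib shape_val (2 # k # \<gamma>) = 3 * rib shape_val (2 # \<gamma>)" "rib shape_val (k # \<gamma>) = rib shape_val (2 # \<gamma>)"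
proof -
  show k: "rib shape_val (k # \<gamma>) = rib shape_val (2 # \<gamma>)" by (rule shape_val_long_first[OF assms])
  then show "rib shape_val (2 # k # \<gamma>) = 3 * rib shape_val (2 # \<gamma>)"
    using shape_val_long_first[of "2 + k" \<gamma>] by (simp add: shape_val_def)
qed

text \<open>Unfolding \<open>1 # \<gamma>\<close> and \<open>2 # \<gamma>\<close> gives merged terms
  with a long first part, which agree; what remains is the difference of the factors 3 and
  4.\<close>

lemma shape_val_one:
  assumes "0 \<notin> set \<gamma>"
  shows "rib shape_val (1 # \<gamma>) = rib shape_val (2 # \<gamma>) - rib shape_val \<gamma>"
proof (cases \<gamma>)
  case (Cons l \<gamma>')
  then have "rib shape_val ((1 + l) # \<gamma>') = rib shape_val ((2 + l) # \<gamma>')"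
    using assms shape_val_long_first[of "1 + l"] shape_val_long_first[of "2 + l"] by simp
  then show ?thesis unfolding Cons by (simp add: shape_val_def)
qed (simp add: shape_val_def)

text \<open>Here \<open>f k = x^k + t (1 + x + \<dots> + x^(k-1))\<close> up to the factor \<open>x - 1\<close>: the complete homogeneous
  functions of the ordinary variables \<open>1, x\<close> and the odd variable \<open>t - 1\<close>.\<close>

lemma rib_two_one:
  fixes x t :: "'a::comm_ring_1"
  assumes f: "\<And>k. (x - 1) * f k = (x - 1) * x ^ k + t * (x ^ k - 1)"
  shows "(x - 1) ^ (length mid + 2) * rib f (k # mid @ [e])
     = (-1) ^ length mid * t * (x - 1 + t) * (1 - x ^ k) * (\<Prod>l\<leftarrow>mid. x - 1 + t - t * x ^ l) * (1 - x ^ e)"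
proof (induction mid arbitrary: k)
  case Nil
  have "(x - 1) ^ 2 * rib f [k, e] = ((x - 1) * f k) * ((x - 1) * f e) - (x - 1) * ((x - 1) * f (k + e))"
    by (simp add: algebra_simps power2_eq_square)
  also have "\<dots> = t * (x - 1 + t) * (1 - x ^ k) * (1 - x ^ e)"
    unfolding f by (simp add: algebra_simps power_add)
  finally show ?case by (simp add: power2_eq_square)
next
  case (Cons l mid)
  let ?C = "(-1) ^ length mid * t * (x - 1 + t) * (\<Prod>l\<leftarrow>mid. x - 1 + t - t * x ^ l) * (1 - x ^ e)"
  have IH: "(x - 1) ^ (length mid + 2) * rib f (k # mid @ [e]) = ?C * (1 - x ^ k)" for k
    unfolding Cons.IH by (simp only: mult_ac)
  \<comment> \<open>With \<open>X = x^k\<close> and \<open>L = x^l\<close>: prepending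
    \<open>k\<close> turns the end factor of \<open>l\<close> into its middle factor, adds the end
    factor of \<open>k\<close> and changes the sign.\<close>
  have aux: "((x - 1) * X + t * (X - 1)) * (1 - L) - (x - 1) * (1 - X * L) = - ((1 - X) * (x - 1 + t - t * L))" for X L
    by (simp add: algebra_simps)
  have "(x - 1) ^ (length (l # mid) + 2) * rib f (k # (l # mid) @ [e])
      = ((x - 1) * f k) * ((x - 1) ^ (length mid + 2) * rib f (l # mid @ [e]))
        - (x - 1) * ((x - 1) ^ (length mid + 2) * rib f ((k + l) # mid @ [e]))"
    by (simp add: algebra_simps)
  also have "\<dots> = ?C * (((x - 1) * x ^ k + t * (x ^ k - 1)) * (1 - x ^ l) - (x - 1) * (1 - x ^ k * x ^ l))"
  proof -
    have "v * (c * p) - w * (c * q) = c * (v * p - w * q)" for v c p w q :: 'a by (simp add: algebra_simps)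
    then show ?thesis unfolding IH f power_add[of x k l] .
  qed
  also have "\<dots> = ?C * (- ((1 - x ^ k) * (x - 1 + t - t * x ^ l)))" unfolding aux ..
  finally show ?case by (simp add: mult_ac)
qed

text \<open>A middle row of length 1 contributes \<open>(x - 1) * (1 - t)\<close>, whence the powers
  on the right. For \<open>d = 0\<close> the second row is an end row and not a middle row, so this
  case is computed separately.\<close>

lemma rib_two_one_schur:
  fixes x t :: "'a::comm_ring_1"
  assumes f: "\<And>k. (x - 1) * f k = (x - 1) * x ^ k + t * (x ^ k - 1)" and "0 < b"
  shows "(x - 1) ^ (d + 2) * (rib f (a # b # replicate d 1) - rib f ((b - 1) # (a + 1) # replicate d 1))
     = (-1) ^ d * t * (x - 1 + t) * (x - 1) ^ (d + 1) * (1 - t) ^ d * (x ^ a - x ^ (b - 1))"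
proof -
  obtain c where b: "b = Suc c" using assms(2) by (cases b) auto
  show ?thesis
  proof (cases d)
    case 0
    have "(x - 1) ^ 2 * rib f [k, l] = t * (x - 1 + t) * (1 - x ^ k) * (1 - x ^ l)" for k l
      using rib_two_one[OF f, of "[]" k l] by (simp add: power2_eq_square)
    then have "(x - 1) ^ 2 * (rib f [a, b] - rib f [b - 1, a + 1])
       = t * (x - 1 + t) * (1 - x ^ a) * (1 - x ^ b) - t * (x - 1 + t) * (1 - x ^ (b - 1)) * (1 - x ^ (a + 1))"
      by (simp only: right_diff_distrib)
    also have "\<dots> = t * (x - 1 + t) * (x - 1) * (x ^ a - x ^ (b - 1))"
      unfolding b by (simp add: algebra_simps)
    finally show ?thesis using 0 by (simp add: power2_eq_square)
  next
    case (Suc e)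
    define P where "P = (-1) ^ Suc e * t * (x - 1 + t) * (x - 1 + t - t * x) ^ e * (1 - x)"
    have L: "(x - 1) ^ (d + 2) * rib f (k # l # replicate d 1) = P * ((1 - x ^ k) * (x - 1 + t - t * x ^ l))" for k l
    proof -
      have "k # l # replicate d 1 = k # (l # replicate e 1) @ [1]" using Suc by (simp add: replicate_append_same)
      then show ?thesis
        using rib_two_one[OF f, of "l # replicate e 1" k 1] Suc
        by (simp add: P_def prod_list_replicate map_replicate mult_ac)
    qed
    have "(x - 1) ^ (d + 2) * (rib f (a # b # replicate d 1) - rib f ((b - 1) # (a + 1) # replicate d 1))
        = P * ((1 - x ^ a) * (x - 1 + t - t * x ^ b) - (1 - x ^ (b - 1)) * (x - 1 + t - t * x ^ (a + 1)))"
      unfolding right_diff_distrib[of "(x - 1) ^ (d + 2)"] L by (simp only: right_diff_distrib)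
    also have "(1 - x ^ a) * (x - 1 + t - t * x ^ b) - (1 - x ^ (b - 1)) * (x - 1 + t - t * x ^ (a + 1))
        = (x ^ (b - 1) - x ^ a) * ((x - 1) * (1 - t))"
      unfolding b by (simp add: algebra_simps)
    also have "x - 1 + t - t * x = (x - 1) * (1 - t)" by (simp add: algebra_simps)
    then have "P = (-1) ^ Suc e * t * (x - 1 + t) * ((x - 1) ^ e * (1 - t) ^ e) * (1 - x)"
      by (simp only: P_def power_mult_distrib)
    also have "(-1) ^ Suc e * t * (x - 1 + t) * ((x - 1) ^ e * (1 - t) ^ e) * (1 - x) * ((x ^ (b - 1) - x ^ a) * ((x - 1) * (1 - t)))
        = (-1) ^ d * t * (x - 1 + t) * (x - 1) ^ (d + 1) * (1 - t) ^ d * (x ^ a - x ^ (b - 1))"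
    proof -
      have swap: "(1 - x) * (x ^ (b - 1) - x ^ a) = (x - 1) * (x ^ a - x ^ (b - 1))" by (simp add: algebra_simps)
      have "s * r * w * (p * v) * (1 - x) * ((x ^ (b - 1) - x ^ a) * ((x - 1) * y))
         = s * r * w * p * v * (x - 1) * y * ((1 - x) * (x ^ (b - 1) - x ^ a))" for s r w p v y :: 'a
        by (simp only: mult_ac)
      then have "s * r * w * (p * v) * (1 - x) * ((x ^ (b - 1) - x ^ a) * ((x - 1) * y))
         = s * r * w * ((x - 1) * ((x - 1) * p)) * (y * v) * (x ^ a - x ^ (b - 1))" for s r w p v y :: 'a
        unfolding swap by (simp only: mult_ac)
      then show ?thesis unfolding Suc by (simp only: power_Suc add_Suc_right add_0_right One_nat_def)
    qed
    finally show ?thesis .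
  qed
qed

text \<open>The additional factor \<open>c\<close> keeps the exponent in the linear term a natural
  number; the bare product would have \<open>c\<close> to the power \<open>length ls - 1\<close>
  there.\<close>

lemma prod_list_expand_1:
  fixes c t :: "'a::comm_ring_1"
  shows "\<exists>Q. c * (\<Prod>l\<leftarrow>ls. c + t * v l) = c ^ (length ls + 1) + t * (c ^ length ls * (\<Sum>l\<leftarrow>ls. v l)) + t ^ 2 * Q"
proof (induction ls)
  case Nil
  show ?case by (rule exI[of _ 0]) simp
next
  case (Cons l ls)
  then obtain Q where Q: "c * (\<Prod>l\<leftarrow>ls. c + t * v l) = c ^ (length ls + 1) + t * (c ^ length ls * (\<Sum>l\<leftarrow>ls. v l)) + t ^ 2 * Q" ..
  have "c * (\<Prod>l\<leftarrow>l # ls. c + t * v l) = (c + t * v l) * (c * (\<Prod>l\<leftarrow>ls. c + t * v l))"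
    by (simp add: mult_ac)
  also have "\<dots> = c ^ (length (l # ls) + 1) + t * (c ^ length (l # ls) * (\<Sum>l\<leftarrow>l # ls. v l))
      + t ^ 2 * (c * Q + v l * (c ^ length ls * (\<Sum>l\<leftarrow>ls. v l)) + t * v l * Q)"
    unfolding Q by (simp add: algebra_simps power2_eq_square)
  finally show ?case ..
qed

lemma one_minus_power_expand_1:
  fixes t :: "'a::comm_ring_1"
  shows "\<exists>Q. (1 - t) ^ d = 1 - of_nat d * t + t ^ 2 * Q"
proof (induction d)
  case 0
  show ?case by (rule exI[of _ 0]) simp
next
  case (Suc d)
  then obtain Q where Q: "(1 - t) ^ d = 1 - of_nat d * t + t ^ 2 * Q" ..
  have "(1 - t) ^ Suc d = 1 - of_nat (Suc d) * t + t ^ 2 * (of_nat d + Q - t * Q)"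
    unfolding power_Suc Q by (simp add: algebra_simps power2_eq_square)
  then show ?case ..
qed

lemma const_poly_power: "[:p:] ^ k = [:p ^ k:]" for p :: "'a::comm_ring_1"
  by (induction k) (auto simp: one_pCons)

lemma const_poly_sum_list: "(\<Sum>l\<leftarrow>ls. [:f l:]) = [:\<Sum>l\<leftarrow>ls. f l:]"
  by (induction ls) auto

lemma monom_one_power: "(monom 1 1 :: 'a::comm_ring_1 poly) ^ k = monom 1 k"
  by (induction k) (auto simp: mult_monom)

lemma linear_coeffs_eqD:
  assumes "[:p0:] + [:0, 1:] * [:p1:] + [:0, 1:] ^ 2 * Q = [:q0:] + [:0, 1:] * [:q1:] + [:0, 1:] ^ 2 * (Q' :: 'a::comm_ring_1 poly)"
  shows "p0 = q0" and "p1 = q1"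
  using assms by (simp_all add: power2_eq_square)

definition omx :: "nat \<Rightarrow> int poly" where
  "omx k = 1 - monom 1 k"

text \<open>The ring is \<open>Z[x][t]\<close> with \<open>t\<close> as the outer variable. Once the
  factor \<open>t * (x - 1 + t) * (x - 1) ^ (d + 1)\<close> is cancelled, each middle row
  contributes \<open>x - 1\<close> to order 0 in \<open>t\<close> and \<open>1 - x^l\<close> to
  order 1. The first equation is order 0, where only the end rows matter; the second is order 1,
  simplified by the first.\<close>

theorem ribbon_difference_ends_middles:
  assumes hyp: "\<And>f :: nat \<Rightarrow> int poly poly. rib f (k # mid @ [e]) - rib f (k' # mid' @ [e'])
      = rib f (a # b # replicate d 1) - rib f ((b - 1) # (a + 1) # replicate d 1)"
    and n: "length mid = n" "length mid' = n" and b: "0 < b"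
  shows "omx k * omx e - omx k' * omx e' = (-1) ^ (n + d) * (omx 1 * (monom 1 (b - 1) - monom 1 a))"
    and "omx k * omx e * (\<Sum>l\<leftarrow>mid. omx l) - omx k' * omx e' * (\<Sum>l\<leftarrow>mid'. omx l)
      = of_nat d * omx 1 * (omx k * omx e - omx k' * omx e')"
proof -
  define t :: "int poly poly" where "t = [:0, 1:]"
  define x :: "int poly poly" where "x = [:monom 1 1:]"
  define U where "U = - omx 1"
  define D :: "int poly" where "D = monom 1 a - monom 1 (b - 1)"
  define s :: "int poly" where "s = (-1) ^ (n + d)"
  define f where "f k = x ^ k + t * (\<Sum>i<k. x ^ i)" for k
  have f: "(x - 1) * f k = (x - 1) * x ^ k + t * (x ^ k - 1)" for k
    unfolding f_def by (simp only: distrib_left power_diff_1_eq mult.left_commute[of "x - 1" t])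
  have xk: "x ^ k = [:monom 1 k:]" for k
    unfolding x_def const_poly_power monom_one_power ..
  have A: "1 - x ^ k = [:omx k:]" for k
    unfolding xk omx_def by (simp add: one_pCons)
  have u: "x - 1 = [:U:]" using A[of 1] by (simp add: U_def) (metis minus_diff_eq minus_pCons minus_zero)
  have D: "x ^ a - x ^ (b - 1) = [:D:]" by (simp add: xk D_def)
  have U0: "U \<noteq> 0"
  proof
    assume "U = 0"
    then have "coeff (omx 1) 0 = 0" by (simp add: U_def)
    then show False by (simp add: omx_def coeff_monom)
  qed
  define P where "P = (\<Prod>l\<leftarrow>mid. x - 1 + t - t * x ^ l)"
  define P' where "P' = (\<Prod>l\<leftarrow>mid'. x - 1 + t - t * x ^ l)"
  define \<Delta> where "\<Delta> = [:omx k * omx e:] * P - [:omx k' * omx e':] * P'"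
  have E: "[:omx k * omx e:] = (1 - x ^ k) * (1 - x ^ e)" for k e by (simp add: A)
  have "(x - 1) ^ (n + 2) * rib f (k # mid @ [e]) = (-1) ^ n * t * (x - 1 + t) * ([:omx k * omx e:] * P)"
    "(x - 1) ^ (n + 2) * rib f (k' # mid' @ [e']) = (-1) ^ n * t * (x - 1 + t) * ([:omx k' * omx e':] * P')"
    using rib_two_one[OF f, of mid k e] rib_two_one[OF f, of mid' k' e'] n
    unfolding P_def P'_def E by (simp_all only: mult_ac)
  then have 1: "(x - 1) ^ (n + 2) * (rib f (k # mid @ [e]) - rib f (k' # mid' @ [e'])) = (-1) ^ n * t * (x - 1 + t) * \<Delta>"
    unfolding \<Delta>_def by (simp only: right_diff_distrib)
  have 2: "(x - 1) ^ (d + 2) * (rib f (k # mid @ [e]) - rib f (k' # mid' @ [e']))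
     = (-1) ^ d * t * (x - 1 + t) * (x - 1) ^ (d + 1) * (1 - t) ^ d * (x ^ a - x ^ (b - 1))"
    unfolding hyp using rib_two_one_schur[OF f b] .
  have "t * (x - 1 + t) * (x - 1) ^ (d + 1) * ((x - 1) * ((-1) ^ n * \<Delta>))
      = (x - 1) ^ (d + 2) * ((-1) ^ n * t * (x - 1 + t) * \<Delta>)"
    by (simp add: algebra_simps)
  also have "\<dots> = (x - 1) ^ (n + 2) * ((x - 1) ^ (d + 2) * (rib f (k # mid @ [e]) - rib f (k' # mid' @ [e'])))"
    unfolding 1[symmetric] by (simp only: mult_ac)
  also have "\<dots> = t * (x - 1 + t) * (x - 1) ^ (d + 1) * ((x - 1) ^ (n + 2) * ((-1) ^ d * (1 - t) ^ d * (x ^ a - x ^ (b - 1))))"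
    unfolding 2 by (simp only: mult_ac)
  finally have "(x - 1) * ((-1) ^ n * \<Delta>) = (x - 1) ^ (n + 2) * ((-1) ^ d * (1 - t) ^ d * (x ^ a - x ^ (b - 1)))"
  proof -
    have "t \<noteq> 0" "x - 1 + t \<noteq> 0" "x - 1 \<noteq> 0" using U0 unfolding u by (auto simp: t_def)
    then have "t * (x - 1 + t) * (x - 1) ^ (d + 1) \<noteq> 0" by simp
    moreover assume "t * (x - 1 + t) * (x - 1) ^ (d + 1) * ((x - 1) * ((-1) ^ n * \<Delta>))
      = t * (x - 1 + t) * (x - 1) ^ (d + 1) * ((x - 1) ^ (n + 2) * ((-1) ^ d * (1 - t) ^ d * (x ^ a - x ^ (b - 1))))"
    ultimately show ?thesis by (metis mult_left_cancel)
  qed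
  then have "(-1) ^ n * ((x - 1) * ((-1) ^ n * \<Delta>)) = (-1) ^ n * ((x - 1) ^ (n + 2) * ((-1) ^ d * (1 - t) ^ d * (x ^ a - x ^ (b - 1))))"
    by simp
  moreover have "(-1) ^ n * ((x - 1) * ((-1) ^ n * \<Delta>)) = (x - 1) * \<Delta>"
    by (simp add: mult.left_commute[of "(-1) ^ n"] flip: mult.assoc power_add)
  ultimately have "(x - 1) * \<Delta> = (x - 1) ^ (n + 2) * ((-1) ^ (n + d) * (1 - t) ^ d * (x ^ a - x ^ (b - 1)))"
    by (simp only: power_add mult_ac)
  moreover have "(-1) ^ (n + d) = [:s:]"
    by (simp add: s_def flip: const_poly_power) (simp add: one_pCons)
  moreover have "[:s * U ^ (n + 2) * D:] = [:U ^ (n + 2):] * ([:s:] * [:D:])" by simp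
  ultimately have main: "[:U:] * \<Delta> = [:s * U ^ (n + 2) * D:] * (1 - t) ^ d"
    unfolding u D const_poly_power by (simp only: mult_ac)
  have L: "x - 1 + t - t * x ^ l = [:U:] + t * [:omx l:]" for l
    unfolding u[symmetric] A[symmetric] by (simp add: algebra_simps)
  have C: "[:p:] * [:q:] = [:p * q:]" for p q :: "int poly" by simp
  obtain Q where Q: "[:U:] * P = [:U ^ (n + 1):] + t * [:U ^ n * (\<Sum>l\<leftarrow>mid. omx l):] + t ^ 2 * Q"
    using prod_list_expand_1[of "[:U:]" t "\<lambda>l. [:omx l:]" mid]
    unfolding P_def L const_poly_power const_poly_sum_list C n by blast
  obtain Q' where Q': "[:U:] * P' = [:U ^ (n + 1):] + t * [:U ^ n * (\<Sum>l\<leftarrow>mid'. omx l):] + t ^ 2 * Q'"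
    using prod_list_expand_1[of "[:U:]" t "\<lambda>l. [:omx l:]" mid']
    unfolding P'_def L const_poly_power const_poly_sum_list C n by blast
  obtain Q'' where Q'': "(1 - t) ^ d = 1 - of_nat d * t + t ^ 2 * Q''"
    using one_minus_power_expand_1 by blast
  let ?E = "omx k * omx e" and ?E' = "omx k' * omx e'"
  have "[:U:] * \<Delta> = [:?E:] * ([:U:] * P) - [:?E':] * ([:U:] * P')"
    unfolding \<Delta>_def by (simp only: right_diff_distrib mult_ac)
  also have "\<dots> = ([:?E:] * [:U ^ (n + 1):] - [:?E':] * [:U ^ (n + 1):])
     + t * ([:?E:] * [:U ^ n * (\<Sum>l\<leftarrow>mid. omx l):] - [:?E':] * [:U ^ n * (\<Sum>l\<leftarrow>mid'. omx l):])
     + t ^ 2 * ([:?E:] * Q - [:?E':] * Q')"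
    unfolding Q Q' by (simp only: algebra_simps)
  also have "[:?E:] * [:U ^ (n + 1):] - [:?E':] * [:U ^ (n + 1):] = [:(?E - ?E') * U ^ (n + 1):]"
    by (simp add: algebra_simps)
  also have "[:?E:] * [:U ^ n * (\<Sum>l\<leftarrow>mid. omx l):] - [:?E':] * [:U ^ n * (\<Sum>l\<leftarrow>mid'. omx l):]
      = [:(?E * (\<Sum>l\<leftarrow>mid. omx l) - ?E' * (\<Sum>l\<leftarrow>mid'. omx l)) * U ^ n:]"
    by (simp add: algebra_simps)
  finally have lhs: "[:U:] * \<Delta> = [:(?E - ?E') * U ^ (n + 1):]
     + t * [:(?E * (\<Sum>l\<leftarrow>mid. omx l) - ?E' * (\<Sum>l\<leftarrow>mid'. omx l)) * U ^ n:] + t ^ 2 * ([:?E:] * Q - [:?E':] * Q')" .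
  have dd: "of_nat d = [:of_nat d:]" for d by (simp add: of_nat_poly)
  have "[:s * U ^ (n + 2) * D:] * (1 - t) ^ d = [:s * U ^ (n + 2) * D:]
     + t * ([:s * U ^ (n + 2) * D:] * - [:of_nat d:]) + t ^ 2 * ([:s * U ^ (n + 2) * D:] * Q'')"
    unfolding Q'' dd by (simp only: algebra_simps mult_1_left mult_1_right) 
  also have "[:s * U ^ (n + 2) * D:] * - [:of_nat d:] = [:- of_nat d * (s * U ^ (n + 2) * D):]" by simp
  finally have rhs: "[:s * U ^ (n + 2) * D:] * (1 - t) ^ d = [:s * U ^ (n + 2) * D:]
     + t * [:- of_nat d * (s * U ^ (n + 2) * D):] + t ^ 2 * ([:s * U ^ (n + 2) * D:] * Q'')" .
  note eqs = linear_coeffs_eqD[OF main[unfolded lhs rhs, unfolded t_def]]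
  have "U ^ (n + 1) * (?E - ?E') = U ^ (n + 1) * (s * U * D)" using eqs(1) by (simp add: mult_ac)
  then have i: "?E - ?E' = s * U * D" using U0 by simp
  then show "?E - ?E' = (-1) ^ (n + d) * (omx 1 * (monom 1 (b - 1) - monom 1 a))"
    by (simp add: s_def U_def D_def algebra_simps)
  have "U ^ n * (?E * (\<Sum>l\<leftarrow>mid. omx l) - ?E' * (\<Sum>l\<leftarrow>mid'. omx l)) = U ^ n * (- of_nat d * U * (s * U * D))"
    using eqs(2) by (simp add: mult_ac power2_eq_square)
  then have "?E * (\<Sum>l\<leftarrow>mid. omx l) - ?E' * (\<Sum>l\<leftarrow>mid'. omx l) = - of_nat d * U * (s * U * D)"
    by (simp only: mult_left_cancel[OF power_not_zero[OF U0]])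
  then show "?E * (\<Sum>l\<leftarrow>mid. omx l) - ?E' * (\<Sum>l\<leftarrow>mid'. omx l) = of_nat d * omx 1 * (?E - ?E')"
    unfolding i[symmetric] by (simp add: U_def)
qed

section \<open>End rows and middle rows\<close>

lemma coeff_omx: "coeff (omx k) m = of_bool (m = 0) - of_bool (m = k)"
  by (simp add: omx_def coeff_monom one_pCons coeff_pCons split: nat.split)

lemma omx_neq_0: "0 < k \<Longrightarrow> omx k \<noteq> 0"
  using coeff_omx[of k 0] by auto

lemma coeff_omx_mult: "coeff (omx q * w) m = coeff w m - (if q \<le> m then coeff w (m - q) else 0)"
  by (simp add: omx_def left_diff_distrib coeff_monom_mult)

text \<open>The multisets are the exponents in the end-row identity after the negative monomials
  have changed sides and the common end row \<open>p\<close> has been cancelled. The element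
  \<open>b - 1\<close> on the right has to occur on the left, which leaves few possibilities to
  chase.\<close>

lemma ends_common:
  assumes pos: "0 < x" "0 < y" "0 < p" and b: "2 \<le> b" "b \<le> (a::nat)"
    and eq: "{#y, p + x, a, b#} = {#x, p + y, a + 1, b - 1#}"
  shows "y = b - 1 \<and> (x = a \<and> p = 1 \<or> x = b \<and> p = a - b + 1)"
proof -
  have "b - 1 \<in># {#y, p + x, a, b#}" unfolding eq by simp
  then consider "y = b - 1" | "p + x = b - 1" using b by auto
  then show ?thesis
  proof cases
    case 1
    have eq': "{#p + x, a, b#} = {#x, p + y, a + 1#}" using eq unfolding 1 by (simp add: add_mset_commute)
    have "x \<in># {#p + x, a, b#}" unfolding eq' by simp
    then consider "x = a" | "x = b" using pos by auto
    then show ?thesis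
    proof cases
      case x: 1
      have e: "{#p + a, b#} = {#p + y, a + 1#}" using eq' unfolding x by (simp add: add_mset_commute)
      have "b \<in># {#p + y, a + 1#}" unfolding e[symmetric] by simp
      then show ?thesis using 1 x b by auto
    next
      case x: 2
      have e: "{#p + b, a#} = {#p + y, a + 1#}" using eq' unfolding x by (simp add: add_mset_commute)
      have "a \<in># {#p + y, a + 1#}" unfolding e[symmetric] by simp
      then show ?thesis using 1 x b by auto
    qed
  next
    case 2
    have eq': "{#y, a, b#} = {#x, p + y, a + 1#}" using eq unfolding 2 by (simp add: add_mset_commute)
    have "x \<in># {#y, a, b#}" unfolding eq' by simp
    then have "x = y" using 2 b pos by auto
    then have e: "{#a, b#} = {#p + y, a + 1#}" using eq' by (simp add: add_mset_commute)
    have "b \<in># {#p + y, a + 1#}" unfolding e[symmetric] by simp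
    then show ?thesis using 2 b \<open>x = y\<close> by auto
  qed
qed

text \<open>No end row is shared and all are positive, so an end row on one side can only match one
  of \<open>a\<close>, \<open>b\<close>, \<open>a + 1\<close>, \<open>b - 1\<close> on the
  other.\<close>

lemma ends_cases:
  assumes pos: "0 < x1" "0 < x2" "0 < y1" "0 < y2" and b: "2 \<le> b" "b \<le> (a::nat)"
    and eq: "{#y1, y2, x1 + x2, a, b#} = {#x1, x2, y1 + y2, a + 1, b - 1#}"
    and ne: "x1 \<noteq> y1" "x1 \<noteq> y2" "x2 \<noteq> y1" "x2 \<noteq> y2"
  shows "(x1 = a \<and> x2 = b \<or> x1 = b \<and> x2 = a) \<and> (y1 = a + 1 \<and> y2 = b - 1 \<or> y1 = b - 1 \<and> y2 = a + 1)"
proof -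
  have "x1 \<in># {#y1, y2, x1 + x2, a, b#}" unfolding eq by simp
  then consider "x1 = a" | "x1 = b" using ne pos by auto
  then have x: "x1 = a \<and> x2 = b \<or> x1 = b \<and> x2 = a"
  proof cases
    case 1
    have eq': "{#y1, y2, x1 + x2, b#} = {#x2, y1 + y2, a + 1, b - 1#}"
      using eq unfolding 1 by (simp add: add_mset_commute)
    have "x2 \<in># {#y1, y2, x1 + x2, b#}" unfolding eq' by simp
    then show ?thesis using 1 ne pos by auto
  next
    case 2
    have eq': "{#y1, y2, x1 + x2, a#} = {#x2, y1 + y2, a + 1, b - 1#}"
      using eq unfolding 2 by (simp add: add_mset_commute)
    have "x2 \<in># {#y1, y2, x1 + x2, a#}" unfolding eq' by simp
    then show ?thesis using 2 ne pos by auto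
  qed
  then have eq': "{#y1, y2, a + b#} = {#y1 + y2, a + 1, b - 1#}"
    using eq by (auto simp: add_mset_commute add.commute)
  have "y1 \<in># {#y1 + y2, a + 1, b - 1#}" unfolding eq'[symmetric] by simp
  then consider "y1 = a + 1" | "y1 = b - 1" using pos by auto
  then have "y1 = a + 1 \<and> y2 = b - 1 \<or> y1 = b - 1 \<and> y2 = a + 1"
  proof cases
    case 1
    have e: "{#y2, a + b#} = {#y1 + y2, b - 1#}" using eq' unfolding 1 by (simp add: add_mset_commute)
    have "y2 \<in># {#y1 + y2, b - 1#}" unfolding e[symmetric] by simp
    then show ?thesis using 1 pos by auto
  next
    case 2
    have e: "{#y2, a + b#} = {#y1 + y2, a + 1#}" using eq' unfolding 2 by (simp add: add_mset_commute)
    have "y2 \<in># {#y1 + y2, a + 1#}" unfolding e[symmetric] by simp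
    then show ?thesis using 2 pos by auto
  qed
  then show ?thesis using x by blast
qed

lemma all_ones_mset:
  "0 \<notin># M \<Longrightarrow> sum_mset M \<le> size M \<Longrightarrow> M = replicate_mset (size M) (1::nat)"
proof (induction M)
  case (add x M)
  have "size M \<le> sum_mset M" using add.prems(1)
    by (induction M) auto
  then have "x = 1" "sum_mset M \<le> size M" using add.prems by auto
  then show ?case using add by simp
qed simp

lemma size_le_sum_mset: "0 \<notin># M \<Longrightarrow> size M \<le> sum_mset (M :: nat multiset)"
  by (induction M) auto

lemma coeff_sum_omx: "coeff (\<Sum>l\<in>#M. omx l) m = of_bool (m = 0) * int (size M) - int (count M m)"
  by (induction M) (auto simp: coeff_omx)

lemma sum_omx_inject:
  assumes "(\<Sum>l\<in>#M. omx l) = (\<Sum>l\<in>#M'. omx l)" "0 \<notin># M" "0 \<notin># M'"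
  shows "M = M'"
proof (rule multiset_eqI)
  fix m
  show "count M m = count M' m"
  proof (cases "m = 0")
    case True
    then show ?thesis using assms(2,3) by (simp add: not_in_iff)
  next
    case False
    then show ?thesis using arg_cong[OF assms(1), of "\<lambda>p. coeff p m"] unfolding coeff_sum_omx by simp
  qed
qed

text \<open>\<open>M\<close> and \<open>M'\<close> hold the middle rows of two compositions with a
  common end row, whose other end rows are \<open>q\<close> and \<open>b - 1\<close>;
  \<open>r\<close> is the excess of the length over \<open>d + 2\<close>. A few coefficients of the
  identity determine \<open>M\<close>, and dividing by \<open>omx (b - 1)\<close> then yields
  \<open>M'\<close>.\<close>

lemma middles_classify:
  fixes M M' :: "nat multiset"
  assumes pos: "0 \<notin># M" "0 \<notin># M'" and size: "size M = d + r" "size M' = d + r"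
    and sum: "sum_mset M = b + d - 1" and b: "2 \<le> b" "b \<le> q"
    and eq: "omx q * ((\<Sum>l\<in>#M. omx l) - of_nat d * omx 1) = omx (b - 1) * ((\<Sum>l\<in>#M'. omx l) - of_nat d * omx 1)"
  shows "r = 1 \<and> M = add_mset (b - 1) (replicate_mset d 1) \<and> M' = add_mset q (replicate_mset d 1)
    \<or> r = 0 \<and> 0 < d \<and> M = add_mset b (replicate_mset (d - 1) 1) \<and> M' = add_mset (q + 1) (replicate_mset (d - 1) 1)"
proof -
  define w where "w M = (\<Sum>l\<in>#M. omx l) - of_nat d * omx 1" for M
  have d1: "of_nat d * omx 1 = (\<Sum>l\<in>#replicate_mset d 1. omx l)" for d by simp
  have w: "coeff (w M) m = of_bool (m = 0) * (int (size M) - int d) - int (count M m) + of_bool (m = 1) * int d" for M m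
    unfolding w_def coeff_diff d1 coeff_sum_omx by (auto simp: algebra_simps)
  have c: "coeff (w M) m - (if q \<le> m then coeff (w M) (m - q) else 0)
      = coeff (w M') m - (if b - 1 \<le> m then coeff (w M') (m - (b - 1)) else 0)" for m
    using arg_cong[OF eq, of "\<lambda>p. coeff p m"] unfolding w_def[symmetric] coeff_omx_mult .
  have M0: "count M 0 = 0" "count M' 0 = 0" using pos by (auto simp: not_in_iff)
  have "\<not> q \<le> b - 1" using b by simp
  \<comment> \<open>The coefficient of \<open>x^(b-1)\<close>. A positive \<open>r\<close> forces a
    part \<open>b - 1\<close> in \<open>M\<close>; the other \<open>d + r - 1\<close> parts add up
    to \<open>d\<close>, which leaves only \<open>r = 1\<close>.\<close>
  then have b1: "int (count M (b - 1)) = int (count M' (b - 1)) + int r"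
    using c[of "b - 1"] b M0 size unfolding w by auto
  have o: "omx (b - 1) \<noteq> 0" using b by (intro omx_neq_0) simp
  show ?thesis
  proof (cases "r = 0")
    case False
    then have "b - 1 \<in># M" using b1 by (auto simp flip: count_greater_zero_iff)
    then obtain K where K: "M = add_mset (b - 1) K" by (metis insert_DiffM)
    have K': "0 \<notin># K" "size K = d + r - 1" "sum_mset K = d" using pos size sum b K by auto
    then have r: "r = 1" using size_le_sum_mset[of K] False by simp
    then have "K = replicate_mset d 1" using all_ones_mset[of K] K' by simp
    then have M: "M = add_mset (b - 1) (replicate_mset d 1)" using K by simp
    then have "w M = omx (b - 1)" unfolding w_def by simp
    then have "omx (b - 1) * omx q = omx (b - 1) * w M'" using eq unfolding w_def[symmetric] by (simp add: mult.commute)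
    then have "w M' = omx q" using o by simp
    then have "(\<Sum>l\<in>#M'. omx l) = (\<Sum>l\<in>#add_mset q (replicate_mset d 1). omx l)" unfolding w_def by (simp add: algebra_simps)
    then have "M' = add_mset q (replicate_mset d 1)" using pos b by (intro sum_omx_inject) auto
    then show ?thesis using r M by simp
  next
    case True
    have "d \<noteq> 0"
    proof
      assume "d = 0"
      then have "M = {#}" using size True by simp
      then show False using sum b \<open>d = 0\<close> by simp
    qed
    have e1: "count M 1 = count M' 1"
    proof (cases "b = 2")
      case False
      then have "\<not> b - 1 \<le> 1" "\<not> q \<le> 1" using b by auto
      then show ?thesis using c[of 1] unfolding w by simp
    qed (use b1 True in simp)
    \<comment> \<open>The coefficient of \<open>x^b\<close>. Together with the equal numbers of ones
      it shows that \<open>M\<close>, of size \<open>d\<close>, has no parts besides 1 and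
      \<open>b\<close>; the total then allows exactly one \<open>b\<close>.\<close>
    have "int (count M b) + int (count M' 1) = int (count M' b) + int d"
      using c[of b] b M0 size True unfolding w by (cases "q = b") auto
    then have ge: "d \<le> count M b + count M 1" using e1 by simp
    define K where "K = filter_mset (\<lambda>x. x \<noteq> 1 \<and> x \<noteq> b) M"
    have "M = replicate_mset (count M 1) 1 + replicate_mset (count M b) b + K"
      using b by (auto intro!: multiset_eqI simp: K_def)
    moreover from arg_cong[OF this, of size] have "size K = 0" "count M b + count M 1 = d" using ge size True by auto
    ultimately have M: "M = replicate_mset (count M 1) 1 + replicate_mset (count M b) b" by simp
    have "count M 1 + count M b * b = b + d - 1" using arg_cong[OF M, of sum_mset] sum by simp
    then have "count M b * (b - 1) = b - 1" using \<open>count M b + count M 1 = d\<close> b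
      by (simp add: diff_mult_distrib2)
    then have cb: "count M b = 1" using b by simp
    then have M: "M = add_mset b (replicate_mset (d - 1) 1)" using M \<open>count M b + count M 1 = d\<close>
      by (metis One_nat_def add_diff_cancel_left' add_mset_replicate_mset_safe replicate_mset_0 replicate_mset_Suc union_mset_add_mset_right add.right_neutral)
    obtain e where e: "d = Suc e" using \<open>d \<noteq> 0\<close> by (cases d) auto
    have s: "omx (Suc k) - omx 1 = monom 1 1 * omx k" for k by (simp add: omx_def algebra_simps mult_monom)
    \<comment> \<open>Here \<open>(1 - x^b) - (1 - x) = x (1 - x^(b-1))\<close>, so the factor
      \<open>omx (b - 1)\<close> cancels and the same shape with \<open>q + 1\<close> in place of
      \<open>b\<close> remains for \<open>M'\<close>.\<close>
    have "w M = omx b - omx 1" unfolding w_def M e by (simp add: algebra_simps)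
    also have "\<dots> = monom 1 1 * omx (b - 1)" using s[of "b - 1"] b by simp
    finally have "omx (b - 1) * (monom 1 1 * omx q) = omx (b - 1) * w M'"
      using eq unfolding w_def[symmetric] by (simp add: mult_ac)
    then have "w M' = omx (Suc q) - omx 1" unfolding s using o by simp
    then have "(\<Sum>l\<in>#M'. omx l) = (\<Sum>l\<in>#add_mset (q + 1) (replicate_mset e 1). omx l)"
      unfolding w_def e by (simp add: algebra_simps)
    then have "M' = add_mset (q + 1) (replicate_mset e 1)" using pos by (intro sum_omx_inject) auto
    then show ?thesis using True M e by simp
  qed
qed

section \<open>Values of \<open>shape_val\<close> for one or two long rows among ones\<close>

lemma shape_val_ones:
  assumes "0 \<notin> set \<gamma>"
  shows "rib shape_val (replicate j 1 @ \<gamma>) = rib shape_val \<gamma> + int j * (rib shape_val (2 # \<gamma>) - 2 * rib shape_val \<gamma>)"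
    and "rib shape_val (2 # replicate j 1 @ \<gamma>)
      = rib shape_val (2 # \<gamma>) + int j * (2 * rib shape_val (2 # \<gamma>) - 4 * rib shape_val \<gamma>)"
\<comment> \<open>With \<open>u\<close> and \<open>v\<close> the values at \<gamma> and
  \<open>2 # \<gamma>\<close>, prepending a 1 maps \<open>(u, v)\<close> to
  \<open>(v - u, 3 v - 4 u)\<close>. This map minus the identity has square 0, so its iterates are
  linear in \<open>j\<close>.\<close>
proof (induction j)
  case (Suc j)
  let ?\<delta> = "replicate j 1 @ \<gamma>"
  have 1: "rib shape_val (1 # ?\<delta>) = rib shape_val (2 # ?\<delta>) - rib shape_val ?\<delta>"
    using assms by (intro shape_val_one) auto
  have 2: "rib shape_val (2 # 1 # ?\<delta>) = 4 * rib shape_val (1 # ?\<delta>) - rib shape_val (2 # ?\<delta>)"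
    using shape_val_long(2)[of 3 ?\<delta>] by (simp add: shape_val_def)
  {
    case 1
    show ?case using \<open>rib shape_val (1 # ?\<delta>) = _\<close> unfolding Suc by (simp add: algebra_simps)
  next
    case 2
    show ?case using \<open>rib shape_val (2 # 1 # ?\<delta>) = _\<close> unfolding 1 Suc by (simp add: algebra_simps)
  }
qed simp_all

lemma shape_val_two_long:
  assumes "2 \<le> k" "2 \<le> l"
  shows "rib shape_val (replicate m 1 @ k # replicate j 1 @ [l]) = 4 * (2 * int j + 3) * (int m + 1)"
proof -
  have l: "rib shape_val [l] = 4" "rib shape_val [2, l] = 12" using assms by (auto simp: shape_val_def)
  have "rib shape_val (2 # replicate j 1 @ [l]) = 12 + 8 * int j"
    using shape_val_ones(2)[of "[l]" j] assms l by simp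
  then have "rib shape_val (k # replicate j 1 @ [l]) = 12 + 8 * int j"
      "rib shape_val (2 # k # replicate j 1 @ [l]) = 3 * (12 + 8 * int j)"
    using shape_val_long[OF assms(1)] by (simp_all del: rib.simps(3))
  then show ?thesis
    using shape_val_ones(1)[of "k # replicate j 1 @ [l]" m] assms
    by (auto simp: algebra_simps simp del: rib.simps(3))
qed

lemma shape_val_one_long:
  assumes "2 \<le> k"
  shows "rib shape_val (replicate m 1 @ k # replicate n 1) = 4 * (int m + 1) * (int n + 1)"
proof -
  have "rib shape_val (2 # replicate n 1) = 4 + 4 * int n"
    using shape_val_ones(2)[of "[]" n] by (simp add: shape_val_def)
  then have "rib shape_val (k # replicate n 1) = 4 + 4 * int n"
      "rib shape_val (2 # k # replicate n 1) = 3 * (4 + 4 * int n)"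
    using shape_val_long[OF assms(1)] by (simp_all del: rib.simps(3))
  then show ?thesis
    using shape_val_ones(1)[of "k # replicate n 1" m] assms
    by (auto simp: algebra_simps simp del: rib.simps(3))
qed

lemma ones_around:
  assumes "mset xs = add_mset k (replicate_mset d (1::nat))"
  obtains i j where "xs = replicate i 1 @ k # replicate j 1" "i + j = d"
proof -
  have "k \<in> set xs" using assms by (metis set_mset_mset union_single_eq_member add_mset_add_single union_commute)
  then obtain ys zs where xs: "xs = ys @ k # zs" by (auto dest: split_list)
  then have m: "mset ys + mset zs = replicate_mset d 1" using assms by simp
  then have "x = 1" if "x \<in> set ys \<union> set zs" for x
    using that by (metis Un_iff in_replicate_mset set_mset_mset union_iff)
  then have "ys = replicate (length ys) 1" "zs = replicate (length zs) 1"
    by (auto intro!: replicate_eqI)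
  moreover have "length ys + length zs = d" using arg_cong[OF m, of size] by simp
  ultimately show ?thesis using that xs by metis
qed

section \<open>Positions of the long rows\<close>

text \<open>The Schur function is replaced by its expression as a difference of two ribbons, so that
  the hypothesis relates four ribbons and can be transferred to any ring.\<close>

definition schur_difference :: "nat list \<Rightarrow> nat list \<Rightarrow> nat \<Rightarrow> nat \<Rightarrow> nat \<Rightarrow> bool" where
  "schur_difference \<alpha> \<beta> a b d \<longleftrightarrow> composition \<alpha> \<and> composition \<beta> \<and> 2 \<le> b \<and> b \<le> a \<and>
     sum_list \<alpha> = a + b + d \<and> sum_list \<beta> = a + b + d \<and>
     ribbon_schur \<alpha> - ribbon_schur \<beta>
       = ribbon_schur (a # b # replicate d 1) - ribbon_schur ((b - 1) # (a + 1) # replicate d 1)"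

lemma schur_difference_rib:
  assumes "schur_difference \<alpha> \<beta> a b d"
  shows "rib f \<alpha> - rib f \<beta> = rib f (a # b # replicate d 1) - rib f ((b - 1) # (a + 1) # replicate d 1)"
  by (rule ribbon_schur_diff_transfer) (use assms in \<open>auto simp: schur_difference_def composition_def\<close>)

lemma ribbon_schur_rev:
  assumes "composition \<alpha>"
  shows "ribbon_schur (rev \<alpha>) = ribbon_schur \<alpha>"
proof -
  have "ribbon_schur (rev \<alpha>) - ribbon_schur \<alpha> = ribbon_schur \<alpha> - ribbon_schur \<alpha>"
    by (rule ribbon_schur_diff_eqI) (use assms in \<open>auto simp: rib_rev composition_def\<close>)
  then show ?thesis by (auto simp: fun_eq_iff)
qed

lemma schur_difference_rev:
  assumes "schur_difference \<alpha> \<beta> a b d" "\<alpha>' \<in> {\<alpha>, rev \<alpha>}" "\<beta>' \<in> {\<beta>, rev \<beta>}"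
  shows "schur_difference \<alpha>' \<beta>' a b d"
  using assms by (auto simp: schur_difference_def ribbon_schur_rev composition_def sum_list_rev)

lemma schur_difference_length:
  assumes "schur_difference \<alpha> \<beta> a b d" "length \<alpha> = length \<beta>"
  shows "d + 2 \<le> length \<alpha>"
proof (rule ccontr)
  assume l: "\<not> d + 2 \<le> length \<alpha>"
  \<comment> \<open>Vanishing at \<open>a + 1\<close> removes the second ribbon on the right from
    degree \<open>d + 2\<close>, where the first one contributes 1; compositions with fewer parts
    contribute nothing.\<close>
  define g :: "nat \<Rightarrow> int" where "g k = of_bool (k \<noteq> a + 1)" for k
  let ?r = "rib (\<lambda>k. monom (g k) 1)"
  have b: "2 \<le> b" "b \<le> a" using assms by (auto simp: schur_difference_def)
  have "coeff (?r \<alpha> - ?r \<beta>) (d + 2) = 0" 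
    using l assms(2) coeff_rib_above[of \<alpha> "d + 2" g] coeff_rib_above[of \<beta> "d + 2" g] by (simp del: One_nat_def)
  moreover have "coeff (?r (a # b # replicate d 1)) (d + 2) = 1"
    using coeff_rib_length[of g "a # b # replicate d 1"] b by (simp add: g_def prod_list_replicate)
  moreover have "coeff (?r ((b - 1) # (a + 1) # replicate d 1)) (d + 2) = 0"
    using coeff_rib_length[of g "(b - 1) # (a + 1) # replicate d 1"] by (simp add: g_def)
  ultimately show False unfolding schur_difference_rib[OF assms(1)] by simp
qed

lemma psums_two_long:
  "s \<in> psums (replicate m 1 @ k # replicate j 1 @ [l]) \<longleftrightarrow> 1 \<le> s \<and> s \<le> m \<or> m + k \<le> s \<and> s \<le> m + k + j"
proof -
  have "t \<in> psums (replicate j 1 @ [l]) \<longleftrightarrow> 1 \<le> t \<and> t \<le> j" for t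
    by (subst psums_replicate) auto
  then have "s - m \<in> psums (k # replicate j 1 @ [l]) \<longleftrightarrow>
      s - m = k \<or> (\<exists>t. s - m = k + t \<and> 1 \<le> t \<and> t \<le> j)"
    by (subst psums_Cons) auto
  also have "\<dots> \<longleftrightarrow> k \<le> s - m \<and> s - m \<le> k + j" by presburger
  finally have "s - m \<in> psums (k # replicate j 1 @ [l]) \<longleftrightarrow> k \<le> s - m \<and> s - m \<le> k + j" .
  then show ?thesis by (subst psums_replicate) auto
qed

text \<open>The values \<open>b\<close> and \<open>a + d\<close> add up to the size. The two ribbons
  on the right share all proper partial sums except \<open>a\<close> and \<open>b - 1\<close>; of
  these only \<open>a\<close> can lie in the pair, namely when \<open>a = b\<close>. For
  \<open>d > 0\<close> the pair consists of two different values.\<close>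

lemma schur_difference_psums:
  assumes "schur_difference \<alpha> \<beta> a b d" "length \<alpha> = length \<beta>" "0 < d"
  shows "(-1) ^ (length \<alpha> + d) * (of_bool (b \<in> psums \<alpha>) + of_bool (a + d \<in> psums \<alpha>)
      - of_bool (b \<in> psums \<beta>) - of_bool (a + d \<in> psums \<beta>)) = (of_bool (a = b) :: int)"
proof -
  let ?\<gamma> = "a # b # replicate d 1" and ?\<delta> = "(b - 1) # (a + 1) # replicate d 1"
  let ?v = "\<lambda>\<gamma>. of_bool (b \<in> psums \<gamma>) + of_bool (a + d \<in> psums \<gamma>) :: int"
  have b: "2 \<le> b" "b \<le> a" and c: "composition \<alpha>" "composition \<beta>"
    and s: "b + (a + d) = sum_list \<alpha>" "b + (a + d) = sum_list \<beta>"
    using assms by (auto simp: schur_difference_def)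
  have c': "composition ?\<gamma>" "composition ?\<delta>" using b by (auto simp: composition_def)
  have s': "b + (a + d) = sum_list ?\<gamma>" "b + (a + d) = sum_list ?\<delta>" using b by (auto simp: sum_list_replicate)
  have ne: "b \<noteq> a + d" using b assms(3) by simp
  have "(-1) ^ length \<alpha> * ?v \<alpha> - (-1) ^ length \<beta> * ?v \<beta> = (-1) ^ length ?\<gamma> * ?v ?\<gamma> - (-1) ^ length ?\<delta> * ?v ?\<delta>"
    using arg_cong[OF schur_difference_rib[OF assms(1), of "\<lambda>k. monom (of_bool (k = b \<or> k = a + d) :: int) 1"], of "\<lambda>p. coeff p 2"]
    unfolding coeff_diff coeff_rib_2_pair[OF c(1) s(1) ne] coeff_rib_2_pair[OF c(2) s(2) ne]
      coeff_rib_2_pair[OF c'(1) s'(1) ne] coeff_rib_2_pair[OF c'(2) s'(2) ne] .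
  then have "(-1) ^ length \<alpha> * (?v \<alpha> - ?v \<beta>) = (-1) ^ d * (?v ?\<gamma> - ?v ?\<delta>)"
    using assms(2) by (simp add: right_diff_distrib)
  moreover have "?v ?\<gamma> - ?v ?\<delta> = of_bool (a = b)"
  proof -
    define B where "B = (\<lambda>s. s = a + b \<or> (\<exists>t. s = a + b + t \<and> t \<in> psums (replicate d 1)))"
    have r: "replicate d (1::nat) \<noteq> []" using assms(3) by simp
    have \<gamma>: "s \<in> psums ?\<gamma> \<longleftrightarrow> s = a \<or> B s" for s
      unfolding B_def by (auto simp: psums_Cons[OF r] psums_Cons simp del: psums.simps One_nat_def)
    have \<delta>: "s \<in> psums ?\<delta> \<longleftrightarrow> s = b - 1 \<or> B s" for s
    proof -
      have "s \<in> psums ?\<delta> \<longleftrightarrow> s = b - 1 \<or> s = (b - 1) + (a + 1)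
          \<or> (\<exists>t. s = (b - 1) + (a + 1) + t \<and> t \<in> psums (replicate d 1))"
        by (auto simp: psums_Cons[OF r] psums_Cons add.assoc simp del: psums.simps One_nat_def)
      moreover have "(b - 1) + (a + 1) = a + b" using b by simp
      ultimately show ?thesis unfolding B_def by presburger
    qed
    have "\<not> B b" using b by (auto simp: B_def)
    then show ?thesis unfolding \<gamma> \<delta> using b assms(3) by auto
  qed
  ultimately have "(-1) ^ length \<alpha> * (?v \<alpha> - ?v \<beta>) = (-1) ^ d * of_bool (a = b)" by simp
  then have "(-1) ^ d * ((-1) ^ length \<alpha> * (?v \<alpha> - ?v \<beta>)) = of_bool (a = b)"
    by (simp flip: power_mult_distrib mult.assoc)
  then show ?thesis by (simp add: power_add algebra_simps)
qed

lemma schur_difference_psums_even: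
  assumes "schur_difference \<alpha> \<beta> a b d" "length \<alpha> = length \<beta>" "0 < d" "even (length \<alpha> + d)"
  shows "of_bool (b \<in> psums \<alpha>) + of_bool (a + d \<in> psums \<alpha>)
    = (of_bool (b \<in> psums \<beta>) + of_bool (a + d \<in> psums \<beta>) + of_bool (a = b) :: int)"
  using schur_difference_psums[OF assms(1-3)] assms(4) by (simp add: minus_one_power_iff)

lemma schur_difference_psums_odd:
  assumes "schur_difference \<alpha> \<beta> a b d" "length \<alpha> = length \<beta>" "0 < d" "odd (length \<alpha> + d)"
  shows "of_bool (b \<in> psums \<beta>) + of_bool (a + d \<in> psums \<beta>)
    = (of_bool (b \<in> psums \<alpha>) + of_bool (a + d \<in> psums \<alpha>) + of_bool (a = b) :: int)"
  using schur_difference_psums[OF assms(1-3)] assms(4) by (simp add: minus_one_power_iff)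

lemma shape_val_two_rows:
  assumes "2 \<le> a" "2 \<le> b"
  shows "rib shape_val (a # b # replicate d 1) = 12 * (int d + 1)"
  using shape_val_two_long[OF assms(2,1), of d 0] rib_rev[of shape_val "a # b # replicate d 1"] by simp

text \<open>The two ribbons on the right have their long rows in the same places, hence the same
  value, unless \<open>b = 2\<close> turns the row \<open>b - 1\<close> into a 1.\<close>

lemma schur_difference_shape:
  assumes "schur_difference \<alpha> \<beta> a b d"
  shows "rib shape_val \<alpha> - rib shape_val \<beta> = (if b = 2 then 4 * (int d + 1) else 0)"
proof -
  have b: "2 \<le> b" "b \<le> a" using assms by (auto simp: schur_difference_def)
  have 1: "rib shape_val (a # b # replicate d 1) = 12 * (int d + 1)" using b by (intro shape_val_two_rows) auto
  show ?thesis
  proof (cases "b = 2")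
    case True
    then have "rib shape_val ((b - 1) # (a + 1) # replicate d 1) = 8 * (int d + 1)"
      using shape_val_one_long[of "a + 1" 1 d] b by simp
    then show ?thesis unfolding schur_difference_rib[OF assms] 1 using True by simp
  next
    case False
    then have "rib shape_val ((b - 1) # (a + 1) # replicate d 1) = 12 * (int d + 1)"
      using b by (intro shape_val_two_rows) auto
    then show ?thesis unfolding schur_difference_rib[OF assms] 1 using False by simp
  qed
qed

text \<open>With \<open>s = i + j\<close> fixed, the product is a quadratic in \<open>j\<close> that repeats a value only at
  \<open>j\<close> and \<open>s + 1/2 - j\<close>.\<close>

lemma shape_product_inj:
  fixes i j i' j' :: nat
  assumes "(2 * int j + 3) * (int i + 2) = (2 * int j' + 3) * (int i' + 2)" "i + j = i' + j'"
  shows "j = j'"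
proof -
  define s where "s = int i + int j"
  have i: "int i = s - int j" "int i' = s - int j'" using assms(2) by (auto simp: s_def)
  have "(int j - int j') * (2 * s + 1 - 2 * (int j + int j')) = 0"
    using assms(1) unfolding i by (simp add: algebra_simps)
  then have "int j = int j' \<or> 2 * s + 1 = 2 * (int j + int j')" by auto
  moreover have "2 * s + 1 \<noteq> 2 * (int j + int j')" by presburger
  ultimately show ?thesis by simp
qed

text \<open>For \<open>b > 2\<close>, \<open>shape_val\<close> forces equal gaps
  \<open>j = j'\<close>, and the partial sums force the gap to be 0. For \<open>b = 2\<close> the
  last row of the second composition joins the ones, and its long row may stand at either end of the
  range.\<close>

lemma positions_one_a_even:
  assumes S: "schur_difference (replicate (i + 1) 1 @ b # replicate j 1 @ [a])
      (replicate (i' + 1) 1 @ (a + 1) # replicate j' 1 @ [b - 1]) a b d"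
    and d: "i + j + 1 = d" "i' + j' + 1 = d"
  shows "j = 0" and "j' = 0 \<or> b = 2 \<and> i' = 0"
proof -
  have b: "2 \<le> b" "b \<le> a" using S by (auto simp: schur_difference_def)
  let ?A = "replicate (i + 1) 1 @ b # replicate j 1 @ [a]"
  let ?B = "replicate (i' + 1) 1 @ (a + 1) # replicate j' 1 @ [b - 1]"
  have l: "length ?A = d + 2" "length ?B = d + 2" using d by auto
  have "0 < d" "even (length ?A + d)" "length ?A = length ?B" using d l by auto
  note P = schur_difference_psums_even[OF S this(3,1,2), unfolded psums_two_long]
  have A: "rib shape_val ?A = 4 * ((2 * int j + 3) * (int i + 2))"
    using shape_val_two_long[of b a "i + 1" j] b by (simp add: algebra_simps)
  have "j = 0 \<and> (j' = 0 \<or> b = 2 \<and> i' = 0)"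
  proof (cases "b = 2")
    case False
    have "rib shape_val ?B = 4 * ((2 * int j' + 3) * (int i' + 2))"
      using shape_val_two_long[of "a + 1" "b - 1" "i' + 1" j'] b False by (simp add: algebra_simps)
    then have "j = j'" using schur_difference_shape[OF S] A False d by (intro shape_product_inj[of j i j' i']) auto
    moreover have "j = 0" using P b d calculation by (auto split: if_splits simp: of_bool_def)
    ultimately show ?thesis by simp
  next
    case True
    have "?B = replicate (i' + 1) 1 @ (a + 1) # replicate (j' + 1) 1" using True by (simp add: replicate_append_same)
    then have "rib shape_val ?B = 4 * ((int i' + 2) * (int j' + 2))"
      using shape_val_one_long[of "a + 1" "i' + 1" "j' + 1"] b by (simp add: algebra_simps)
    then have e: "(2 * int j + 3) * (int i + 2) = (int i' + 2) * (int j' + 2) + (int d + 1)"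
      using schur_difference_shape[OF S] A True by simp
    \<comment> \<open>Comparing partial sums leaves at most one of \<open>i'\<close>,
      \<open>j'\<close> positive; the product of runs then has a single value, and the equation for
      \<open>j\<close> has no nonzero solution by parity.\<close>
    have z: "i' = 0 \<or> j' = 0" using P b d True by (auto split: if_splits simp: of_bool_def)
    then have "(int i' + 2) * (int j' + 2) = 2 * (int d + 1)" using d by auto
    moreover have i: "int i = int d - 1 - int j" using d by simp
    ultimately have "int j * (2 * int d - 1 - 2 * int j) = 0" using e unfolding i by (simp add: algebra_simps)
    moreover have "2 * int d - 1 - 2 * int j \<noteq> 0" by presburger
    ultimately show ?thesis using True z by auto
  qed
  then show "j = 0" "j' = 0 \<or> b = 2 \<and> i' = 0" by auto
qed

text \<open>For \<open>b = 2\<close> the second composition is a column of ones followed by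
  \<open>a\<close>, whatever \<open>i\<close> and \<open>j\<close> are, and \<open>shape_val\<close>
  alone gives \<open>i' * j' = 0\<close>. Otherwise it gives \<open>j = j'\<close>, and the partial
  sums put the inner long row next to one end of its range.\<close>

lemma positions_one_a_odd:
  assumes S: "schur_difference (replicate (i' + 1) 1 @ a # replicate j' 1 @ [b - 1])
      (replicate (i + 1) 1 @ (b - 1) # replicate j 1 @ [a]) a b d"
    and d: "i + j = d" "i' + j' = d"
  shows "b = 2 \<and> (i' = 0 \<or> j' = 0) \<or> i = 0 \<and> i' = 0 \<or> j = 0 \<and> j' = 0"
proof -
  have b: "2 \<le> b" "b \<le> a" using S by (auto simp: schur_difference_def)
  let ?B = "replicate (i + 1) 1 @ (b - 1) # replicate j 1 @ [a]"
  let ?A = "replicate (i' + 1) 1 @ a # replicate j' 1 @ [b - 1]"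
  show ?thesis
  proof (cases "b = 2")
    case False
    have "rib shape_val ?B = 4 * ((2 * int j + 3) * (int i + 2))"
      using shape_val_two_long[of "b - 1" a "i + 1" j] b False by (simp add: algebra_simps)
    moreover have "rib shape_val ?A = 4 * ((2 * int j' + 3) * (int i' + 2))"
      using shape_val_two_long[of a "b - 1" "i' + 1" j'] b False by (simp add: algebra_simps)
    ultimately have j: "j = j'"
      using schur_difference_shape[OF S] False d by (intro shape_product_inj[of j i j' i']) auto
    have "i = 0 \<or> j = 0"
    \<comment> \<open>For \<open>d = 0\<close> the pair of partial sums may degenerate, but then
      \<open>i\<close> and \<open>j\<close> are 0 anyway.\<close>
    proof (cases "d = 0")
      case False
      have l: "length ?A = d + 3" "length ?B = d + 3" using d by auto
      have "0 < d" "odd (length ?A + d)" "length ?A = length ?B" using False l by auto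
      note P = schur_difference_psums_odd[OF S this(3,1,2), unfolded psums_two_long]
      then show ?thesis using b d j by (auto split: if_splits simp: of_bool_def)
    qed (use d in simp)
    then show ?thesis using j d by auto
  next
    case True
    have "?B = replicate (d + 2) 1 @ a # replicate 0 1"
      using True d by (auto simp: replicate_append_same replicate_app_Cons_same simp flip: replicate_add append_assoc)
    then have "rib shape_val ?B = rib shape_val (replicate (d + 2) 1 @ a # replicate 0 1)" by (rule arg_cong)
    also have "\<dots> = 4 * (int (d + 2) + 1) * (int 0 + 1)" by (rule shape_val_one_long) (use b in simp)
    finally have B: "rib shape_val ?B = 4 * (int (d + 2) + 1) * (int 0 + 1)" .
    have "?A = replicate (i' + 1) 1 @ a # replicate (j' + 1) 1" using True by (simp add: replicate_append_same)
    then have "rib shape_val ?A = rib shape_val (replicate (i' + 1) 1 @ a # replicate (j' + 1) 1)" by (rule arg_cong)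
    also have "\<dots> = 4 * (int (i' + 1) + 1) * (int (j' + 1) + 1)" by (rule shape_val_one_long) (use b in simp)
    finally have A: "rib shape_val ?A = 4 * (int (i' + 1) + 1) * (int (j' + 1) + 1)" .
    have "(int i' + 2) * (int j' + 2) = 2 * int d + 4"
      using schur_difference_shape[OF S, unfolded A B] True by (simp add: algebra_simps)
    moreover have "int d = int i' + int j'" using d by simp
    ultimately have "int i' * int j' = 0" by (simp add: algebra_simps)
    then show ?thesis using True by auto
  qed
qed

lemma positions_c_b_even:
  assumes S: "schur_difference (c # replicate i 1 @ b # replicate j 1 @ [b])
      (c # replicate i' 1 @ (b + 1) # replicate j' 1 @ [b - 1]) a b d"
    and d: "i + j + 1 = d" "i' + j' + 1 = d" and c: "1 < c" "a = c + b - 1"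
  shows False
proof -
  have b: "2 \<le> b" "b \<le> a" using S by (auto simp: schur_difference_def)
  let ?A = "c # replicate i 1 @ b # replicate j 1 @ [b]"
  let ?B = "c # replicate i' 1 @ (b + 1) # replicate j' 1 @ [b - 1]"
  \<comment> \<open>The zeros at \<open>a\<close> and \<open>a + 1\<close> kill both products on the
    right. The first composition contains \<open>b\<close> twice and gets the factor 4, the second
    gets at most 1 from \<open>b + 1\<close> and \<open>b - 1\<close>; so the parts alone, without
    their order, are contradictory.\<close>
  define g :: "nat \<Rightarrow> int" where "g k = (if k = a \<or> k = a + 1 then 0 else if k = b then 2 else 1)" for k
  have g1: "g 1 = 1" "g a = 0" "g (a + 1) = 0" "g b = 2" "g (b - 1) = 1" "g (b + 1) \<le> 1" "0 < g c"
    using b c by (auto simp: g_def)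
  have "prod_list (map g ?A) - prod_list (map g ?B)
      = prod_list (map g (a # b # replicate d 1)) - prod_list (map g ((b - 1) # (a + 1) # replicate d 1))"
    using arg_cong[OF schur_difference_rib[OF S, of "\<lambda>k. monom (g k) 1"], of "\<lambda>p. coeff p (d + 2)"]
      coeff_rib_length[of g ?A] coeff_rib_length[of g ?B]
      coeff_rib_length[of g "a # b # replicate d 1"] coeff_rib_length[of g "(b - 1) # (a + 1) # replicate d 1"] d
    by (simp del: rib.simps prod_list.Cons)
  then have "g c * 4 - g c * g (b + 1) = 0"
    using g1 by (simp add: prod_list_replicate)
  then have "g c * (4 - g (b + 1)) = 0" by (simp add: algebra_simps)
  then show False using g1 by auto
qed

section \<open>Sums of adjacent parts\<close>

lemma merge_sum_ones:
  assumes "g 1 = 1" "g k = 1" "prod_list (map g \<gamma>) = 1"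
  shows "merge_sum g (replicate m 1 @ k # \<gamma>)
    = (if m = 0 then 0 else (int m - 1) * g 2 + g (1 + k)) + merge_sum g (k # \<gamma>)"
proof (induction m)
  case (Suc m)
  show ?case
  proof (cases m)
    case 0
    then show ?thesis using assms by simp
  next
    case (Suc m')
    have "merge_sum g (replicate (Suc m) 1 @ k # \<gamma>) = g 2 + merge_sum g (replicate m 1 @ k # \<gamma>)"
      using assms unfolding Suc by (simp add: prod_list_replicate numeral_2_eq_2)
    then show ?thesis using Suc.IH Suc by (simp add: algebra_simps)
  qed
qed simp

lemma merge_sum_four:
  assumes "g 1 = 1" "g c = 1" "g k = 1" "g l = 1"
  shows "merge_sum g (c # replicate i 1 @ k # replicate j 1 @ [l])
    = (if i = 0 then g (c + k) else g (c + 1) + (int i - 1) * g 2 + g (1 + k))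
    + (if j = 0 then g (k + l) else g (k + 1) + (int j - 1) * g 2 + g (1 + l))"
proof -
  have r: "merge_sum g (k # replicate j 1 @ [l]) = (if j = 0 then g (k + l) else g (k + 1) + (int j - 1) * g 2 + g (1 + l))"
  proof (cases j)
    case (Suc j')
    have "merge_sum g (k # replicate j 1 @ [l]) = g (k + 1) + merge_sum g (replicate j 1 @ [l])"
      using assms unfolding Suc by (simp add: prod_list_replicate)
    then show ?thesis using merge_sum_ones[of g l "[]" j] assms Suc by simp
  qed (use assms in simp)
  show ?thesis
  proof (cases i)
    case 0
    then show ?thesis using r assms by (simp add: prod_list_replicate)
  next
    case (Suc i')
    have "merge_sum g (c # replicate i 1 @ k # replicate j 1 @ [l]) = g (c + 1) + merge_sum g (replicate i 1 @ k # replicate j 1 @ [l])"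
      using assms unfolding Suc by (simp add: prod_list_replicate)
    then show ?thesis using r merge_sum_ones[of g k "replicate j 1 @ [l]" i] assms Suc by (simp add: prod_list_replicate)
  qed
qed

text \<open>Both compositions have the same parts, so their top coefficients cancel. One degree
  lower, the adjacent merges of the two are compared with the products over the parts on the
  right.\<close>

lemma positions_c_b_odd:
  assumes S: "schur_difference (c # replicate i' 1 @ b # replicate j' 1 @ [b - 1])
      (c # replicate i 1 @ (b - 1) # replicate j 1 @ [b]) a b d"
    and d: "i + j = d" "i' + j' = d" and c: "1 < c" "a = c + b - 1"
  shows "i' = 0 \<or> j' = 0 \<and> c = b - 1" and "i = 0 \<or> b = 2 \<or> j = 0 \<and> c = b"
proof -
  have b: "2 \<le> b" "b \<le> a" using S by (auto simp: schur_difference_def)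
  let ?A = "c # replicate i' 1 @ b # replicate j' 1 @ [b - 1]"
  let ?B = "c # replicate i 1 @ (b - 1) # replicate j 1 @ [b]"
  have M: "merge_sum g ?B - merge_sum g ?A
      = prod_list (map g (a # b # replicate d 1)) - prod_list (map g ((b - 1) # (a + 1) # replicate d 1))" for g
  proof -
    have "length ?A - 1 = d + 2" "length ?B - 1 = d + 2" using d by auto
    then show ?thesis
      using arg_cong[OF schur_difference_rib[OF S, of "\<lambda>k. monom (g k) 1"], of "\<lambda>p. coeff p (d + 2)"]
        coeff_rib_length_pred[of ?A g] coeff_rib_length_pred[of ?B g]
        coeff_rib_length[of g "a # b # replicate d 1"] coeff_rib_length[of g "(b - 1) # (a + 1) # replicate d 1"]
      by (simp del: rib.simps prod_list.Cons merge_sum.simps)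
  qed
  show "i' = 0 \<or> j' = 0 \<and> c = b - 1"
  proof -
    \<comment> \<open>All parts have value 1, so a merge counts 1 unless it produces
      \<open>a + 1 = c + b\<close>. The first composition must have exactly one more such merge than
      the second.\<close>
    define g :: "nat \<Rightarrow> int" where "g k = of_bool (k \<noteq> a + 1)" for k
    have g: "g 1 = 1" "g c = 1" "g b = 1" "g (b - 1) = 1" "g a = 1" "g (a + 1) = 0" using b c by (auto simp: g_def)
    have "merge_sum g ?B - merge_sum g ?A = 1" unfolding M using g by (simp add: prod_list_replicate)
    moreover have "g 2 = 1" "g (c + 1) = 1" "g (c + b) = 0" "g (c + (b - 1)) = 1" "g (1 + b) = 1" "g (b + 1) = 1"
      "g (1 + (b - 1)) = 1" "g (b - 1 + 1) = 1" "g (b + (b - 1)) = of_bool (c \<noteq> b - 1)" "g (b - 1 + b) = of_bool (c \<noteq> b - 1)"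
      using b c by (auto simp: g_def)
    ultimately show ?thesis
      unfolding merge_sum_four[OF g(1,2,3,4)] merge_sum_four[OF g(1,2,4,3)] using d
      by (auto split: if_splits simp: of_bool_def)
  qed
  show "i = 0 \<or> b = 2 \<or> j = 0 \<and> c = b"
  proof -
    \<comment> \<open>The same count for \<open>a = c + (b - 1)\<close>; now the second composition
      has exactly one more such merge.\<close>
    define g :: "nat \<Rightarrow> int" where "g k = of_bool (k \<noteq> a)" for k
    have g: "g 1 = 1" "g c = 1" "g b = 1" "g (b - 1) = 1" "g a = 0" "g (a + 1) = 1" using b c by (auto simp: g_def)
    have "merge_sum g ?B - merge_sum g ?A = -1" unfolding M using g by (simp add: prod_list_replicate)
    moreover have "g 2 = 1" "g (c + 1) = of_bool (b \<noteq> 2)" "g (c + b) = 1" "g (c + (b - 1)) = 0"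
      "g (1 + b) = of_bool (c \<noteq> 2)" "g (b + 1) = of_bool (c \<noteq> 2)" "g (1 + (b - 1)) = 1" "g (b - 1 + 1) = 1"
      "g (b + (b - 1)) = of_bool (c \<noteq> b)" "g (b - 1 + b) = of_bool (c \<noteq> b)"
      using b c by (auto simp: g_def)
    ultimately show ?thesis
      unfolding merge_sum_four[OF g(1,2,3,4)] merge_sum_four[OF g(1,2,4,3)] using d
      by (auto split: if_splits simp: of_bool_def)
  qed
qed

section \<open>Classification\<close>

text \<open>Both sides are expanded and the negative monomials moved across, so that all
  coefficients count exponents and the identity becomes one of multisets.\<close>

lemma ends_mset_eq:
  assumes "omx x1 * omx x2 - omx y1 * omx y2 = omx 1 * (monom 1 (b - 1) - monom 1 a)"
    and "0 < b"
  shows "{#y1, y2, x1 + x2, a, b#} = {#x1, x2, y1 + y2, a + 1, b - 1#}"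
proof -
  have e: "omx u * omx v = 1 - monom 1 u - monom 1 v + monom 1 (u + v)" for u v
    by (simp add: omx_def algebra_simps mult_monom)
  have "omx 1 * (monom 1 (b - 1) - monom 1 a) = monom 1 (b - 1) - monom 1 a - monom 1 b + monom 1 (a + 1)"
    using assms(2) by (simp add: omx_def algebra_simps mult_monom)
  then have eq: "monom 1 y1 + monom 1 y2 + monom 1 (x1 + x2) + monom 1 a + monom 1 b
      = (monom 1 x1 + monom 1 x2 + monom 1 (y1 + y2) + monom 1 (a + 1) + monom 1 (b - 1) :: int poly)"
    using assms(1) unfolding e by (simp add: algebra_simps)
  have m: "coeff (monom (1 :: int) k) m = int (count {#k#} m)" for k m by (simp add: coeff_monom)
  have "{#y1#} + {#y2#} + {#x1 + x2#} + {#a#} + {#b#} = {#x1#} + {#x2#} + {#y1 + y2#} + {#a + 1#} + {#b - 1#}"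
  proof (rule multiset_eqI)
    fix m
    show "count ({#y1#} + {#y2#} + {#x1 + x2#} + {#a#} + {#b#}) m
        = count ({#x1#} + {#x2#} + {#y1 + y2#} + {#a + 1#} + {#b - 1#}) m"
      using arg_cong[OF eq, of "\<lambda>p. coeff p m"] unfolding coeff_add m count_union of_nat_add[symmetric] of_nat_eq_iff .
  qed
  then show ?thesis by (simp add: add_mset_commute)
qed

lemma common_end_classify:
  fixes mx my :: "nat list"
  assumes pos: "0 < p" "0 < x" "0 < y" "0 \<notin> set mx" "0 \<notin> set my"
    and len: "length mx = d + r" "length my = d + r"
    and sum: "p + x + sum_list mx = a + b + d" and b: "2 \<le> b" "b \<le> a"
    and eq: "{#y, p + x, a, b#} = {#x, p + y, a + 1, b - 1#}"
    and ii: "omx p * omx x * (\<Sum>l\<leftarrow>mx. omx l) - omx p * omx y * (\<Sum>l\<leftarrow>my. omx l)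
      = of_nat d * omx 1 * (omx p * omx x - omx p * omx y)"
  shows "y = b - 1 \<and> (x = a \<and> p = 1 \<or> x = b \<and> p = a - b + 1) \<and>
    (r = 1 \<and> mset mx = add_mset (b - 1) (replicate_mset d 1) \<and> mset my = add_mset x (replicate_mset d 1)
    \<or> r = 0 \<and> 0 < d \<and> mset mx = add_mset b (replicate_mset (d - 1) 1) \<and> mset my = add_mset (x + 1) (replicate_mset (d - 1) 1))"
proof -
  have e: "y = b - 1" "x = a \<and> p = 1 \<or> x = b \<and> p = a - b + 1"
    using ends_common[OF pos(2,3,1) b eq] by auto
  have "omx p * (omx x * ((\<Sum>l\<leftarrow>mx. omx l) - of_nat d * omx 1)) = omx p * (omx y * ((\<Sum>l\<leftarrow>my. omx l) - of_nat d * omx 1))"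
    using ii by (simp add: algebra_simps)
  then have "omx x * ((\<Sum>l\<leftarrow>mx. omx l) - of_nat d * omx 1) = omx (b - 1) * ((\<Sum>l\<leftarrow>my. omx l) - of_nat d * omx 1)"
    using omx_neq_0[OF pos(1)] unfolding e(1) by simp
  then have "omx x * ((\<Sum>l\<in>#mset mx. omx l) - of_nat d * omx 1) = omx (b - 1) * ((\<Sum>l\<in>#mset my. omx l) - of_nat d * omx 1)"
    by (simp only: mset_map[symmetric] sum_mset_sum_list)
  moreover have "sum_mset (mset mx) = b + d - 1" using sum e(2) b by (auto simp: sum_mset_sum_list)
  ultimately have "r = 1 \<and> mset mx = add_mset (b - 1) (replicate_mset d 1) \<and> mset my = add_mset x (replicate_mset d 1)
    \<or> r = 0 \<and> 0 < d \<and> mset mx = add_mset b (replicate_mset (d - 1) 1) \<and> mset my = add_mset (x + 1) (replicate_mset (d - 1) 1)"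
    using pos len b e(2) by (intro middles_classify) auto
  then show ?thesis using e by blast
qed

lemma all_ones_list:
  assumes "0 \<notin> set xs" "sum_list xs \<le> length (xs :: nat list)"
  shows "xs = replicate (length xs) 1"
proof -
  have "mset xs = replicate_mset (length xs) 1"
    using all_ones_mset[of "mset xs"] assms by (simp add: sum_mset_sum_list)
  then have "x = 1" if "x \<in> set xs" for x using that by (metis in_replicate_mset set_mset_mset)
  then show ?thesis by (intro replicate_eqI) auto
qed

text \<open>\<open>X\<close> is the composition whose end-row product has the positive sign: it
  comes from \<alpha> for even \<open>r\<close> and from \<beta> for odd \<open>r\<close>. The
  common end row is placed first.\<close>

definition common_end_pair :: "nat \<Rightarrow> nat \<Rightarrow> nat \<Rightarrow> nat \<Rightarrow> nat list \<Rightarrow> nat list \<Rightarrow> bool" where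
  "common_end_pair a b d r X Y \<longleftrightarrow> (\<exists>p x mx my. X = p # mx @ [x] \<and> Y = p # my @ [b - 1] \<and>
     (x = a \<and> p = 1 \<or> x = b \<and> p = a - b + 1) \<and>
     (r = 1 \<and> mset mx = add_mset (b - 1) (replicate_mset d 1) \<and> mset my = add_mset x (replicate_mset d 1)
     \<or> r = 0 \<and> 0 < d \<and> mset mx = add_mset b (replicate_mset (d - 1) 1)
       \<and> mset my = add_mset (x + 1) (replicate_mset (d - 1) 1)))"

text \<open>If an end row is shared, reversals bring it to the front of both compositions. If none
  is, the end rows of each composition add up to \<open>a + b\<close>, so the \<open>d + r\<close>
  middle rows add up to \<open>d\<close>: they are all 1 and \<open>r = 0\<close>.\<close>

lemma ends_middles_classify:
  assumes X: "X = x1 # mx @ [x2]" and Y: "Y = y1 # my @ [y2]"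
    and pos: "0 \<notin> set X" "0 \<notin> set Y" and len: "length mx = d + r" "length my = d + r"
    and sum: "sum_list X = a + b + d" "sum_list Y = a + b + d" and b: "2 \<le> b" "b \<le> a"
    and i: "omx x1 * omx x2 - omx y1 * omx y2 = omx 1 * (monom 1 (b - 1) - monom 1 a)"
    and ii: "omx x1 * omx x2 * (\<Sum>l\<leftarrow>mx. omx l) - omx y1 * omx y2 * (\<Sum>l\<leftarrow>my. omx l)
      = of_nat d * omx 1 * (omx x1 * omx x2 - omx y1 * omx y2)"
  shows "\<exists>X'\<in>{X, rev X}. \<exists>Y'\<in>{Y, rev Y}.
    r = 0 \<and> X' = b # replicate d 1 @ [a] \<and> Y' = (b - 1) # replicate d 1 @ [a + 1] \<or>
    common_end_pair a b d r X' Y'"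
proof -
  define A where "A X' Y' \<longleftrightarrow> r = 0 \<and> X' = b # replicate d 1 @ [a] \<and> Y' = (b - 1) # replicate d 1 @ [a + 1]" for X' Y'
  define B where "B = common_end_pair a b d r"
  have p: "0 < x1" "0 < x2" "0 < y1" "0 < y2" "0 \<notin> set mx" "0 \<notin> set my" using pos X Y by auto
  have sx: "x1 + x2 + sum_list mx = a + b + d" "x2 + x1 + sum_list mx = a + b + d" using sum X by auto
  have sr: "(\<Sum>l\<leftarrow>rev ls. omx l) = (\<Sum>l\<leftarrow>ls. omx l)" for ls by (simp add: rev_map[symmetric] sum_list_rev)
  have eq: "{#y1, y2, x1 + x2, a, b#} = {#x1, x2, y1 + y2, a + 1, b - 1#}" using i b by (intro ends_mset_eq) auto
  have B: "B (p # mx' @ [x]) (p # my' @ [y])"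
    if "{#y, p + x, a, b#} = {#x, p + y, a + 1, b - 1#}" "0 < p" "0 < x" "0 < y" "p + x + sum_list mx' = a + b + d"
      "0 \<notin> set mx'" "0 \<notin> set my'" "length mx' = d + r" "length my' = d + r"
      "omx p * omx x * (\<Sum>l\<leftarrow>mx'. omx l) - omx p * omx y * (\<Sum>l\<leftarrow>my'. omx l)
        = of_nat d * omx 1 * (omx p * omx x - omx p * omx y)" for p x y mx' my'
    using common_end_classify[OF that(2,3,4,6,7,8,9,5) b that(1,10)] unfolding B_def common_end_pair_def by blast
  consider "x1 = y1" | "x1 = y2" | "x2 = y1" | "x2 = y2" | "x1 \<noteq> y1" "x1 \<noteq> y2" "x2 \<noteq> y1" "x2 \<noteq> y2" by blast
  then have "\<exists>X'\<in>{X, rev X}. \<exists>Y'\<in>{Y, rev Y}. A X' Y' \<or> B X' Y'"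
  proof cases
    case 1
    have "B (x1 # mx @ [x2]) (x1 # my @ [y2])"
      by (rule B) (use 1 eq p len sx ii in \<open>auto simp: add_mset_commute\<close>)
    then have "B X Y" using X Y 1 by simp
    then show ?thesis by blast
  next
    case 2
    have "B (x1 # mx @ [x2]) (x1 # rev my @ [y1])"
      by (rule B) (use 2 eq p len sx ii in \<open>auto simp: add_mset_commute sr mult_ac add.commute\<close>)
    then have "B X (rev Y)" using X Y 2 by simp
    then show ?thesis by blast
  next
    case 3
    have "B (x2 # rev mx @ [x1]) (x2 # my @ [y2])"
      by (rule B) (use 3 eq p len sx ii in \<open>auto simp: add_mset_commute sr mult_ac add.commute\<close>)
    then have "B (rev X) Y" using X Y 3 by simp
    then show ?thesis by blast
  next
    case 4
    have "B (x2 # rev mx @ [x1]) (x2 # rev my @ [y1])"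
      by (rule B) (use 4 eq p len sx ii in \<open>auto simp: add_mset_commute sr mult_ac add.commute\<close>)
    then have "B (rev X) (rev Y)" using X Y 4 by simp
    then show ?thesis by blast
  next
    case 5
    have e: "x1 = a \<and> x2 = b \<or> x1 = b \<and> x2 = a" "y1 = a + 1 \<and> y2 = b - 1 \<or> y1 = b - 1 \<and> y2 = a + 1"
      using ends_cases[OF p(1-4) b eq 5] by auto
    have s: "sum_list mx = d" "sum_list my = d" using sum X Y e b by auto
    have r: "r = 0" using size_le_sum_mset[of "mset mx"] p len s by (simp add: sum_mset_sum_list)
    have m: "mx = replicate d 1" "my = replicate d 1"
      using all_ones_list[of mx] all_ones_list[of my] p len s r by auto
    have "b # replicate d 1 @ [a] \<in> {X, rev X}" using e(1) unfolding X m by auto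
    moreover have "(b - 1) # replicate d 1 @ [a + 1] \<in> {Y, rev Y}" using e(2) unfolding Y m by auto
    ultimately show ?thesis using r unfolding A_def by blast
  qed
  then show ?thesis unfolding A_def B_def .
qed

definition listed_pair :: "nat \<Rightarrow> nat \<Rightarrow> nat \<Rightarrow> nat list \<Rightarrow> nat list \<Rightarrow> bool" where
  "listed_pair a b d \<alpha>' \<beta>' \<longleftrightarrow>
       \<alpha>' = [b] @ replicate d 1 @ [a] \<and> \<beta>' = [b - 1] @ replicate d 1 @ [a + 1] \<or>
       \<alpha>' = [a, b] @ replicate d 1 \<and> \<beta>' = [b - 1, a + 1] @ replicate d 1 \<or>
       \<alpha>' = replicate (d + 1) 1 @ [a, b - 1] \<and> \<beta>' = replicate (d + 1) 1 @ [b - 1, a] \<or>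
       \<alpha>' = [1, a] @ replicate d 1 @ [b - 1] \<and> \<beta>' = [1, b - 1] @ replicate d 1 @ [a] \<or>
       \<alpha>' = [b - 1] @ replicate d 1 @ [b, a - b + 1] \<and>
       \<beta>' = [b] @ replicate d 1 @ [b - 1, a - b + 1]"

lemma listed_pair_rib:
  assumes "2 \<le> b" "b \<le> a" "listed_pair a b d \<alpha> \<beta>"
  shows "rib f \<alpha> - rib f \<beta> = rib f (a # b # replicate d 1) - rib f ((b - 1) # (a + 1) # replicate d 1)"
  using assms(3) unfolding listed_pair_def
proof (elim disjE conjE)
  assume "\<alpha> = [b] @ replicate d 1 @ [a]" "\<beta> = [b - 1] @ replicate d 1 @ [a + 1]"
  then show ?thesis using rib_family1[OF assms(1), of f d a] by (simp del: rib.simps)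
next
  assume "\<alpha> = [a, b] @ replicate d 1" "\<beta> = [b - 1, a + 1] @ replicate d 1"
  then show ?thesis by (simp del: rib.simps)
next
  assume "\<alpha> = replicate (d + 1) 1 @ [a, b - 1]" "\<beta> = replicate (d + 1) 1 @ [b - 1, a]"
  then show ?thesis using rib_family3[OF assms(1), of f d a] by (simp only:)
next
  assume "\<alpha> = [1, a] @ replicate d 1 @ [b - 1]" "\<beta> = [1, b - 1] @ replicate d 1 @ [a]"
  then show ?thesis using rib_family4[OF assms(1), of f a d] by (simp del: rib.simps)
next
  assume "\<alpha> = [b - 1] @ replicate d 1 @ [b, a - b + 1]" "\<beta> = [b] @ replicate d 1 @ [b - 1, a - b + 1]"
  then show ?thesis using rib_family5[OF assms(1,2), of f d] by (simp del: rib.simps)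
qed

lemma replicate_join: "replicate i x @ x # replicate j x = replicate (i + j + 1) x"
  by (induction i) auto

text \<open>The end row \<open>p = 1\<close> leads to the second family; a longer \<open>p\<close>
  is impossible.\<close>

lemma schur_difference_listed_even:
  assumes S: "schur_difference (p # mx @ [x]) (p # my @ [b - 1]) a b d" and "0 < d"
    and px: "x = a \<and> p = 1 \<or> x = b \<and> p = a - b + 1"
    and m: "mset mx = add_mset b (replicate_mset (d - 1) 1)" "mset my = add_mset (x + 1) (replicate_mset (d - 1) 1)"
  shows "\<exists>\<alpha>'\<in>{p # mx @ [x], rev (p # mx @ [x])}. \<exists>\<beta>'\<in>{p # my @ [b - 1], rev (p # my @ [b - 1])}. listed_pair a b d \<alpha>' \<beta>'"
proof -
  have b: "2 \<le> b" "b \<le> a" using S by (auto simp: schur_difference_def)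
  obtain i j where ij: "mx = replicate i 1 @ b # replicate j 1" "i + j = d - 1" using m(1) by (rule ones_around)
  obtain i' j' where ij': "my = replicate i' 1 @ (x + 1) # replicate j' 1" "i' + j' = d - 1" using m(2) by (rule ones_around)
  show ?thesis
  proof (cases "p = 1")
    case True
    then have x: "x = a" using px b by auto
    have S': "schur_difference (replicate (i + 1) 1 @ b # replicate j 1 @ [a])
        (replicate (i' + 1) 1 @ (a + 1) # replicate j' 1 @ [b - 1]) a b d"
      using S unfolding ij ij' True x by simp
    have "i + j + 1 = d" "i' + j' + 1 = d" using ij ij' \<open>0 < d\<close> by auto
    note j = positions_one_a_even[OF S' this]
    have d: "d = Suc i" using ij j(1) \<open>0 < d\<close> by simp
    have "rev (p # mx @ [x]) = [a, b] @ replicate d 1"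
      unfolding ij True x using j(1) d by (simp add: replicate_append_same)
    moreover have "[b - 1, a + 1] @ replicate d 1 \<in> {p # my @ [b - 1], rev (p # my @ [b - 1])}"
    proof (cases "j' = 0")
      case True
      then show ?thesis using ij' d ij j(1) unfolding x \<open>p = 1\<close> by (simp add: replicate_append_same)
    next
      case False
      \<comment> \<open>Since \<open>b - 1 = 1\<close>, the composition
        \<open>1, a + 1, 1, ..., 1\<close> already has the listed form without reversal.\<close>
      then have "b = 2" "i' = 0" using j(2) by auto
      then show ?thesis using ij' d ij j(1) unfolding x \<open>p = 1\<close> by (simp add: replicate_append_same)
    qed
    ultimately show ?thesis unfolding listed_pair_def by blast
  next
    case False
    then have x: "x = b" "p = a - b + 1" "1 < p" "a = p + b - 1" using px b by auto
    have S': "schur_difference (p # replicate i 1 @ b # replicate j 1 @ [b])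
        (p # replicate i' 1 @ (b + 1) # replicate j' 1 @ [b - 1]) a b d"
      using S unfolding ij ij' x(1) by simp
    have "i + j + 1 = d" "i' + j' + 1 = d" using ij ij' \<open>0 < d\<close> by auto
    then show ?thesis using positions_c_b_even[OF S' _ _ x(3,4)] by blast
  qed
qed

text \<open>The end row \<open>p = 1\<close> leads to the third and fourth families, a longer
  \<open>p\<close> to the fifth.\<close>

lemma schur_difference_listed_odd:
  assumes S: "schur_difference (p # my @ [b - 1]) (p # mx @ [x]) a b d"
    and px: "x = a \<and> p = 1 \<or> x = b \<and> p = a - b + 1"
    and m: "mset mx = add_mset (b - 1) (replicate_mset d 1)" "mset my = add_mset x (replicate_mset d 1)"
  shows "\<exists>\<alpha>'\<in>{p # my @ [b - 1], rev (p # my @ [b - 1])}. \<exists>\<beta>'\<in>{p # mx @ [x], rev (p # mx @ [x])}. listed_pair a b d \<alpha>' \<beta>'"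
proof -
  have b: "2 \<le> b" "b \<le> a" using S by (auto simp: schur_difference_def)
  obtain i j where ij: "mx = replicate i 1 @ (b - 1) # replicate j 1" "i + j = d" using m(1) by (rule ones_around)
  obtain i' j' where ij': "my = replicate i' 1 @ x # replicate j' 1" "i' + j' = d" using m(2) by (rule ones_around)
  show ?thesis
  proof (cases "p = 1")
    case True
    then have x: "x = a" using px b by auto
    have S': "schur_difference (replicate (i' + 1) 1 @ a # replicate j' 1 @ [b - 1])
        (replicate (i + 1) 1 @ (b - 1) # replicate j 1 @ [a]) a b d"
      using S unfolding ij ij' True x by simp
    have A: "p # my @ [b - 1] = replicate (i' + 1) 1 @ a # replicate j' 1 @ [b - 1]"
      and B: "p # mx @ [x] = replicate (i + 1) 1 @ (b - 1) # replicate j 1 @ [a]"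
      unfolding ij ij' True x by simp_all
    \<comment> \<open>For \<open>b = 2\<close> the second members of the third and fourth families
      coincide, so the position of \<open>a\<close> in the first member decides between
      them.\<close>
    have B2: "p # mx @ [x] = replicate (d + 2) 1 @ [a]" if "b = 2"
      unfolding B ij(2)[symmetric] that
      by (simp add: replicate_add replicate_app_Cons_same)
    consider "b = 2" "i' = 0" | "b = 2" "j' = 0" | "i = 0" "i' = 0" | "j = 0" "j' = 0"
      using positions_one_a_odd[OF S' ij(2) ij'(2)] by blast
    then show ?thesis
    proof cases
      case 1
      then have "p # my @ [b - 1] = [1, a] @ replicate d 1 @ [b - 1]" unfolding A using ij' by simp
      moreover have "p # mx @ [x] = [1, b - 1] @ replicate d 1 @ [a]" unfolding B2[OF 1(1)] using 1 by simp
      ultimately show ?thesis unfolding listed_pair_def by blast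
    next
      case 2
      then have "p # my @ [b - 1] = replicate (d + 1) 1 @ [a, b - 1]" unfolding A using ij' by simp
      moreover have "p # mx @ [x] = replicate (d + 1) 1 @ [b - 1, a]" unfolding B2[OF 2(1)] using 2
        by (simp add: replicate_app_Cons_same)
      ultimately show ?thesis unfolding listed_pair_def by blast
    next
      case 3
      then have "p # my @ [b - 1] = [1, a] @ replicate d 1 @ [b - 1]" unfolding A using ij' by simp
      moreover have "p # mx @ [x] = [1, b - 1] @ replicate d 1 @ [a]" unfolding B using 3 ij by simp
      ultimately show ?thesis unfolding listed_pair_def by blast
    next
      case 4
      then have "p # my @ [b - 1] = replicate (d + 1) 1 @ [a, b - 1]" unfolding A using ij' by simp
      moreover have "p # mx @ [x] = replicate (d + 1) 1 @ [b - 1, a]" unfolding B using 4 ij by simp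
      ultimately show ?thesis unfolding listed_pair_def by blast
    qed
  next
    case False
    then have x: "x = b" "p = a - b + 1" "1 < p" "a = p + b - 1" using px b by auto
    have S': "schur_difference (p # replicate i' 1 @ b # replicate j' 1 @ [b - 1])
        (p # replicate i 1 @ (b - 1) # replicate j 1 @ [b]) a b d"
      using S unfolding ij ij' x(1) by simp
    note pos = positions_c_b_odd[OF S' ij(2) ij'(2) x(3,4)]
    have "[b - 1] @ replicate d 1 @ [b, p] \<in> {p # my @ [b - 1], rev (p # my @ [b - 1])}"
      using pos(1)
    proof
      assume "i' = 0"
      then show ?thesis using ij' x(1) by simp
    next
      assume "j' = 0 \<and> p = b - 1"
      then show ?thesis using ij' x(1) by simp
    qed
    moreover have "[b] @ replicate d 1 @ [b - 1, p] \<in> {p # mx @ [x], rev (p # mx @ [x])}"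
      using pos(2)
    proof (elim disjE conjE)
      assume "i = 0"
      then show ?thesis using ij x(1) by simp
    next
      assume "b = 2"
      then have "mx = replicate (i + j + 1) 1" unfolding ij(1) by (simp add: replicate_join)
      then have "rev (p # mx @ [x]) = [b] @ replicate d 1 @ [b - 1, p]"
        using ij(2) x(1) \<open>b = 2\<close> by (simp add: replicate_append_same)
      then show ?thesis by simp
    next
      assume "j = 0" "p = b"
      then show ?thesis using ij x(1) by simp
    qed
    ultimately show ?thesis unfolding listed_pair_def x(2)[symmetric] by blast
  qed
qed

lemma first_middle_last:
  assumes "2 \<le> length xs"
  obtains k mid e where "xs = k # mid @ [e]" "length mid = length xs - 2"
proof -
  obtain k ys where xs: "xs = k # ys" using assms by (cases xs) auto
  then obtain mid e where "ys = mid @ [e]" using assms by (cases ys rule: rev_cases) auto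
  then show ?thesis using that xs by simp
qed

theorem schur_difference_listed:
  assumes S: "schur_difference \<alpha> \<beta> a b d" and l: "length \<alpha> = length \<beta>"
  shows "\<exists>\<alpha>'\<in>{\<alpha>, rev \<alpha>}. \<exists>\<beta>'\<in>{\<beta>, rev \<beta>}. listed_pair a b d \<alpha>' \<beta>'"
proof -
  have b: "2 \<le> b" "b \<le> a" and s: "sum_list \<alpha> = a + b + d" "sum_list \<beta> = a + b + d"
    and c: "0 \<notin> set \<alpha>" "0 \<notin> set \<beta>"
    using S by (auto simp: schur_difference_def composition_def)
  define r where "r = length \<alpha> - (d + 2)"
  have r: "length \<alpha> = d + r + 2" using schur_difference_length[OF S l] by (simp add: r_def)
  obtain k mid e where \<alpha>: "\<alpha> = k # mid @ [e]" "length mid = d + r"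
    using r by (metis add_diff_cancel_right' first_middle_last le_add2)
  obtain k' mid' e' where \<beta>: "\<beta> = k' # mid' @ [e']" "length mid' = d + r"
    using r l by (metis add_diff_cancel_right' first_middle_last le_add2)
  have hyp: "rib f (k # mid @ [e]) - rib f (k' # mid' @ [e'])
      = rib f (a # b # replicate d 1) - rib f ((b - 1) # (a + 1) # replicate d 1)" for f :: "nat \<Rightarrow> int poly poly"
    using schur_difference_rib[OF S, of f] unfolding \<alpha>(1) \<beta>(1) .
  have "0 < b" using b by simp
  note E = ribbon_difference_ends_middles[OF hyp \<alpha>(2) \<beta>(2) this]
  \<comment> \<open>The sign is that of \<open>(-1)^r\<close>; for odd \<open>r\<close> the two
    compositions exchange roles before the end rows are classified.\<close>
  have sgn: "(-1) ^ (d + r + d) = (if even r then 1 else - 1 :: int poly)" by (simp add: minus_one_power_iff)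
  show ?thesis
  proof (cases "even r")
    case True
    have i: "omx k * omx e - omx k' * omx e' = omx 1 * (monom 1 (b - 1) - monom 1 a)"
      using E(1) unfolding sgn using True by simp
    obtain \<alpha>' \<beta>' where 1: "\<alpha>' \<in> {\<alpha>, rev \<alpha>}" "\<beta>' \<in> {\<beta>, rev \<beta>}" and
      2: "r = 0 \<and> \<alpha>' = b # replicate d 1 @ [a] \<and> \<beta>' = (b - 1) # replicate d 1 @ [a + 1] \<or>
      common_end_pair a b d r \<alpha>' \<beta>'"
      using ends_middles_classify[OF \<alpha>(1) \<beta>(1) c \<alpha>(2) \<beta>(2) s b i E(2)] by blast
    have S': "schur_difference \<alpha>' \<beta>' a b d" using schur_difference_rev[OF S 1] .
    have "\<exists>\<alpha>''\<in>{\<alpha>', rev \<alpha>'}. \<exists>\<beta>''\<in>{\<beta>', rev \<beta>'}. listed_pair a b d \<alpha>'' \<beta>''"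
      using 2
    proof (elim disjE conjE)
      assume "\<alpha>' = b # replicate d 1 @ [a]" "\<beta>' = (b - 1) # replicate d 1 @ [a + 1]"
      then have "listed_pair a b d \<alpha>' \<beta>'" by (simp add: listed_pair_def)
      then show ?thesis by blast
    next
      assume "common_end_pair a b d r \<alpha>' \<beta>'"
      then obtain p x mx my where *: "\<alpha>' = p # mx @ [x]" "\<beta>' = p # my @ [b - 1]" "x = a \<and> p = 1 \<or> x = b \<and> p = a - b + 1"
        "0 < d" "mset mx = add_mset b (replicate_mset (d - 1) 1)" "mset my = add_mset (x + 1) (replicate_mset (d - 1) 1)"
        using True unfolding common_end_pair_def by auto
      show ?thesis using schur_difference_listed_even[OF S'[unfolded *(1,2)] *(4,3,5,6)] unfolding *(1,2) .
    qed
    moreover have "{\<alpha>', rev \<alpha>'} = {\<alpha>, rev \<alpha>}" "{\<beta>', rev \<beta>'} = {\<beta>, rev \<beta>}" using 1 by auto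
    ultimately show ?thesis by simp
  next
    case False
    have i: "omx k' * omx e' - omx k * omx e = omx 1 * (monom 1 (b - 1) - monom 1 a)"
      using E(1) unfolding sgn using False by (simp add: algebra_simps)
    have ii: "omx k' * omx e' * (\<Sum>l\<leftarrow>mid'. omx l) - omx k * omx e * (\<Sum>l\<leftarrow>mid. omx l)
        = of_nat d * omx 1 * (omx k' * omx e' - omx k * omx e)"
      using E(2) by (simp add: algebra_simps)
    obtain \<beta>' \<alpha>' where 1: "\<alpha>' \<in> {\<alpha>, rev \<alpha>}" "\<beta>' \<in> {\<beta>, rev \<beta>}" and
      2: "r = 0 \<and> \<beta>' = b # replicate d 1 @ [a] \<and> \<alpha>' = (b - 1) # replicate d 1 @ [a + 1] \<or>
      common_end_pair a b d r \<beta>' \<alpha>'"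
      using ends_middles_classify[OF \<beta>(1) \<alpha>(1) c(2,1) \<beta>(2) \<alpha>(2) s(2,1) b i ii] by blast
    have S': "schur_difference \<alpha>' \<beta>' a b d" using schur_difference_rev[OF S 1] .
    obtain p x mx my where *: "\<beta>' = p # mx @ [x]" "\<alpha>' = p # my @ [b - 1]" "x = a \<and> p = 1 \<or> x = b \<and> p = a - b + 1"
      "mset mx = add_mset (b - 1) (replicate_mset d 1)" "mset my = add_mset x (replicate_mset d 1)"
      using 2 False unfolding common_end_pair_def by auto
    have "\<exists>\<alpha>''\<in>{\<alpha>', rev \<alpha>'}. \<exists>\<beta>''\<in>{\<beta>', rev \<beta>'}. listed_pair a b d \<alpha>'' \<beta>''"
      using schur_difference_listed_odd[OF S'[unfolded *(1,2)] *(3,4,5)] unfolding *(1,2) .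
    moreover have "{\<alpha>', rev \<alpha>'} = {\<alpha>, rev \<alpha>}" "{\<beta>', rev \<beta>'} = {\<beta>, rev \<beta>}" using 1 by auto
    ultimately show ?thesis by simp
  qed
qed

section \<open>Exclusion of hooks and conclusion\<close>

lemma rib_const_2: "\<gamma> \<noteq> [] \<Longrightarrow> rib (\<lambda>_. 2 :: int) \<gamma> = 2"
  by (induction "\<lambda>_::nat. 2 :: int" \<gamma> rule: rib.induct) auto

text \<open>A hook is itself a ribbon. When all \<open>f k\<close> are 2, it has the value 2,
  whereas the difference of two nonempty ribbons has the value 0.\<close>

lemma ribbon_schur_diff_neq_hook:
  assumes "composition \<alpha>" "composition \<beta>" "length \<alpha> = length \<beta>" "\<alpha> \<noteq> []" "0 < k"
  shows "ribbon_schur \<alpha> - ribbon_schur \<beta> \<noteq> schur (k # replicate m 1)"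
proof
  assume "ribbon_schur \<alpha> - ribbon_schur \<beta> = schur (k # replicate m 1)"
  then have "ribbon_schur \<alpha> - ribbon_schur \<beta> = ribbon_schur (k # replicate m 1)"
    by (simp only: schur_def ribbon_schur_def hook_ribbon_eq_young)
  then have "rib (\<lambda>_. 2 :: int) \<alpha> - rib (\<lambda>_. 2) \<beta> = rib (\<lambda>_. 2) (k # replicate m 1)"
    using assms by (intro ribbon_schur_diff_transfer_single) (auto simp: composition_def)
  moreover have "\<beta> \<noteq> []" using assms by auto
  ultimately show False using assms by (simp add: rib_const_2 del: rib.simps)
qed

lemma near_hook_partition:
  assumes "is_partition \<nu>" "part \<nu> 3 \<le> 1" "\<nu> \<noteq> []"
  shows "0 < part \<nu> 1" "part \<nu> 2 \<le> part \<nu> 1"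
    and "part \<nu> 2 \<le> 1 \<Longrightarrow> \<exists>m. \<nu> = part \<nu> 1 # replicate m 1"
    and "2 \<le> part \<nu> 2 \<Longrightarrow> \<nu> = part \<nu> 1 # part \<nu> 2 # replicate (length (drop 2 \<nu>)) 1"
proof -
  obtain a \<mu> where \<nu>: "\<nu> = a # \<mu>" using assms(3) by (cases \<nu>) auto
  have a: "part \<nu> 1 = a" "0 < a" using assms(1) by (auto simp: \<nu> part_def is_partition_def)
  show "0 < part \<nu> 1" using a by simp
  have ones: "xs = replicate (length xs) 1" if "\<forall>p\<in>set xs. 0 < p" "\<forall>p\<in>set xs. p \<le> 1" for xs :: "nat list"
    using that by (intro replicate_eqI) (auto simp: le_Suc_eq)
  show "part \<nu> 2 \<le> part \<nu> 1"
    using assms(1) unfolding a by (cases \<mu>) (auto simp: \<nu> part_def is_partition_def)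
  show "\<exists>m. \<nu> = part \<nu> 1 # replicate m 1" if "part \<nu> 2 \<le> 1"
  proof -
    have "\<forall>p\<in>set \<mu>. p \<le> 1"
      using assms(1) that by (cases \<mu>) (fastforce simp: \<nu> part_def is_partition_def)+
    then have "\<mu> = replicate (length \<mu>) 1" using assms(1) by (intro ones) (auto simp: \<nu> is_partition_def)
    then show ?thesis unfolding a unfolding \<nu> by blast
  qed
  show "\<nu> = part \<nu> 1 # part \<nu> 2 # replicate (length (drop 2 \<nu>)) 1" if b: "2 \<le> part \<nu> 2"
  proof -
    obtain b \<kappa> where \<mu>: "\<mu> = b # \<kappa>" using b by (cases \<mu>) (auto simp: \<nu> part_def)
    have "\<forall>p\<in>set \<kappa>. p \<le> 1"
      using assms(1,2) by (cases \<kappa>) (fastforce simp: \<nu> \<mu> part_def is_partition_def)+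
    then have "\<kappa> = replicate (length \<kappa>) 1" using assms(1) by (intro ones) (auto simp: \<nu> \<mu> is_partition_def)
    then show ?thesis unfolding a unfolding \<nu> \<mu> by (simp add: part_def)
  qed
qed

theorem theorem3p1:
  fixes \<alpha> \<beta> \<nu> :: "nat list" and R N a b d :: nat
  assumes "composition \<alpha>" and "length \<alpha> = R" and "sum_list \<alpha> = N"
    and "composition \<beta>" and "length \<beta> = R" and "sum_list \<beta> = N"
    and "\<alpha> \<noteq> replicate R 1"
    and "is_partition \<nu>" and "sum_list \<nu> = N" and "part \<nu> 3 \<le> 1"
    and "a = part \<nu> 1" and "b = part \<nu> 2" and "d = length (drop 2 \<nu>)"
  shows "ribbon_schur \<alpha> - ribbon_schur \<beta> = schur \<nu> \<longleftrightarrow>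
    2 \<le> b \<and>
    (\<exists>\<alpha>'\<in>{\<alpha>, rev \<alpha>}. \<exists>\<beta>'\<in>{\<beta>, rev \<beta>}.
       \<alpha>' = [b] @ replicate d 1 @ [a] \<and> \<beta>' = [b - 1] @ replicate d 1 @ [a + 1] \<or>
       \<alpha>' = [a, b] @ replicate d 1 \<and> \<beta>' = [b - 1, a + 1] @ replicate d 1 \<or>
       \<alpha>' = replicate (d + 1) 1 @ [a, b - 1] \<and> \<beta>' = replicate (d + 1) 1 @ [b - 1, a] \<or>
       \<alpha>' = [1, a] @ replicate d 1 @ [b - 1] \<and> \<beta>' = [1, b - 1] @ replicate d 1 @ [a] \<or>
       \<alpha>' = [b - 1] @ replicate d 1 @ [b, a - b + 1] \<and>
       \<beta>' = [b] @ replicate d 1 @ [b - 1, a - b + 1])"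
  unfolding listed_pair_def[symmetric]
proof -
  \<comment> \<open>The empty composition is \<open>replicate 0 1\<close>.\<close>
  have "\<alpha> \<noteq> []" using assms(2,7) by auto
  then have "0 < N" using assms(1,3) by (cases \<alpha>) (auto simp: composition_def)
  then have "\<nu> \<noteq> []" using assms(9) by auto
  note nu = near_hook_partition[OF assms(8,10) this]
  have l: "length \<alpha> = length \<beta>" using assms by simp
  show "ribbon_schur \<alpha> - ribbon_schur \<beta> = schur \<nu> \<longleftrightarrow>
    2 \<le> b \<and> (\<exists>\<alpha>'\<in>{\<alpha>, rev \<alpha>}. \<exists>\<beta>'\<in>{\<beta>, rev \<beta>}. listed_pair a b d \<alpha>' \<beta>')"
  proof (cases "2 \<le> b")
    case False
    then obtain m where "\<nu> = part \<nu> 1 # replicate m 1" using nu(3) assms(12) by auto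
    then have "ribbon_schur \<alpha> - ribbon_schur \<beta> \<noteq> schur \<nu>"
      using ribbon_schur_diff_neq_hook[OF assms(1,4) l \<open>\<alpha> \<noteq> []\<close> nu(1), of m] by simp
    then show ?thesis using False by simp
  next
    case True
    have ba: "b \<le> a" using nu(2) assms by simp
    have nu': "\<nu> = a # b # replicate d 1" using nu(4) True assms(11-13) by simp
    then have N: "N = a + b + d" using assms(9) by (simp add: sum_list_replicate)
    have schur: "schur \<nu> = ribbon_schur (a # b # replicate d 1) - ribbon_schur ((b - 1) # (a + 1) # replicate d 1)"
      unfolding nu' by (rule schur_two_rows[OF True ba])
    show ?thesis
    proof
      assume "ribbon_schur \<alpha> - ribbon_schur \<beta> = schur \<nu>"
      then have "schur_difference \<alpha> \<beta> a b d"
        using assms(1,3,4,6) True ba N unfolding schur_difference_def schur by simp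
      then show "2 \<le> b \<and> (\<exists>\<alpha>'\<in>{\<alpha>, rev \<alpha>}. \<exists>\<beta>'\<in>{\<beta>, rev \<beta>}. listed_pair a b d \<alpha>' \<beta>')"
        using schur_difference_listed[OF _ l] True by blast
    next
      assume "2 \<le> b \<and> (\<exists>\<alpha>'\<in>{\<alpha>, rev \<alpha>}. \<exists>\<beta>'\<in>{\<beta>, rev \<beta>}. listed_pair a b d \<alpha>' \<beta>')"
      then obtain \<alpha>' \<beta>' where 1: "\<alpha>' \<in> {\<alpha>, rev \<alpha>}" "\<beta>' \<in> {\<beta>, rev \<beta>}" and 2: "listed_pair a b d \<alpha>' \<beta>'"
        by blast
      have "rib f \<alpha> - rib f \<beta> = rib f \<alpha>' - rib f \<beta>'" for f :: "nat \<Rightarrow> mpoly"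
        using 1 by (auto simp: rib_rev)
      then show "ribbon_schur \<alpha> - ribbon_schur \<beta> = schur \<nu>"
        unfolding schur using listed_pair_rib[OF True ba 2] assms(1,4) True ba
        by (intro ribbon_schur_diff_eqI) (auto simp: composition_def simp del: rib.simps)
    qed
  qed
qed

end
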